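(* Let $\alpha,\beta>-1$ and $0<k<\alpha+1$, and let $W$ be the weight matrix $$W(x)=(1-x)^\alpha(1+x)^\beta\begin{pmatrix}4(\alpha+1)-2k(1-x)&2(\alpha+1-k)(1-x)\\2(\alpha+1-k)(1-x)&(\alpha+1-k)(1-x)^2\end{pmatrix},\qquad x\in(-1,1).$$ Then: i) The algebra $\mathcal D(W)$ is commutative. ii) $\mathcal D(W)$ contains no differential operators of odd order, and it is generated as an algebra by $\{I,D_1,D_2\}$, where $$D_1=\partial^2(1-x^2)I+\partial\begin{pmatrix}\beta-\alpha+1-x(\alpha+\beta+3)&-2\\0&\beta-\alpha-2-x(\alpha+\beta+4)\end{pmatrix}+\begin{pmatrix}\alpha+\beta-k+2&0\\\alpha+1-k&0\end{pmatrix},$$ $$D_2=\partial^2\begin{pmatrix}1-x^2&-2(x+1)\\0&0\end{pmatrix}+\partial\begin{pmatrix}\alpha+\beta-2k+3-x(\alpha+\beta+3)&-2(\alpha+\beta-k+3)\\(1-x)(\alpha+1-k)&-2(\alpha+1-k)\end{pmatrix}+\begin{pmatrix}-k(\alpha+\beta+2-k)&0\\-k(\alpha+1-k)&0\end{pmatrix}.$$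
   Context: Differential operators $D=\sum_{j}\partial^jF_j(x)$, $\partial=\frac{d}{dx}$, act on the right on matrix-valued functions: $P(x)\cdot D=\sum_j \partial^j(P)(x)F_j(x)$; the product satisfies $P\cdot(D_1D_2)=(P\cdot D_1)\cdot D_2$. $\operatorname{Mat}_N(\Omega[x])$ is the algebra of such operators with all $F_j\in\operatorname{Mat}_N(\mathbb C)[x]$. For a weight matrix $W$ of size $N$ on an interval (smooth, positive definite almost everywhere, with finite moments), the monic orthogonal polynomials $P_n$ are those with leading coefficient $I$, degree $n$, and $\int P_nWP_m^*\,dx=0$ for $n\neq m$; $\mathcal D(W)$ is the complex algebra of all $D\in\operatorname{Mat}_N(\Omega[x])$ such that for every $n\ge0$ there is $\Lambda_n(D)\in\operatorname{Mat}_N(\mathbb C)$ with $P_n\cdot D=\Lambda_n(D)P_n$. *)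

theory Defs
  imports "HOL-Analysis.Analysis" "HOL-Computational_Algebra.Polynomial"
begin

section \<open>Matrix polynomials\<close>

text \<open>The product of matrices is \<open>**\<close>; the type-class product \<open>*\<close> on \<open>'a^'n^'n\<close> is entrywise
  and is not used.\<close>

type_synonym 'n cmat = "complex^'n^'n"
type_synonym 'n pmat = "complex poly^'n^'n"

definition pmat_eval :: "'n::finite pmat \<Rightarrow> real \<Rightarrow> 'n cmat"
  where "pmat_eval P x = map_matrix (\<lambda>p. poly p (of_real x)) P"

definition pmat_const :: "'n::finite cmat \<Rightarrow> 'n pmat"
  where "pmat_const A = map_matrix (\<lambda>c. [:c:]) A"

definition pmat_deriv :: "'n::finite pmat \<Rightarrow> 'n pmat"
  where "pmat_deriv P = map_matrix pderiv P"

definition monic_pmat :: "nat \<Rightarrow> 'n::finite pmat \<Rightarrow> bool"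
  where "monic_pmat n P \<longleftrightarrow>
    (\<forall>r s. degree (P $ r $ s) \<le> n) \<and> (\<chi> r s. coeff (P $ r $ s) n) = mat 1"

definition adjoint_cmat :: "'n::finite cmat \<Rightarrow> 'n cmat"
  where "adjoint_cmat A = map_matrix cnj (transpose A)"

lemma pmat_deriv_nth [simp]: "pmat_deriv P $ r $ s = pderiv (P $ r $ s)"
  by (simp add: pmat_deriv_def)

lemma pmat_deriv_funpow_nth [simp]: "(pmat_deriv ^^ n) P $ r $ s = (pderiv ^^ n) (P $ r $ s)"
  by (induction n) auto

lemma pmat_deriv_funpow_0 [simp]: "(pmat_deriv ^^ n) 0 = 0"
  by (simp add: vec_eq_iff higher_pderiv_0)

lemma matrix_mul_nth: "(A ** B) $ r $ s = (\<Sum>q\<in>UNIV. A $ r $ q * B $ q $ s)"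
  by (simp add: matrix_matrix_mult_def)

lemma matrix_mul_add_left: "(A + B) ** (C :: 'a::semiring_1^'n^'m) = A ** C + B ** C"
  by (simp add: vec_eq_iff matrix_mul_nth distrib_right sum.distrib)

lemma matrix_mul_zero_left [simp]: "(0 :: 'a::semiring_1^'n^'m) ** B = 0"
  and matrix_mul_zero_right [simp]: "A ** (0 :: 'a::semiring_1^'n^'m) = 0"
  by (simp_all add: vec_eq_iff matrix_mul_nth)

lemma matrix_mul_sum_left: "(\<Sum>i\<in>I. f i) ** (B :: 'a::semiring_1^'n^'m) = (\<Sum>i\<in>I. f i ** B)"
  by (induction I rule: infinite_finite_induct) (simp_all add: matrix_mul_add_left)

lemma matrix_mul_sum_right: "(A :: 'a::semiring_1^'n^'m) ** (\<Sum>i\<in>I. f i) = (\<Sum>i\<in>I. A ** f i)"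
  by (induction I rule: infinite_finite_induct) (simp_all add: matrix_add_ldistrib)

lemma map_matrix_mult_zero [simp]:
  "map_matrix ((*) c) (0 :: 'a::semiring_0^'n^'m) = 0" "map_matrix ((*) 0) (A :: 'a::semiring_0^'n^'m) = 0"
  by (simp_all add: map_matrix_def vec_eq_iff)

lemma mat_matrix_mul: "mat c ** A = map_matrix ((*) (c :: 'a::semiring_1)) A"
  by (simp add: vec_eq_iff matrix_mul_nth mat_def if_distrib[of "\<lambda>x. x * _"] cong: if_cong)

lemma higher_pderiv_Leibniz:
  fixes p q :: "'a::{comm_semiring_1,semiring_no_zero_divisors} poly"
  shows "(pderiv ^^ n) (p * q) =
    (\<Sum>l\<le>n. of_nat (n choose l) * ((pderiv ^^ l) p * (pderiv ^^ (n - l)) q))"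
proof (induction n)
  case 0
  then show ?case by simp
next
  case (Suc n)
  let ?f = "\<lambda>l m. (pderiv ^^ l) p * (pderiv ^^ m) q"
  have d: "pderiv (of_nat c * r) = of_nat c * pderiv r" for c and r :: "'a poly"
    by (simp add: pderiv_mult)
  have s: "pderiv (\<Sum>i\<in>I. g i) = (\<Sum>i\<in>I. pderiv (g i))" for I :: "nat set" and g :: "nat \<Rightarrow> 'a poly"
    using higher_pderiv_sum[of 1 g I] by simp
  have "(pderiv ^^ Suc n) (p * q) =
      (\<Sum>l\<le>n. of_nat (n choose l) * pderiv (?f l (n - l)))"
    by (simp add: Suc.IH s d)
  also have "\<dots> = (\<Sum>l\<le>n. of_nat (n choose l) * (?f (Suc l) (n - l) + ?f l (Suc n - l)))"
    by (intro sum.cong) (auto simp: pderiv_mult Suc_diff_le algebra_simps)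
  also have "\<dots> = (\<Sum>l\<le>n. of_nat (n choose l) * ?f (Suc l) (n - l)) +
      (\<Sum>l\<le>n. of_nat (n choose l) * ?f l (Suc n - l))"
    by (simp add: distrib_left sum.distrib)
  also have "(\<Sum>l\<le>n. of_nat (n choose l) * ?f l (Suc n - l)) =
      (\<Sum>l\<le>Suc n. of_nat (n choose l) * ?f l (Suc n - l))"
    by (simp add: binomial_eq_0)
  also have "\<dots> = ?f 0 (Suc n) + (\<Sum>l\<le>n. of_nat (n choose Suc l) * ?f (Suc l) (n - l))"
    by (subst sum.atMost_Suc_shift) simp
  also have "(\<Sum>l\<le>n. of_nat (n choose l) * ?f (Suc l) (n - l)) + \<dots> =
      ?f 0 (Suc n) + (\<Sum>l\<le>n. of_nat (Suc n choose Suc l) * ?f (Suc l) (n - l))"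
    by (simp add: sum.distrib algebra_simps)
  also have "\<dots> = (\<Sum>l\<le>Suc n. of_nat (Suc n choose l) * ?f l (Suc n - l))"
    by (subst sum.atMost_Suc_shift) simp
  finally show ?case .
qed

lemma pmat_deriv_funpow_add:
  "(pmat_deriv ^^ n) (A + B) = (pmat_deriv ^^ n) A + (pmat_deriv ^^ n) B"
  by (simp add: vec_eq_iff higher_pderiv_add)

lemma pmat_deriv_funpow_sum:
  "(pmat_deriv ^^ n) (\<Sum>i\<in>I. f i) = (\<Sum>i\<in>I. (pmat_deriv ^^ n) (f i))"
  by (induction I rule: infinite_finite_induct) (simp_all add: pmat_deriv_funpow_add)

lemma pmat_deriv_Leibniz:
  "(pmat_deriv ^^ n) (A ** B) =
    (\<Sum>l\<le>n. map_matrix ((*) (of_nat (n choose l))) ((pmat_deriv ^^ l) A ** (pmat_deriv ^^ (n - l)) B))"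
  by (simp add: vec_eq_iff matrix_mul_nth higher_pderiv_sum higher_pderiv_Leibniz sum_distrib_left
      sum.swap[of _ UNIV])

section \<open>Matrix differential operators with polynomial coefficients\<close>

text \<open>An operator \<open>\<Sum>j. \<partial>\<^sup>j F\<^sub>j(x)\<close> is the finitely supported sequence of its coefficients \<open>F\<^sub>j\<close>,
  written to the right of the powers of \<open>\<partial>\<close>.\<close>

typedef (overloaded) 'n dop = "{F :: nat \<Rightarrow> 'n::finite pmat. finite {j. F j \<noteq> 0}}"
  morphisms dop_coeff Abs_dop
  by (rule exI[of _ "\<lambda>_. 0"]) simp

lemma finite_dop_coeff [simp, intro]: "finite {j. dop_coeff D j \<noteq> 0}"
  using dop_coeff by blast

lemma dop_eqI: "(\<And>j. dop_coeff D j = dop_coeff E j) \<Longrightarrow> D = E"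
  by (simp add: dop_coeff_inject[symmetric] fun_eq_iff)

text \<open>The right action \<open>P \<cdot> D\<close>.\<close>

definition dop_act :: "'n::finite pmat \<Rightarrow> 'n dop \<Rightarrow> 'n pmat"
  where "dop_act P D = (\<Sum>j | dop_coeff D j \<noteq> 0. (pmat_deriv ^^ j) P ** dop_coeff D j)"

definition dop_order :: "'n::finite dop \<Rightarrow> nat"
  where "dop_order D = (LEAST n. \<forall>j>n. dop_coeff D j = 0)"

definition dop_mat :: "'n::finite pmat \<Rightarrow> 'n dop"
  where "dop_mat F = Abs_dop (\<lambda>j. if j = 0 then F else 0)"

definition dop_del :: "'n::finite dop"
  where "dop_del = Abs_dop (\<lambda>j. if j = 1 then mat 1 else 0)"

definition dop_scale :: "complex \<Rightarrow> 'n::finite dop \<Rightarrow> 'n dop"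
  where "dop_scale c D = Abs_dop (\<lambda>j. map_matrix (smult c) (dop_coeff D j))"

lemma dop_coeff_Abs: "finite {j. F j \<noteq> 0} \<Longrightarrow> dop_coeff (Abs_dop F) = F"
  by (rule Abs_dop_inverse) simp

lemma dop_coeff_mat [simp]: "dop_coeff (dop_mat F) j = (if j = 0 then F else 0)"
  unfolding dop_mat_def by (subst dop_coeff_Abs) (auto intro: finite_subset[of _ "{0}"])

lemma dop_coeff_del [simp]: "dop_coeff dop_del j = (if j = 1 then mat 1 else 0)"
  unfolding dop_del_def by (subst dop_coeff_Abs) (auto intro: finite_subset[of _ "{1}"])

lemma dop_coeff_scale [simp]: "dop_coeff (dop_scale c D) j = map_matrix (smult c) (dop_coeff D j)"
  unfolding dop_scale_def
  by (subst dop_coeff_Abs) (auto intro!: finite_subset[OF _ finite_dop_coeff[of D]] simp: vec_eq_iff)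

text \<open>The product is the one determined by \<open>P \<cdot> (D E) = (P \<cdot> D) \<cdot> E\<close>: by the Leibniz rule the
  coefficient of \<open>\<partial>\<^sup>m\<close> in \<open>(\<Sum>i. \<partial>\<^sup>i F\<^sub>i) (\<Sum>j. \<partial>\<^sup>j G\<^sub>j)\<close> is the sum of
  \<open>(j choose l) F\<^sub>i\<^bsup>(j - l)\<^esup> G\<^sub>j\<close> over all \<open>i + l = m\<close> and \<open>j\<close>; see \<open>dop_act_times\<close> below.\<close>

instantiation dop :: (finite) "{zero,one,plus,minus,uminus,times}"
begin

definition zero_dop :: "'a dop"
  where "0 = Abs_dop (\<lambda>_. 0 :: 'a pmat)"

definition one_dop :: "'a dop"
  where "1 = dop_mat (mat 1 :: 'a pmat)"

definition plus_dop :: "'a dop \<Rightarrow> 'a dop \<Rightarrow> 'a dop"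
  where "D + E = Abs_dop (\<lambda>j. dop_coeff D j + dop_coeff E j)"

definition minus_dop :: "'a dop \<Rightarrow> 'a dop \<Rightarrow> 'a dop"
  where "D - E = Abs_dop (\<lambda>j. dop_coeff D j - dop_coeff E j)"

definition uminus_dop :: "'a dop \<Rightarrow> 'a dop"
  where "- D = Abs_dop (\<lambda>j. - dop_coeff D j)"

definition times_dop :: "'a dop \<Rightarrow> 'a dop \<Rightarrow> 'a dop"
  where "D * E = Abs_dop (\<lambda>m. \<Sum>i\<le>m. \<Sum>j | dop_coeff E j \<noteq> 0.
    map_matrix ((*) (of_nat (j choose (m - i))))
      ((pmat_deriv ^^ (j - (m - i))) (dop_coeff D i) ** dop_coeff E j))"

instance ..

end

lemma dop_coeff_zero [simp]: "dop_coeff 0 j = 0"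
  by (simp add: zero_dop_def dop_coeff_Abs)

lemma dop_coeff_plus [simp]: "dop_coeff (D + E) j = dop_coeff D j + dop_coeff E j"
  unfolding plus_dop_def
  by (subst dop_coeff_Abs)
    (auto intro!: finite_subset[OF _ finite_UnI[OF finite_dop_coeff[of D] finite_dop_coeff[of E]]])

lemma dop_coeff_minus [simp]: "dop_coeff (D - E) j = dop_coeff D j - dop_coeff E j"
  unfolding minus_dop_def
  by (subst dop_coeff_Abs)
    (auto intro!: finite_subset[OF _ finite_UnI[OF finite_dop_coeff[of D] finite_dop_coeff[of E]]])

lemma dop_coeff_uminus [simp]: "dop_coeff (- D) j = - dop_coeff D j"
  by (simp add: uminus_dop_def dop_coeff_Abs)

lemma dop_coeff_times:
  "dop_coeff (D * E) m = (\<Sum>i\<le>m. \<Sum>j | dop_coeff E j \<noteq> 0.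
    map_matrix ((*) (of_nat (j choose (m - i))))
      ((pmat_deriv ^^ (j - (m - i))) (dop_coeff D i) ** dop_coeff E j))"
proof -
  obtain N where N: "\<And>j. dop_coeff D j \<noteq> 0 \<Longrightarrow> j < N"
    using finite_dop_coeff[of D] unfolding finite_nat_set_iff_bounded by blast
  obtain K where K: "\<And>j. dop_coeff E j \<noteq> 0 \<Longrightarrow> j < K"
    using finite_dop_coeff[of E] unfolding finite_nat_set_iff_bounded by blast
  let ?c = "\<lambda>m. \<Sum>i\<le>m. \<Sum>j | dop_coeff E j \<noteq> 0. map_matrix ((*) (of_nat (j choose (m - i))))
      ((pmat_deriv ^^ (j - (m - i))) (dop_coeff D i) ** dop_coeff E j)"
  have "?c m = 0" if m: "m \<ge> N + K" for m
  proof (intro sum.neutral ballI)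
    fix i j assume i: "i \<in> {..m}" and j: "j \<in> {j. dop_coeff E j \<noteq> 0}"
    have "dop_coeff D i = 0 \<or> j < m - i"
      using N[of i] K[of j] m i j by fastforce
    then show "map_matrix ((*) (of_nat (j choose (m - i))))
        ((pmat_deriv ^^ (j - (m - i))) (dop_coeff D i) ** dop_coeff E j) = 0"
      by (auto simp: binomial_eq_0)
  qed
  then have "{m. ?c m \<noteq> 0} \<subseteq> {..<N + K}"
    by (metis (mono_tags, lifting) lessThan_iff mem_Collect_eq not_le subsetI)
  then have "finite {m. ?c m \<noteq> 0}"
    by (rule finite_subset) (rule finite_lessThan)
  then show ?thesis
    unfolding times_dop_def by (simp only: dop_coeff_Abs)
qed

lemma dop_coeff_bounded: "\<exists>N. \<forall>j\<ge>N. dop_coeff D j = 0"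
  using finite_dop_coeff[of D] unfolding finite_nat_set_iff_bounded
  by (metis (mono_tags) mem_Collect_eq not_le)

lemma dop_act_bounded:
  assumes "\<And>j. j \<ge> N \<Longrightarrow> dop_coeff D j = 0"
  shows "dop_act P D = (\<Sum>j<N. (pmat_deriv ^^ j) P ** dop_coeff D j)"
  unfolding dop_act_def by (rule sum.mono_neutral_left) (use assms not_le in auto)

lemma dop_coeff_times_bounded:
  assumes "\<And>j. j \<ge> K \<Longrightarrow> dop_coeff E j = 0"
  shows "dop_coeff (D * E) m = (\<Sum>i\<le>m. \<Sum>j<K. map_matrix ((*) (of_nat (j choose (m - i))))
    ((pmat_deriv ^^ (j - (m - i))) (dop_coeff D i) ** dop_coeff E j))"
proof -
  have "(\<Sum>j | dop_coeff E j \<noteq> 0. map_matrix ((*) (of_nat (j choose (m - i))))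
      ((pmat_deriv ^^ (j - (m - i))) (dop_coeff D i) ** dop_coeff E j)) =
    (\<Sum>j<K. map_matrix ((*) (of_nat (j choose (m - i))))
      ((pmat_deriv ^^ (j - (m - i))) (dop_coeff D i) ** dop_coeff E j))" for i
  proof (rule sum.mono_neutral_left)
    show "{j. dop_coeff E j \<noteq> 0} \<subseteq> {..<K}"
      using assms not_le by auto
    show "\<forall>j\<in>{..<K} - {j. dop_coeff E j \<noteq> 0}. map_matrix ((*) (of_nat (j choose (m - i))))
        ((pmat_deriv ^^ (j - (m - i))) (dop_coeff D i) ** dop_coeff E j) = 0"
      by simp
  qed simp
  then show ?thesis
    by (simp only: dop_coeff_times)
qed

lemma dop_act_times: "dop_act P (D * E) = dop_act (dop_act P D) E"
proof -
  obtain N where N: "\<And>j. j \<ge> N \<Longrightarrow> dop_coeff D j = 0" using dop_coeff_bounded[of "D"] by blast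
  obtain K where K: "\<And>j. j \<ge> K \<Longrightarrow> dop_coeff E j = 0" using dop_coeff_bounded[of "E"] by blast
  obtain L where L: "\<And>j. j \<ge> L \<Longrightarrow> dop_coeff (D * E) j = 0" using dop_coeff_bounded[of "D * E"] by blast
  define M where "M = max L (N + K)"
  define h where "h j i l = map_matrix ((*) (of_nat (j choose l)))
    ((pmat_deriv ^^ (i + l)) P ** ((pmat_deriv ^^ (j - l)) (dop_coeff D i) ** dop_coeff E j))"
    for i j l
  have scale: "A ** map_matrix ((*) c) B = map_matrix ((*) c) (A ** B)"
    "map_matrix ((*) c) A ** B = map_matrix ((*) c) (A ** B)" for c and A B :: "'a pmat"
    by (simp_all add: vec_eq_iff matrix_mul_nth sum_distrib_left mult_ac)
  have "dop_act P (D * E) = (\<Sum>m<M. (pmat_deriv ^^ m) P ** dop_coeff (D * E) m)"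
    by (rule dop_act_bounded) (simp add: L M_def)
  also have "\<dots> = (\<Sum>m<M. \<Sum>i\<le>m. \<Sum>j<K. h j i (m - i))"
    by (simp add: dop_coeff_times_bounded[OF K] matrix_mul_sum_right scale h_def)
  also have "\<dots> = (\<Sum>j<K. \<Sum>m<M. \<Sum>i\<le>m. h j i (m - i))"
  proof -
    have "(\<Sum>m<M. \<Sum>i\<le>m. \<Sum>j<K. h j i (m - i)) = (\<Sum>m<M. \<Sum>j<K. \<Sum>i\<le>m. h j i (m - i))"
      by (intro sum.cong refl sum.swap)
    then show ?thesis
      using sum.swap by simp
  qed
  also have "\<dots> = (\<Sum>j<K. \<Sum>i<N. \<Sum>l\<le>j. h j i l)"
  proof (rule sum.cong[OF refl])
    fix j assume j: "j \<in> {..<K}"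
    have "(\<Sum>m<M. \<Sum>i\<le>m. h j i (m - i)) = (\<Sum>(i, l)\<in>{(i, l). i + l < M}. h j i l)"
      by (rule sum.triangle_reindex[symmetric])
    also have "\<dots> = (\<Sum>(i, l)\<in>{..<N} \<times> {..j}. h j i l)"
    proof (rule sum.mono_neutral_right)
      show "finite {(i, l). i + l < M}"
        by (rule finite_subset[of _ "{..<M} \<times> {..<M}"]) auto
      show "{..<N} \<times> {..j} \<subseteq> {(i, l). i + l < M}"
        using j by (auto simp: M_def)
      show "\<forall>x\<in>{(i, l). i + l < M} - {..<N} \<times> {..j}. (case x of (i, l) \<Rightarrow> h j i l) = 0"
        using N by (auto simp: h_def binomial_eq_0 not_less Ball_def)

    qed
    finally show "(\<Sum>m<M. \<Sum>i\<le>m. h j i (m - i)) = (\<Sum>i<N. \<Sum>l\<le>j. h j i l)"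
      by (simp add: sum.cartesian_product)
  qed
  also have "\<dots> = (\<Sum>j<K. (pmat_deriv ^^ j) (dop_act P D) ** dop_coeff E j)"
  proof (rule sum.cong[OF refl])
    fix j
    have "(pmat_deriv ^^ l) ((pmat_deriv ^^ i) P) = (pmat_deriv ^^ (i + l)) P" for i l
      by (simp add: funpow_add add.commute[of i l])
    then show "(\<Sum>i<N. \<Sum>l\<le>j. h j i l) = (pmat_deriv ^^ j) (dop_act P D) ** dop_coeff E j"
      by (simp add: dop_act_bounded[OF N] pmat_deriv_funpow_sum matrix_mul_sum_left
          pmat_deriv_Leibniz scale h_def matrix_mul_assoc)
  qed
  also have "\<dots> = dop_act (dop_act P D) E"
    by (rule dop_act_bounded[OF K, symmetric])
  finally show ?thesis .
qed

lemma dop_eq_by_act: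
  fixes D E :: "'n::finite dop"
  assumes "\<And>P. dop_act P D = dop_act P E"
  shows "D = E"
proof -
  have "dop_coeff D j = dop_coeff E j" for j
  proof (induction j rule: less_induct)
    case (less j)
    obtain N where N: "\<And>i. i \<ge> N \<Longrightarrow> dop_coeff D i = 0" using dop_coeff_bounded[of "D"] by blast
    obtain K where K: "\<And>i. i \<ge> K \<Longrightarrow> dop_coeff E i = 0" using dop_coeff_bounded[of "E"] by blast
    define M where "M = max (Suc j) (max N K)"
    define P :: "'n pmat" where "P = mat (monom 1 j)"
    have dP: "(pmat_deriv ^^ i) P = mat ((pderiv ^^ i) (monom 1 j))" for i
      by (simp add: vec_eq_iff P_def mat_def higher_pderiv_0)
    have act: "dop_act P F = (\<Sum>i<j. (pmat_deriv ^^ i) P ** dop_coeff F i)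
        + map_matrix ((*) [:fact j:]) (dop_coeff F j)"
      if F: "\<And>i. i \<ge> M \<Longrightarrow> dop_coeff F i = 0" for F :: "'n dop"
    proof -
      have z: "(pmat_deriv ^^ i) P = 0" if "i > j" for i
      proof -
        have "(pderiv ^^ i) (monom 1 j :: complex poly) = 0"
          using that by (auto simp: poly_eq_iff coeff_higher_pderiv)
        then show ?thesis by (simp add: dP vec_eq_iff mat_def)
      qed
      have "(pderiv ^^ j) (monom 1 j :: complex poly) = [:fact j:]"
        by (auto simp: poly_eq_iff coeff_higher_pderiv pochhammer_fact coeff_pCons split: nat.splits)
      then have e: "(pmat_deriv ^^ j) P ** dop_coeff F j = map_matrix ((*) [:fact j:]) (dop_coeff F j)"
        by (simp only: dP mat_matrix_mul)
      have "dop_act P F = (\<Sum>i<M. (pmat_deriv ^^ i) P ** dop_coeff F i)"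
        by (rule dop_act_bounded) (rule F)
      also have "\<dots> = (\<Sum>i<Suc j. (pmat_deriv ^^ i) P ** dop_coeff F i)"
        by (rule sum.mono_neutral_right) (auto simp: M_def z)
      finally have "dop_act P F = (\<Sum>i<Suc j. (pmat_deriv ^^ i) P ** dop_coeff F i)" .
      then show ?thesis
        by (simp only: sum.lessThan_Suc e)
    qed
    have "map_matrix ((*) [:fact j:]) (dop_coeff D j) = map_matrix ((*) [:fact j:]) (dop_coeff E j)"
    proof -
      have "dop_act P D = dop_act P E" by (rule assms)
      moreover have "(\<Sum>i<j. (pmat_deriv ^^ i) P ** dop_coeff D i) =
          (\<Sum>i<j. (pmat_deriv ^^ i) P ** dop_coeff E i)"
        by (rule sum.cong) (simp_all add: less)
      moreover have "i \<ge> M \<Longrightarrow> dop_coeff D i = 0" "i \<ge> M \<Longrightarrow> dop_coeff E i = 0" for i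
        using N K by (simp_all add: M_def)
      ultimately show ?thesis
        using act[of D] act[of E] by simp
    qed
    then show ?case by (simp add: vec_eq_iff poly_eq_iff)
  qed
  then show ?thesis by (rule dop_eqI)
qed

lemma dop_act_add_left: "dop_act (P + Q) D = dop_act P D + dop_act Q D"
  by (simp add: dop_act_def pmat_deriv_funpow_add matrix_mul_add_left sum.distrib)

lemma dop_act_add_right: "dop_act P (D + E) = dop_act P D + dop_act P E"
proof -
  obtain N where N: "\<And>j. j \<ge> N \<Longrightarrow> dop_coeff D j = 0" using dop_coeff_bounded[of "D"] by blast
  obtain K where K: "\<And>j. j \<ge> K \<Longrightarrow> dop_coeff E j = 0" using dop_coeff_bounded[of "E"] by blast
  show ?thesis
    using dop_act_bounded[of "max N K" D P] dop_act_bounded[of "max N K" E P]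
      dop_act_bounded[of "max N K" "D + E" P] N K
    by (simp add: matrix_add_ldistrib sum.distrib)
qed

lemma dop_act_zero [simp]: "dop_act P 0 = 0"
  by (simp add: dop_act_def)

lemma dop_act_zero_left [simp]: "dop_act 0 D = 0"
  by (simp add: dop_act_def)

lemma dop_act_mat [simp]: "dop_act P (dop_mat F) = P ** F"
  using dop_act_bounded[of 1 "dop_mat F" P] by simp

lemma dop_act_one [simp]: "dop_act P 1 = P"
  by (simp add: one_dop_def)

lemma dop_act_del [simp]: "dop_act P dop_del = pmat_deriv P"
  using dop_act_bounded[of 2 dop_del P] by (simp add: numeral_2_eq_2)

instance dop :: (finite) ring_1
proof
  fix D E F :: "'a dop"
  show "D + E + F = D + (E + F)" "D + E = E + D" "0 + D = D" "- D + D = 0" "D - E = D + - E"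
    by (auto intro!: dop_eqI)
  show "D * E * F = D * (E * F)" "(D + E) * F = D * F + E * F" "D * (E + F) = D * E + D * F"
    "1 * D = D" "D * 1 = D"
    by (rule dop_eq_by_act, simp add: dop_act_times dop_act_add_left dop_act_add_right)+
  have "dop_coeff (0 :: 'a dop) 0 $ undefined $ undefined \<noteq> dop_coeff 1 0 $ undefined $ undefined"
    by (simp add: one_dop_def mat_def)
  then show "(0 :: 'a dop) \<noteq> 1"
    by metis
qed

text \<open>The complex subalgebra generated by a set of operators (the unit has to be listed among the
  generators).\<close>

inductive_set dop_algebra_generated :: "'n::finite dop set \<Rightarrow> 'n dop set" for S
  where
    zero: "0 \<in> dop_algebra_generated S"
  | gen: "D \<in> S \<Longrightarrow> D \<in> dop_algebra_generated S"
  | add: "D \<in> dop_algebra_generated S \<Longrightarrow> E \<in> dop_algebra_generated S \<Longrightarrow>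
      D + E \<in> dop_algebra_generated S"
  | scale: "D \<in> dop_algebra_generated S \<Longrightarrow> dop_scale c D \<in> dop_algebra_generated S"
  | mult: "D \<in> dop_algebra_generated S \<Longrightarrow> E \<in> dop_algebra_generated S \<Longrightarrow>
      D * E \<in> dop_algebra_generated S"

section \<open>Matrix orthogonal polynomials\<close>

text \<open>A weight is a function \<open>W\<close> on the real line of which only the values on the interval \<open>S\<close>
  matter.\<close>

definition monic_orthogonal ::
    "real set \<Rightarrow> (real \<Rightarrow> 'n::finite cmat) \<Rightarrow> (nat \<Rightarrow> 'n pmat) \<Rightarrow> bool"
  where "monic_orthogonal S W P \<longleftrightarrow>
    (\<forall>n. monic_pmat n (P n)) \<and>
    (\<forall>n m. n \<noteq> m \<longrightarrow>
      set_integrable lborel S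
        (\<lambda>x. pmat_eval (P n) x ** W x ** adjoint_cmat (pmat_eval (P m) x)) \<and>
      (LINT x:S|lborel. pmat_eval (P n) x ** W x ** adjoint_cmat (pmat_eval (P m) x)) = 0)"

definition monic_orthogonal_polys ::
    "real set \<Rightarrow> (real \<Rightarrow> 'n::finite cmat) \<Rightarrow> nat \<Rightarrow> 'n pmat"
  where "monic_orthogonal_polys S W = (THE P. monic_orthogonal S W P)"

definition weight_algebra :: "real set \<Rightarrow> (real \<Rightarrow> 'n::finite cmat) \<Rightarrow> 'n dop set"
  where "weight_algebra S W =
    {D. \<forall>n. \<exists>\<Lambda>. dop_act (monic_orthogonal_polys S W n) D =
                pmat_const \<Lambda> ** monic_orthogonal_polys S W n}"

section \<open>The Jacobi-type weight and its operators\<close>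

definition mat2 :: "'a::zero \<Rightarrow> 'a \<Rightarrow> 'a \<Rightarrow> 'a \<Rightarrow> 'a^2^2"
  where "mat2 a b c d = vector [vector [a, b], vector [c, d]]"

definition dop_real_mat :: "real poly^'n^'n \<Rightarrow> 'n::finite dop"
  where "dop_real_mat F = dop_mat (map_matrix (map_poly complex_of_real) F)"

definition jacobi_weight :: "real \<Rightarrow> real \<Rightarrow> real \<Rightarrow> real \<Rightarrow> 2 cmat"
  where "jacobi_weight \<alpha> \<beta> k x = map_matrix complex_of_real
    (((1 - x) powr \<alpha> * (1 + x) powr \<beta>) *\<^sub>R
      mat2 (4 * (\<alpha> + 1) - 2 * k * (1 - x))    (2 * (\<alpha> + 1 - k) * (1 - x))
           (2 * (\<alpha> + 1 - k) * (1 - x))        ((\<alpha> + 1 - k) * (1 - x)\<^sup>2))"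

definition jacobi_D1 :: "real \<Rightarrow> real \<Rightarrow> real \<Rightarrow> 2 dop"
  where "jacobi_D1 \<alpha> \<beta> k =
    dop_del\<^sup>2 * dop_real_mat (mat2
      [:1, 0, -1:]    0
      0               [:1, 0, -1:]) +
    dop_del * dop_real_mat (mat2
      [:\<beta> - \<alpha> + 1, - (\<alpha> + \<beta> + 3):]    [:-2:]
      0                              [:\<beta> - \<alpha> - 2, - (\<alpha> + \<beta> + 4):]) +
    dop_real_mat (mat2
      [:\<alpha> + \<beta> - k + 2:]    0
      [:\<alpha> + 1 - k:]        0)"

definition jacobi_D2 :: "real \<Rightarrow> real \<Rightarrow> real \<Rightarrow> 2 dop"
  where "jacobi_D2 \<alpha> \<beta> k =
    dop_del\<^sup>2 * dop_real_mat (mat2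
      [:1, 0, -1:]    [:-2, -2:]
      0               0) +
    dop_del * dop_real_mat (mat2
      [:\<alpha> + \<beta> - 2 * k + 3, - (\<alpha> + \<beta> + 3):]    [:-2 * (\<alpha> + \<beta> - k + 3):]
      [:\<alpha> + 1 - k, - (\<alpha> + 1 - k):]            [:-2 * (\<alpha> + 1 - k):]) +
    dop_real_mat (mat2
      [:- k * (\<alpha> + \<beta> + 2 - k):]    0
      [:- k * (\<alpha> + 1 - k):]        0)"

end

theory Submission
  imports Defs
begin

text \<open>
  The proof rests on first order factorizations. Between scalar polynomials and row vectors there are
  first order differential operators \<open>lift0\<close>, \<open>lift1\<close> (from scalars to rows) and \<open>proj0\<close>, \<open>proj1\<close>
  (back) with \<open>proj0 \<circ> lift1 = 0\<close> and \<open>proj1 \<circ> lift0 = 0\<close>, such that \<open>D\<^sub>2\<close> acts as \<open>lift0 \<circ> proj0\<close> and \<open>D\<^sub>1\<close> as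
  \<open>lift0 \<circ> proj0 + lift1 \<circ> proj1\<close> plus a constant (\<open>row_act_D2\<close>, \<open>row_act_D1\<close>). The compositions
  \<open>proj0 \<circ> lift0\<close> and \<open>proj1 \<circ> lift1\<close> are, up to constants, the scalar Jacobi operators for the exponents
  \<open>(\<alpha> + 1, \<beta>)\<close> and \<open>(\<alpha> + 1, \<beta> + 1)\<close>, and \<open>proj0\<close>, \<open>proj1\<close> are up to factors the adjoints of \<open>lift0\<close>,
  \<open>lift1\<close> for the weight \<open>W\<close>. Consequently, if \<open>h\<^sub>n\<close> and \<open>f\<^sub>n\<close> are the corresponding Jacobi polynomials, the
  rows \<open>lift0 h\<^sub>n\<close> and \<open>lift1 f\<^sub>n\<close> are eigenfunctions of \<open>D\<^sub>1\<close> and \<open>D\<^sub>2\<close>, they are orthogonal to all rows of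
  lower degree, and they span the row space of the monic orthogonal polynomial \<open>P\<^sub>n\<close>
  (\<open>monic_orthogonal_polys_eq\<close>).

  Let \<open>D\<close> belong to \<open>\<D>(W)\<close>. It preserves the span of \<open>lift0 h\<^sub>n\<close> and \<open>lift1 f\<^sub>n\<close> for every \<open>n\<close>. An off-diagonal
  entry would give a nonzero scalar differential operator that maps each \<open>h\<^sub>n\<close> to a multiple of \<open>f\<^sub>n\<close>,
  or conversely. The values of such an operator at \<open>x = 1\<close> and \<open>x = -1\<close> rule this out: the derivatives of
  a Jacobi polynomial at an end point are its value there times polynomials in its eigenvalue, which is
  invariant under a reflection of \<open>n\<close>, whereas \<open>h\<^sub>n(1) f\<^sub>n(-1) / (h\<^sub>n(-1) f\<^sub>n(1)) = (n + \<beta> + 1) / (\<beta> + 1)\<close> is not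
  (\<open>no_intertwiner_up\<close>, \<open>no_intertwiner_down\<close>). So all of \<open>\<D>(W)\<close> is diagonal in one basis, which gives
  commutativity.

  Evaluation at \<open>x = 1\<close> also shows that the eigenvalues of \<open>D\<close> are \<open>A(\<lambda>\<^sub>n)\<close> on \<open>lift0 h\<^sub>n\<close> and \<open>B(\<mu>\<^sub>n)\<close> on \<open>lift1 f\<^sub>n\<close>
  for polynomials \<open>A\<close>, \<open>B\<close>, where \<open>\<lambda>\<^sub>n\<close>, \<open>\<mu>\<^sub>n\<close> are the scalar Jacobi eigenvalues. The pair \<open>(A, B)\<close> satisfies one
  linear condition \<open>A(glue0) = B(glue1)\<close>: at these parameters the power series solutions at \<open>x = 1\<close> of the
  two scalar equations have proportional images under \<open>lift0\<close> and \<open>lift1\<close> (\<open>glued_jets\<close>). The pairs with this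
  condition are exactly those of the operators \<open>p(D\<^sub>1) + q(D\<^sub>2)\<close>, and an operator is determined by its
  pair. Finally, in the common order \<open>2 j\<close> the leading coefficients of \<open>D\<^sub>1\<^sup>j\<close> and \<open>D\<^sub>2\<^sup>j\<close> are linearly
  independent, so all orders are even.
\<close>

section \<open>Integration against a scalar Jacobi weight\<close>

definition jacobi_density :: "real \<Rightarrow> real \<Rightarrow> real \<Rightarrow> real"
  where "jacobi_density a b x = (1 - x) powr a * (1 + x) powr b"

definition jacobi_integral :: "real \<Rightarrow> real \<Rightarrow> complex poly \<Rightarrow> complex"
  where "jacobi_integral a b p =
    (LINT x:{-1<..<1}|lborel. jacobi_density a b x *\<^sub>R poly p (of_real x))"

lemma jacobi_density_pos: "x \<in> {-1<..<1} \<Longrightarrow> 0 < jacobi_density a b x"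
  by (simp add: jacobi_density_def)

lemma jacobi_density_mult:
  assumes "x \<in> {-1<..<1}"
  shows "jacobi_density (a + 1) b x = (1 - x) * jacobi_density a b x"
    and "jacobi_density a (b + 1) x = (1 + x) * jacobi_density a b x"
  using assms by (simp_all add: jacobi_density_def powr_add)

lemma continuous_on_jacobi_density:
  "continuous_on {-1<..<1} (jacobi_density a b)"
  unfolding jacobi_density_def by (intro continuous_intros) auto

text \<open>Near one end point the density is a single power, which has an explicit bounded antiderivative
  because its exponent exceeds \<open>-1\<close>.\<close>

lemma powr_integrable_endpoint:
  fixes a :: real
  assumes "a > -1"
  shows "set_integrable lborel {-1<..<1} (\<lambda>x. (1 - x) powr a)"
    and "set_integrable lborel {-1<..<1} (\<lambda>x. (1 + x) powr a)"
proof -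
  have e: "einterval (ereal (-1)) (ereal 1) = {-1<..<1}"
    by (auto simp: einterval_def)
  have "set_integrable lborel (einterval (ereal (-1)) (ereal 1)) (\<lambda>x. (1 - x) powr a)"
  proof (rule interval_integral_FTC_nonneg(1)[where F = "\<lambda>x. - ((1 - x) powr (a + 1)) / (a + 1)"
        and A = "- (2 powr (a + 1)) / (a + 1)" and B = "0"])
    show "((\<lambda>x. - ((1 - x) powr (a + 1)) / (a + 1)) has_real_derivative (1 - x) powr a) (at x)"
      if "ereal (-1) < ereal x" "ereal x < ereal 1" for x
    proof -
      have "((\<lambda>x. - ((1 - x) powr (a + 1))) has_real_derivative (a + 1) * (1 - x) powr a) (at x)"
        using that by (auto intro!: derivative_eq_intros simp: algebra_simps)
      from DERIV_cdivide[OF this, of "a + 1"] show ?thesis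
        using assms by simp
    qed
    have "((\<lambda>x. - ((1 - x) powr (a + 1)) / (a + 1)) \<longlongrightarrow> - ((1 - (-1)) powr (a + 1)) / (a + 1)) (at_right (-1))"
      using assms by (auto intro!: tendsto_eq_intros)
    then show "(((\<lambda>x. - ((1 - x) powr (a + 1)) / (a + 1)) \<circ> real_of_ereal) \<longlongrightarrow> - (2 powr (a + 1)) / (a + 1))
        (at_right (ereal (-1)))"
      unfolding ereal_tendsto_simps1 by (simp add: o_def)
    have "((\<lambda>x. - ((1 - x) powr (a + 1)) / (a + 1)) \<longlongrightarrow> - ((1 - 1) powr (a + 1)) / (a + 1)) (at_left 1)"
      using assms by (auto intro!: tendsto_eq_intros tendsto_powr' eventually_at_leftI[of 0])
    then show "(((\<lambda>x. - ((1 - x) powr (a + 1)) / (a + 1)) \<circ> real_of_ereal) \<longlongrightarrow> 0) (at_left (ereal 1))"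
      unfolding ereal_tendsto_simps1 by (simp add: o_def)
    show "isCont (\<lambda>x. (1 - x) powr a) x" if "ereal (-1) < ereal x" "ereal x < ereal 1" for x
      using that by (auto intro!: continuous_intros)
  qed auto
  then show 1: "set_integrable lborel {-1<..<1} (\<lambda>x. (1 - x) powr a)"
    by (simp add: e)
  have "integrable lborel (\<lambda>x. indicator {-1<..<1::real} (- x) *\<^sub>R (1 - (- x)) powr a)"
    using lborel_integrable_real_affine[OF 1[unfolded set_integrable_def], of "-1" 0] by simp
  then show "set_integrable lborel {-1<..<1} (\<lambda>x. (1 + x) powr a)"
    unfolding set_integrable_def
    by (rule Bochner_Integration.integrable_cong[THEN iffD1, rotated -1])
      (auto simp: indicator_def)
qed

lemma powr_le_max:
  fixes y a :: real
  assumes "1 \<le> y" "y \<le> 2"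
  shows "y powr a \<le> max 1 (2 powr a)"
proof (cases "a \<ge> 0")
  case True
  then have "y powr a \<le> 2 powr a"
    using assms by (intro powr_mono2) auto
  then show ?thesis by simp
next
  case False
  then have "y powr a \<le> 1 powr a"
    using assms by (intro powr_mono2') auto
  then show ?thesis by simp
qed

lemma set_borel_measurable_continuous_open:
  fixes f :: "real \<Rightarrow> 'a::real_normed_vector"
  assumes "continuous_on {a<..<b} f"
  shows "set_borel_measurable lborel {a<..<b} f"
  using borel_measurable_continuous_on_indicator[OF _ assms]
  by (simp add: set_borel_measurable_def)

text \<open>On either half of the interval one of the two factors of the density stays between positive
  constants, so the density is dominated by a combination of the two end point powers.\<close>

lemma jacobi_density_integrable:
  assumes "a > -1" "b > -1"
  shows "set_integrable lborel {-1<..<1} (jacobi_density a b)"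
proof (rule set_integrable_bound)
  let ?g = "\<lambda>x. max 1 (2 powr b) * (1 - x) powr a + max 1 (2 powr a) * (1 + x) powr b"
  show "set_integrable lborel {-1<..<1} ?g"
    using powr_integrable_endpoint assms by (intro set_integral_add set_integrable_mult_right) auto
  show "set_borel_measurable lborel {-1<..<1} (jacobi_density a b)"
    by (intro set_borel_measurable_continuous_open continuous_on_jacobi_density)
  have "jacobi_density a b x \<le> ?g x" if "x \<in> {-1<..<1}" for x
  proof (cases "x \<ge> 0")
    case True
    then have "(1 + x) powr b \<le> max 1 (2 powr b)"
      using that by (intro powr_le_max) auto
    then have "jacobi_density a b x \<le> max 1 (2 powr b) * (1 - x) powr a"
      unfolding jacobi_density_def by (subst mult.commute) (rule mult_right_mono, auto)
    then show ?thesis by (simp add: add_increasing2)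
  next
    case False
    then have "(1 - x) powr a \<le> max 1 (2 powr a)"
      using that by (intro powr_le_max) auto
    then have "jacobi_density a b x \<le> max 1 (2 powr a) * (1 + x) powr b"
      unfolding jacobi_density_def by (rule mult_right_mono) auto
    then show ?thesis by (simp add: add_increasing)
  qed
  then show "AE x in lborel. x \<in> {-1<..<1} \<longrightarrow> norm (jacobi_density a b x) \<le> norm (?g x)"
    using jacobi_density_pos by (intro AE_I2 impI) (auto simp: less_imp_le)
qed

lemma jacobi_density_poly_integrable:
  assumes "a > -1" "b > -1"
  shows "set_integrable lborel {-1<..<1} (\<lambda>x. jacobi_density a b x *\<^sub>R poly p (complex_of_real x))"
proof -
  have "compact ((\<lambda>x. poly p (complex_of_real x)) ` {-1..1})"
    by (intro compact_continuous_image continuous_intros) auto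
  then obtain K where K: "\<And>x. x \<in> {-1..1} \<Longrightarrow> norm (poly p (complex_of_real x)) \<le> K"
    using compact_imp_bounded[of "(\<lambda>x. poly p (complex_of_real x)) ` {-1..1}"]
    unfolding bounded_iff ball_simps by (meson that)
  show ?thesis
  proof (rule set_integrable_bound)
    show "set_integrable lborel {-1<..<1} (\<lambda>x. K * jacobi_density a b x)"
      using jacobi_density_integrable[OF assms] by (rule set_integrable_mult_right)
    show "set_borel_measurable lborel {-1<..<1} (\<lambda>x. jacobi_density a b x *\<^sub>R poly p (of_real x))"
      by (intro set_borel_measurable_continuous_open continuous_intros continuous_on_jacobi_density)
    have "norm (jacobi_density a b x *\<^sub>R poly p (complex_of_real x)) \<le> norm (K * jacobi_density a b x)"
      if "x \<in> {-1<..<1}" for x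
    proof -
      have "norm (poly p (complex_of_real x)) \<le> K" using that by (intro K) auto
      then have "norm (poly p (complex_of_real x)) * \<bar>jacobi_density a b x\<bar> \<le> \<bar>K\<bar> * \<bar>jacobi_density a b x\<bar>"
        by (intro mult_right_mono) auto
      then show ?thesis by (simp add: abs_mult mult.commute)
    qed
    then show "AE x in lborel. x \<in> {-1<..<1} \<longrightarrow>
        norm (jacobi_density a b x *\<^sub>R poly p (complex_of_real x)) \<le> norm (K * jacobi_density a b x)"
      by (intro AE_I2) auto
  qed
qed

lemma jacobi_integral_add:
  assumes "a > -1" "b > -1"
  shows "jacobi_integral a b (p + q) = jacobi_integral a b p + jacobi_integral a b q"
  unfolding jacobi_integral_def using set_integral_add(2)[OF jacobi_density_poly_integrable[OF assms, of p]
      jacobi_density_poly_integrable[OF assms, of q]]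
  by (simp add: scaleR_add_right)

lemma jacobi_integral_smult:
  "jacobi_integral a b (smult c p) = c * jacobi_integral a b p"
  unfolding jacobi_integral_def
  by (subst set_integral_mult_right[symmetric]) (simp add: mult_scaleR_right)

lemma jacobi_integral_0 [simp]: "jacobi_integral a b 0 = 0"
  by (simp add: jacobi_integral_def)

lemma jacobi_integral_uminus: "jacobi_integral a b (- p) = - jacobi_integral a b p"
  using jacobi_integral_smult[of a b "-1" p] by simp

lemma jacobi_integral_diff:
  assumes "a > -1" "b > -1"
  shows "jacobi_integral a b (p - q) = jacobi_integral a b p - jacobi_integral a b q"
  using jacobi_integral_add[OF assms, of p "- q"] by (simp add: jacobi_integral_uminus)

lemma jacobi_integral_shift:
  "jacobi_integral (a + 1) b p = jacobi_integral a b ([:1, -1:] * p)"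
  "jacobi_integral a (b + 1) p = jacobi_integral a b ([:1, 1:] * p)"
proof -
  have "jacobi_density (a + 1) b x *\<^sub>R poly p (complex_of_real x) =
      jacobi_density a b x *\<^sub>R poly ([:1, -1:] * p) (complex_of_real x)"
    "jacobi_density a (b + 1) x *\<^sub>R poly p (complex_of_real x) =
      jacobi_density a b x *\<^sub>R poly ([:1, 1:] * p) (complex_of_real x)"
    if "x \<in> {-1<..<1}" for x
    unfolding jacobi_density_mult[OF that] by (simp_all add: scaleR_conv_of_real algebra_simps)
  then show "jacobi_integral (a + 1) b p = jacobi_integral a b ([:1, -1:] * p)"
    "jacobi_integral a (b + 1) p = jacobi_integral a b ([:1, 1:] * p)"
    unfolding jacobi_integral_def by (intro set_lebesgue_integral_cong; simp)+
qed

text \<open>The integrand is the derivative of \<open>(1 - x)\<^bsup>a + 1\<^esup> (1 + x)\<^bsup>b + 1\<^esup> p(x)\<close>, which vanishes at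
  both end points. This is the only integral that is ever evaluated: every orthogonality relation
  below is an algebraic consequence of it.\<close>

lemma jacobi_integral_pearson:
  assumes "a > -1" "b > -1"
  shows "jacobi_integral a b ([:1, 0, -1:] * pderiv p + [:of_real (b - a), - of_real (a + b + 2):] * p) = 0"
proof -
  let ?q = "[:1, 0, -1:] * pderiv p + [:of_real (b - a), - of_real (a + b + 2):] * p"
  let ?F = "\<lambda>x. jacobi_density (a + 1) (b + 1) x *\<^sub>R poly p (complex_of_real x)"
  have e: "einterval (ereal (-1)) (ereal 1) = {-1<..<1}"
    by (auto simp: einterval_def)
  have "(LBINT x=ereal (-1)..ereal 1. jacobi_density a b x *\<^sub>R poly ?q (of_real x)) = 0 - 0"
  proof (rule interval_integral_FTC_integrable[where F = ?F])
    fix x assume "ereal (-1) < ereal x" "ereal x < ereal 1"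
    then have x: "x \<in> {-1<..<1}" by simp
    have d: "(jacobi_density (a + 1) (b + 1) has_real_derivative
        jacobi_density a b x * ((b - a) - (a + b + 2) * x)) (at x)"
    proof -
      have "(jacobi_density (a + 1) (b + 1) has_real_derivative
          (1 - x) powr (a + 1) * ((b + 1) * (1 + x) powr b) - (a + 1) * (1 - x) powr a * (1 + x) powr (b + 1)) (at x)"
        unfolding jacobi_density_def [abs_def] using x by (auto intro!: derivative_eq_intros)
      moreover have "(1 - x) powr (a + 1) * ((b + 1) * (1 + x) powr b) - (a + 1) * (1 - x) powr a * (1 + x) powr (b + 1)
        = jacobi_density a b x * ((b - a) - (a + b + 2) * x)"
        using x by (simp add: jacobi_density_def powr_add algebra_simps)
      ultimately show ?thesis by simp
    qed
    have dp: "((\<lambda>x. poly p (complex_of_real x)) has_vector_derivative poly (pderiv p) (of_real x)) (at x)"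
      using poly_DERIV[of p "of_real x"] by (rule has_vector_derivative_real_field)
    have eq: "jacobi_density (a + 1) (b + 1) x *\<^sub>R poly (pderiv p) (of_real x) +
        (jacobi_density a b x * ((b - a) - (a + b + 2) * x)) *\<^sub>R poly p (of_real x) =
        jacobi_density a b x *\<^sub>R poly ?q (of_real x)"
    proof -
      have s: "jacobi_density (a + 1) (b + 1) x = (1 - x) * (1 + x) * jacobi_density a b x"
        using x by (simp add: jacobi_density_mult)
      show ?thesis
        unfolding s scaleR_conv_of_real by (simp add: algebra_simps)
    qed
    show "(?F has_vector_derivative jacobi_density a b x *\<^sub>R poly ?q (of_real x)) (at x)"
      using has_vector_derivative_scaleR[OF d dp] by (simp add: eq)
    have "continuous_on {-1<..<1} (\<lambda>x. jacobi_density a b x *\<^sub>R poly ?q (complex_of_real x))"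
      by (intro continuous_intros continuous_on_jacobi_density)
    then show "isCont (\<lambda>x. jacobi_density a b x *\<^sub>R poly ?q (complex_of_real x)) x"
      using x by (meson continuous_on_eq_continuous_at open_greaterThanLessThan)
  next
    show "set_integrable lborel (einterval (ereal (-1)) (ereal 1))
        (\<lambda>x. jacobi_density a b x *\<^sub>R poly ?q (complex_of_real x))"
      unfolding e by (rule jacobi_density_poly_integrable[OF assms])
    have c: "continuous_on {-1..1} ?F"
      unfolding jacobi_density_def using assms by (intro continuous_intros continuous_on_powr') auto
    then have "(?F \<longlongrightarrow> ?F (-1)) (at_right (-1))"
      by (rule continuous_on_Icc_at_rightD) simp
    then show "((?F \<circ> real_of_ereal) \<longlongrightarrow> 0) (at_right (ereal (-1)))"
      unfolding ereal_tendsto_simps1 using assms by (simp add: o_def jacobi_density_def)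
    have "(?F \<longlongrightarrow> ?F 1) (at_left 1)"
      using c by (rule continuous_on_Icc_at_leftD) simp
    then show "((?F \<circ> real_of_ereal) \<longlongrightarrow> 0) (at_left (ereal 1))"
      unfolding ereal_tendsto_simps1 using assms by (simp add: o_def jacobi_density_def)
  qed simp
  then show ?thesis
    by (simp add: jacobi_integral_def interval_lebesgue_integral_def e del: poly_add poly_mult poly_pCons)
qed

lemma jacobi_integral_nonneg_eq_0:
  assumes ab: "a > -1" "b > -1"
    and g: "\<And>x. x \<in> {-1<..<1} \<Longrightarrow> poly p (of_real x) = of_real (g x) \<and> 0 \<le> g x"
    and 0: "jacobi_integral a b p = 0"
  shows "p = 0"
proof -
  let ?f = "\<lambda>x. indicator {-1<..<1} x *\<^sub>R (jacobi_density a b x *\<^sub>R Re (poly p (of_real x)))"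
  have int: "integrable lborel ?f"
    using integrable_bounded_linear[OF bounded_linear_Re
        jacobi_density_poly_integrable[OF ab, of p, unfolded set_integrable_def]]
    by (simp add: mult.assoc)
  have "integral\<^sup>L lborel ?f = Re (jacobi_integral a b p)"
    unfolding jacobi_integral_def set_lebesgue_integral_def
    using jacobi_density_poly_integrable[OF ab, of p, unfolded set_integrable_def]
    by (subst integral_Re[symmetric]) (simp_all add: mult.assoc)
  then have "integral\<^sup>L lborel ?f = 0" using 0 by simp
  moreover have nn: "0 \<le> ?f x" for x
    using g[of x] jacobi_density_pos[of x a b] by (auto simp: indicator_def)
  ultimately have "AE x in lborel. ?f x = 0"
    using integral_nonneg_eq_0_iff_AE[OF int] by simp
  then have ae: "AE x in lborel. x \<in> {-1<..<1} \<longrightarrow> poly p (complex_of_real x) = 0"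
  proof (rule AE_mp, intro AE_I2 impI)
    fix x :: real assume "?f x = 0" and x: "x \<in> {-1<..<1}"
    then have "Re (poly p (of_real x)) = 0"
      using jacobi_density_pos[OF x, of a b] by simp
    then show "poly p (complex_of_real x) = 0" using g[OF x] by simp
  qed
  show "p = 0"
  proof (rule ccontr)
    assume "p \<noteq> 0"
    then have "finite {z. poly p z = 0}" by (rule poly_roots_finite)
    then have "finite (complex_of_real -` {z. poly p z = 0})"
      by (rule finite_vimageI) (simp add: inj_on_def)
    then have "finite {x::real. poly p (complex_of_real x) = 0}"
      by (simp add: vimage_def)
    then have "AE x in lborel. x \<notin> {x::real. poly p (complex_of_real x) = 0}"
      by (intro AE_not_in finite_imp_null_set_lborel)
    with ae have "AE x in lborel. x \<notin> {-1<..<1::real}"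
      by eventually_elim auto
    then have "emeasure lborel {-1<..<1::real} = 0"
      by (subst (asm) AE_iff_measurable[of "{-1<..<1}"]) auto
    then show False by simp
  qed
qed

text \<open>Integration by parts in the form in which it is applied: a summand of Pearson type may be
  discarded.\<close>

lemma jacobi_integral_mod_pearson:
  assumes "a > -1" "b > -1"
  shows "jacobi_integral a b (smult c ([:1, 0, -1:] * pderiv p + [:of_real (b - a), - of_real (a + b + 2):] * p) + q)
    = jacobi_integral a b q"
  by (simp only: jacobi_integral_add[OF assms, of "smult _ _"] jacobi_integral_smult
      jacobi_integral_pearson[OF assms]) simp

section \<open>Jacobi polynomials as eigenfunctions\<close>

lemma poly_eq_pointwise:
  fixes p q :: "complex poly"
  shows "(\<And>x. poly p x = poly q x) \<Longrightarrow> p = q"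
  by (simp add: poly_eq_poly_eq_iff[symmetric] fun_eq_iff)

text \<open>A strict degree bound under which the zero polynomial has degree less than \<open>0\<close>; this makes it
  suitable as the start of inductions.\<close>

abbreviation deg_less :: "nat \<Rightarrow> 'a::zero poly \<Rightarrow> bool"
  where "deg_less n p \<equiv> \<forall>j\<ge>n. coeff p j = 0"

lemma deg_less_pCons_mult_pderiv:
  fixes p :: "complex poly"
  assumes "deg_less n p"
  shows "deg_less n ([:c, d:] * pderiv p)"
proof (intro allI impI)
  fix j assume "j \<ge> n"
  then show "coeff ([:c, d:] * pderiv p) j = 0"
    using assms by (cases j) (auto simp: coeff_pderiv)
qed

definition jacobi_op :: "real \<Rightarrow> real \<Rightarrow> complex poly \<Rightarrow> complex poly"
  where "jacobi_op a b p = [:1, 0, -1:] * pderiv (pderiv p)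
    + [:of_real (b - a), - of_real (a + b + 2):] * pderiv p"

definition jacobi_eigenvalue :: "real \<Rightarrow> real \<Rightarrow> nat \<Rightarrow> complex"
  where "jacobi_eigenvalue a b n = - of_nat n * (of_nat n + of_real (a + b + 1))"

text \<open>In the monomial basis the operator is triangular, with the eigenvalues on the diagonal.\<close>

lemma coeff_jacobi_op:
  "coeff (jacobi_op a b p) n = jacobi_eigenvalue a b n * coeff p n
    + of_real (b - a) * of_nat (n + 1) * coeff p (n + 1)
    + of_nat (n + 2) * of_nat (n + 1) * coeff p (n + 2)"
proof (cases n)
  case (Suc m)
  then show ?thesis
    by (cases m) (simp_all add: jacobi_op_def jacobi_eigenvalue_def coeff_pderiv algebra_simps eval_nat_numeral)
qed (simp add: jacobi_op_def jacobi_eigenvalue_def coeff_pderiv algebra_simps eval_nat_numeral)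

lemma jacobi_op_add: "jacobi_op a b (p + q) = jacobi_op a b p + jacobi_op a b q"
  and jacobi_op_diff: "jacobi_op a b (p - q) = jacobi_op a b p - jacobi_op a b q"
  by (simp_all add: poly_eq_iff coeff_jacobi_op algebra_simps)

lemma jacobi_eigenvalue_inj:
  assumes "a > -1" "b > -1" "m \<noteq> n"
  shows "jacobi_eigenvalue a b m \<noteq> jacobi_eigenvalue a b n"
proof
  assume "jacobi_eigenvalue a b m = jacobi_eigenvalue a b n"
  then have "complex_of_real ((real m - real n) * (real m + real n + a + b + 1)) = 0"
    by (simp add: jacobi_eigenvalue_def algebra_simps)
  then have "real m + real n + a + b + 1 = 0"
    using assms(3) by (simp only: of_real_eq_0_iff) auto
  moreover have "real m + real n \<ge> 1" using assms(3) by linarith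
  ultimately show False using assms by linarith
qed

text \<open>Back substitution in the triangular system: the leading coefficient of the solution is forced,
  and subtracting its contribution lowers the degree of the right-hand side.\<close>

lemma jacobi_op_solve:
  assumes "deg_less m q" and "\<And>j. j < m \<Longrightarrow> jacobi_eigenvalue a b j \<noteq> \<mu>"
  shows "\<exists>g. deg_less m g \<and> jacobi_op a b g - smult \<mu> g = q"
  using assms
proof (induction m arbitrary: q)
  case 0
  then have "q = 0" by (simp add: poly_eq_iff)
  then show ?case by (intro exI[of _ 0]) (simp add: jacobi_op_def)
next
  case (Suc m)
  let ?L = "\<lambda>g. jacobi_op a b g - smult \<mu> g"
  define t where "t = monom (coeff q m / (jacobi_eigenvalue a b m - \<mu>)) m"
  have ne: "jacobi_eigenvalue a b m - \<mu> \<noteq> 0" using Suc.prems(2)[of m] by simp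
  have "deg_less m (q - ?L t)"
  proof (intro allI impI)
    fix j assume "j \<ge> m"
    show "coeff (q - ?L t) j = 0"
    proof (cases "j = m")
      case True
      then show ?thesis
        using ne by (simp add: t_def coeff_jacobi_op field_simps)
    next
      case False
      then show ?thesis
        using \<open>j \<ge> m\<close> Suc.prems(1) by (simp add: t_def coeff_jacobi_op)
    qed
  qed
  then obtain g where g: "deg_less m g" "?L g = q - ?L t"
    using Suc.IH[of "q - ?L t"] Suc.prems(2) by auto
  show ?case
  proof (intro exI conjI)
    show "deg_less (Suc m) (g + t)" using g(1) by (simp add: t_def)
    show "?L (g + t) = q" using g(2) by (simp add: jacobi_op_add smult_add_right algebra_simps)
  qed
qed

text \<open>The Jacobi polynomial, normalized to be monic. Defining it by its differential equation makes the
  Taylor expansions at the end points available, which drive the classification.\<close>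

definition jacobi_poly :: "real \<Rightarrow> real \<Rightarrow> nat \<Rightarrow> complex poly"
  where "jacobi_poly a b n = (SOME h. coeff h n = 1 \<and> deg_less (Suc n) h \<and>
    jacobi_op a b h = smult (jacobi_eigenvalue a b n) h)"

lemma
  assumes "a > -1" "b > -1"
  shows coeff_jacobi_poly: "coeff (jacobi_poly a b n) n = 1"
    and deg_less_jacobi_poly: "deg_less (Suc n) (jacobi_poly a b n)"
    and jacobi_op_jacobi_poly: "jacobi_op a b (jacobi_poly a b n) = smult (jacobi_eigenvalue a b n) (jacobi_poly a b n)"
proof -
  let ?\<mu> = "jacobi_eigenvalue a b n"
  let ?x = "monom 1 n :: complex poly"
  have "deg_less n (jacobi_op a b ?x - smult ?\<mu> ?x)"
    by (auto simp: coeff_jacobi_op)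
  then obtain g where g: "deg_less n g" "jacobi_op a b g - smult ?\<mu> g = jacobi_op a b ?x - smult ?\<mu> ?x"
    using jacobi_op_solve[of n _ a b ?\<mu>] jacobi_eigenvalue_inj[OF assms] by (metis less_irrefl)
  have "coeff (?x - g) n = 1 \<and> deg_less (Suc n) (?x - g) \<and> jacobi_op a b (?x - g) = smult ?\<mu> (?x - g)"
    using g by (auto simp: jacobi_op_diff smult_diff_right algebra_simps)
  then have "coeff (jacobi_poly a b n) n = 1 \<and> deg_less (Suc n) (jacobi_poly a b n) \<and>
    jacobi_op a b (jacobi_poly a b n) = smult ?\<mu> (jacobi_poly a b n)"
    unfolding jacobi_poly_def by (rule someI)
  then show "coeff (jacobi_poly a b n) n = 1" "deg_less (Suc n) (jacobi_poly a b n)"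
    "jacobi_op a b (jacobi_poly a b n) = smult (jacobi_eigenvalue a b n) (jacobi_poly a b n)"
    by auto
qed

text \<open>The difference of the two integrands is of Pearson type for the Wronskian-like polynomial
  \<open>p' q - p q'\<close>.\<close>

lemma jacobi_op_symmetric:
  assumes "a > -1" "b > -1"
  shows "jacobi_integral a b (jacobi_op a b p * q) = jacobi_integral a b (p * jacobi_op a b q)"
proof -
  let ?w = "pderiv p * q - p * pderiv q"
  have "jacobi_op a b p * q - p * jacobi_op a b q
      = [:1, 0, -1:] * pderiv ?w + [:of_real (b - a), - of_real (a + b + 2):] * ?w"
    by (rule poly_eq_pointwise) (simp add: jacobi_op_def pderiv_diff pderiv_mult algebra_simps)
  then have "jacobi_integral a b (jacobi_op a b p * q - p * jacobi_op a b q) = 0"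
    using jacobi_integral_pearson[OF assms, of ?w] by simp
  then show ?thesis
    by (simp add: jacobi_integral_diff[OF assms])
qed

text \<open>Eigenfunctions of a symmetric operator for distinct eigenvalues are orthogonal, and the Jacobi
  polynomials of degree less than \<open>n\<close> span all polynomials of degree less than \<open>n\<close>.\<close>

lemma jacobi_poly_orthogonal:
  assumes "a > -1" "b > -1" and "deg_less n g"
  shows "jacobi_integral a b (jacobi_poly a b n * g) = 0"
proof -
  have hh: "jacobi_integral a b (jacobi_poly a b n * jacobi_poly a b m) = 0" if "m < n" for m
  proof -
    have "jacobi_eigenvalue a b n * jacobi_integral a b (jacobi_poly a b n * jacobi_poly a b m)
        = jacobi_eigenvalue a b m * jacobi_integral a b (jacobi_poly a b n * jacobi_poly a b m)"
      using jacobi_op_symmetric[OF assms(1,2), of "jacobi_poly a b n" "jacobi_poly a b m"]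
      by (simp add: jacobi_op_jacobi_poly[OF assms(1,2)] jacobi_integral_smult)
    then show ?thesis
      using jacobi_eigenvalue_inj[OF assms(1,2), of n m] that by auto
  qed
  have "jacobi_integral a b (jacobi_poly a b n * g) = 0" if "deg_less m g" "m \<le> n" for m g
    using that
  proof (induction m arbitrary: g)
    case 0
    then have "g = 0" by (simp add: poly_eq_iff)
    then show ?case by simp
  next
    case (Suc m)
    let ?h = "jacobi_poly a b m" and ?c = "coeff g m"
    have "deg_less m (g - smult ?c ?h)"
    proof (intro allI impI)
      fix j assume "j \<ge> m"
      then show "coeff (g - smult ?c ?h) j = 0"
        using Suc.prems(1) coeff_jacobi_poly[OF assms(1,2), of m] deg_less_jacobi_poly[OF assms(1,2), of m]
        by (cases "j = m") auto
    qed
    then have "jacobi_integral a b (jacobi_poly a b n * (g - smult ?c ?h)) = 0"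
      using Suc.IH Suc.prems(2) by (meson Suc_leD)
    then show ?case
      using hh[of m] Suc.prems(2)
      by (simp add: right_diff_distrib jacobi_integral_diff[OF assms(1,2)] jacobi_integral_smult)
  qed
  then show ?thesis using assms(3) by blast
qed

section \<open>Taylor coefficients at the end points\<close>

lemma higher_pderiv_jacobi_op:
  "(pderiv ^^ j) (jacobi_op a b p) = [:1, 0, -1:] * (pderiv ^^ (j + 2)) p
    + [:of_real (b - a), - of_real (a + b + 2 + 2 * real j):] * (pderiv ^^ (j + 1)) p
    + smult (jacobi_eigenvalue a b j) ((pderiv ^^ j) p)"
proof (induction j)
  case 0
  then show ?case by (simp add: jacobi_op_def jacobi_eigenvalue_def)
next
  case (Suc j)
  show ?case
    by (rule poly_eq_pointwise)
      (simp add: Suc.IH pderiv_add pderiv_mult pderiv_smult pderiv_pCons pderiv_minus jacobi_eigenvalue_def algebra_simps)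
qed

text \<open>Differentiating the equation \<open>(1 - x\<^sup>2) h'' + \<dots> = \<mu> h\<close> repeatedly and evaluating where \<open>1 - x\<^sup>2\<close>
  vanishes leaves a two term recursion for the derivatives of \<open>h\<close>. The Boolean \<open>r\<close> selects the
  right end point \<open>1\<close> or the left end point \<open>-1\<close>; \<open>jet_denom\<close> is the coefficient of the higher
  derivative in this recursion, and \<open>jet_poly\<close> solves it as a polynomial in the eigenvalue \<open>\<mu>\<close>.\<close>

definition jet_denom :: "real \<Rightarrow> real \<Rightarrow> bool \<Rightarrow> nat \<Rightarrow> complex"
  where "jet_denom a b r j = (if r then - 2 * of_real (real j + a + 1) else 2 * of_real (real j + b + 1))"

definition endpoint :: "bool \<Rightarrow> complex"
  where "endpoint r = (if r then 1 else -1)"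

definition jet_poly :: "real \<Rightarrow> real \<Rightarrow> bool \<Rightarrow> nat \<Rightarrow> complex poly"
  where "jet_poly a b r j = (\<Prod>i<j. smult (1 / jet_denom a b r i) [:- jacobi_eigenvalue a b i, 1:])"

lemma poly_jet_poly:
  "poly (jet_poly a b r j) \<mu> = (\<Prod>i<j. (\<mu> - jacobi_eigenvalue a b i) / jet_denom a b r i)"
  by (simp add: jet_poly_def poly_prod diff_divide_distrib)

lemma jet_denom_nonzero:
  assumes "a > -1" "b > -1"
  shows "jet_denom a b r j \<noteq> 0"
proof -
  have "real j + a + 1 \<noteq> 0" "real j + b + 1 \<noteq> 0" using assms by linarith+
  then show ?thesis
    unfolding jet_denom_def by (simp del: of_real_add)
qed

lemma jacobi_jet_step:
  assumes "jacobi_op a b h = smult \<mu> h"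
  shows "jet_denom a b r j * poly ((pderiv ^^ Suc j) h) (endpoint r)
    = (\<mu> - jacobi_eigenvalue a b j) * poly ((pderiv ^^ j) h) (endpoint r)"
proof -
  have "poly ((pderiv ^^ j) (jacobi_op a b h)) (endpoint r) = \<mu> * poly ((pderiv ^^ j) h) (endpoint r)"
    by (simp add: assms higher_pderiv_smult)
  then show ?thesis
    unfolding higher_pderiv_jacobi_op
    by (cases r) (simp_all add: jet_denom_def endpoint_def algebra_simps)
qed

text \<open>All derivatives at an end point are multiples of the value there, with factors that depend
  polynomially on the eigenvalue. The exponents being greater than \<open>-1\<close>, no denominator
  vanishes.\<close>

lemma jacobi_jet:
  assumes "a > -1" "b > -1" and "jacobi_op a b h = smult \<mu> h"
  shows "poly ((pderiv ^^ j) h) (endpoint r) = poly (jet_poly a b r j) \<mu> * poly h (endpoint r)"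
proof (induction j)
  case (Suc j)
  have "poly ((pderiv ^^ Suc j) h) (endpoint r)
    = (\<mu> - jacobi_eigenvalue a b j) / jet_denom a b r j * poly ((pderiv ^^ j) h) (endpoint r)"
    using jacobi_jet_step[OF assms(3), of r j] jet_denom_nonzero[OF assms(1,2), of r j]
    by (simp add: field_simps)
  also have "\<dots> = poly (jet_poly a b r (Suc j)) \<mu> * poly h (endpoint r)"
    unfolding Suc.IH poly_jet_poly by simp
  finally show ?case .
qed (simp add: jet_poly_def)

lemma jacobi_poly_deriv_top:
  assumes "a > -1" "b > -1"
  shows "poly ((pderiv ^^ n) (jacobi_poly a b n)) z = fact n"
proof -
  have "(pderiv ^^ n) (jacobi_poly a b n) = [:fact n:]"
  proof (rule poly_eqI)
    fix j
    show "coeff ((pderiv ^^ n) (jacobi_poly a b n)) j = coeff [:fact n:] j"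
      using coeff_jacobi_poly[OF assms, of n] deg_less_jacobi_poly[OF assms, of n]
      by (cases j) (simp_all add: coeff_higher_pderiv pochhammer_fact)
  qed
  then show ?thesis by simp
qed

text \<open>The \<open>n\<close>-th derivative of the monic polynomial is \<open>n!\<close>. Expressing it through the value at either
  end point shows that this value is not zero; in the quotient of the two expressions the factors
  that depend on the eigenvalue cancel.\<close>

lemma
  assumes "a > -1" "b > -1"
  shows jacobi_poly_endpoint_nonzero: "poly (jacobi_poly a b n) (endpoint r) \<noteq> 0"
    and jacobi_poly_endpoint_quotient: "poly (jacobi_poly a b n) 1 * pochhammer (of_real (b + 1)) n =
      (-1) ^ n * poly (jacobi_poly a b n) (-1) * pochhammer (of_real (a + 1)) n"
proof -
  let ?\<mu> = "jacobi_eigenvalue a b n"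
  have f: "poly (jet_poly a b r n) ?\<mu> * poly (jacobi_poly a b n) (endpoint r) = fact n" for r
    using jacobi_jet[OF assms jacobi_op_jacobi_poly[OF assms], of n n r] jacobi_poly_deriv_top[OF assms]
    by simp
  show "poly (jacobi_poly a b n) (endpoint r) \<noteq> 0"
    using f[of r] by (metis fact_nonzero mult_zero_right)
  define X where "X = (\<Prod>i<n. ?\<mu> - jacobi_eigenvalue a b i)"
  have j: "poly (jet_poly a b r n) ?\<mu> = X / (\<Prod>i<n. jet_denom a b r i)" for r
    by (simp add: poly_jet_poly X_def prod_dividef)
  have "(\<Prod>i<n. jet_denom a b True i) = (\<Prod>i<n. (-2) * (of_real (a + 1) + of_nat i))"
    "(\<Prod>i<n. jet_denom a b False i) = (\<Prod>i<n. 2 * (of_real (b + 1) + of_nat i))"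
    by (intro prod.cong refl; simp add: jet_denom_def algebra_simps)+
  then have d1: "(\<Prod>i<n. jet_denom a b True i) = (-2) ^ n * pochhammer (of_real (a + 1)) n"
    and d2: "(\<Prod>i<n. jet_denom a b False i) = 2 ^ n * pochhammer (of_real (b + 1)) n"
    by (simp_all only: pochhammer_prod prod.distrib lessThan_atLeast0 prod_constant card_atLeastLessThan diff_zero)
  have nz: "(\<Prod>i<n. jet_denom a b r i) \<noteq> 0" for r
    using jet_denom_nonzero[OF assms] by (simp add: prod_zero_iff)
  have X0: "X \<noteq> 0"
    using f[of True] j[of True] by auto
  have "X * poly (jacobi_poly a b n) 1 = fact n * (\<Prod>i<n. jet_denom a b True i)"
    using f[of True] j[of True] nz[of True] by (simp add: endpoint_def field_simps)
  moreover have "X * poly (jacobi_poly a b n) (-1) = fact n * (\<Prod>i<n. jet_denom a b False i)"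
    using f[of False] j[of False] nz[of False] by (simp add: endpoint_def field_simps)
  moreover have "(-2 :: complex) ^ n = (-1) ^ n * 2 ^ n"
    by (simp flip: power_mult_distrib)
  moreover have "X * h = F * (e * t * A) \<Longrightarrow> X * h' = F * (t * B) \<Longrightarrow> X * (h * B) = X * (e * h' * A)"
    for h h' F e t A B :: complex
    by algebra
  ultimately have "X * (poly (jacobi_poly a b n) 1 * pochhammer (of_real (b + 1)) n) =
      X * ((-1) ^ n * poly (jacobi_poly a b n) (-1) * pochhammer (of_real (a + 1)) n)"
    unfolding d1 d2 by presburger
  then show "poly (jacobi_poly a b n) 1 * pochhammer (of_real (b + 1)) n =
      (-1) ^ n * poly (jacobi_poly a b n) (-1) * pochhammer (of_real (a + 1)) n"
    using X0 by simp
qed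

text \<open>Raising \<open>b\<close> by one changes the quotient of the two end point values by a factor that is linear in
  \<open>n\<close>. The eigenvalues are invariant under a reflection of \<open>n\<close>, this factor is not; the contrast is
  exploited in \<open>no_intertwiner_up\<close> and \<open>no_intertwiner_down\<close>.\<close>

lemma jacobi_poly_endpoint_ratio:
  assumes "a > -1" "b > -1"
  shows "poly (jacobi_poly a (b + 1) n) 1 * poly (jacobi_poly a b n) (-1) * (of_nat n + of_real (b + 1)) =
    of_real (b + 1) * poly (jacobi_poly a b n) 1 * poly (jacobi_poly a (b + 1) n) (-1)"
proof -
  define A B where "A = pochhammer (complex_of_real (a + 1)) n" and "B = pochhammer (complex_of_real (b + 1)) n"
  define B' where "B' = pochhammer (complex_of_real (b + 1 + 1)) n"
  have pos: "0 < pochhammer (a + 1) n" "0 < pochhammer (b + 1) n" "0 < pochhammer (b + 1 + 1) n"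
    using assms by (auto intro!: pochhammer_pos)
  have nz: "A \<noteq> 0" "B \<noteq> 0" "B' \<noteq> 0"
    using pos unfolding A_def B_def B'_def by (simp_all only: pochhammer_of_real of_real_eq_0_iff)
  have rec: "of_real (b + 1) * B' = B * (of_nat n + of_real (b + 1))"
    using pochhammer_rec[of "complex_of_real (b + 1)" n] pochhammer_rec'[of "complex_of_real (b + 1)" n]
    by (simp add: B_def B'_def algebra_simps)
  have 1: "poly (jacobi_poly a (b + 1) n) 1 * B' = (-1) ^ n * poly (jacobi_poly a (b + 1) n) (-1) * A"
    using jacobi_poly_endpoint_quotient[of a "b + 1" n] assms by (simp add: A_def B'_def)
  have 2: "poly (jacobi_poly a b n) 1 * B = (-1) ^ n * poly (jacobi_poly a b n) (-1) * A"
    using jacobi_poly_endpoint_quotient[of a b n] assms by (simp add: A_def B_def)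
  define s where "s = (-1 :: complex) ^ n"
  have "s * A * B * (poly (jacobi_poly a (b + 1) n) 1 * poly (jacobi_poly a b n) (-1) * (of_nat n + of_real (b + 1)))
    = s * A * B * (of_real (b + 1) * poly (jacobi_poly a b n) 1 * poly (jacobi_poly a (b + 1) n) (-1))"
  proof -
    have "f * B' = s * f' * A \<Longrightarrow> h * B = s * h' * A \<Longrightarrow> c * B' = B * N \<Longrightarrow>
        s * A * B * (f * h' * N) = s * A * B * (c * h * f')" for f f' h h' c N :: complex
      by algebra
    then show ?thesis using 1 2 rec unfolding s_def by blast
  qed
  then show ?thesis using nz by (simp add: s_def)
qed

lemma higher_pderiv_linear_mult:
  "(pderiv ^^ j) ([:c, d:] * pderiv p) = [:c, d:] * (pderiv ^^ Suc j) p + smult (of_nat j * d) ((pderiv ^^ j) p)"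
  for p :: "complex poly"
proof (induction j)
  case (Suc j)
  show ?case
    unfolding funpow.simps(2) o_apply[of pderiv] Suc.IH
    by (rule poly_eq_pointwise)
      (simp add: pderiv_add pderiv_mult pderiv_smult pderiv_pCons algebra_simps del: mult_pCons_left)
qed simp

lemma higher_pderiv_diff: "(pderiv ^^ j) (p - q) = (pderiv ^^ j) p - (pderiv ^^ j) q"
  for p q :: "complex poly"
  by (induction j) (simp_all add: pderiv_diff)

text \<open>Truncated Taylor series serve as a substitute for the solutions of differential equations that
  are not polynomials.\<close>

lemma exists_poly_with_jet:
  fixes y :: "nat \<Rightarrow> complex"
  shows "\<exists>h. \<forall>j<N. poly ((pderiv ^^ j) h) z = y j"
proof -
  define p where "p = (\<Sum>i<N. monom (y i / fact i) i)"
  have shift: "(pderiv ^^ j) (pcompose p [:- z, 1:]) = pcompose ((pderiv ^^ j) p) [:- z, 1:]" for j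
    by (induction j) (simp_all add: pderiv_pcompose pderiv_pCons)
  have "poly ((pderiv ^^ j) (pcompose p [:- z, 1:])) z = y j" if "j < N" for j
  proof -
    have "coeff p j = y j / fact j"
      using that by (simp add: p_def coeff_sum)
    then show ?thesis
      by (simp add: shift poly_pcompose poly_0_coeff_0 coeff_higher_pderiv flip: pochhammer_fact)
  qed
  then show ?thesis by blast
qed

section \<open>Functionals supported at a point\<close>

text \<open>Finite linear combinations of derivatives at \<open>z\<close>.\<close>

inductive jet_functional :: "complex \<Rightarrow> (complex poly \<Rightarrow> complex) \<Rightarrow> bool" for z
  where
    zero: "jet_functional z (\<lambda>p. 0)"
  | step: "jet_functional z l \<Longrightarrow> jet_functional z (\<lambda>p. l p + c * poly ((pderiv ^^ j) p) z)"

lemma jet_functional_scale: "jet_functional z l \<Longrightarrow> jet_functional z (\<lambda>p. c * l p)"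
proof (induction rule: jet_functional.induct)
  case zero
  then show ?case using jet_functional.zero by simp
next
  case (step l d j)
  show ?case using jet_functional.step[OF step.IH, of "c * d" j] by (simp add: algebra_simps)
qed

lemma jet_functional_add:
  "jet_functional z l \<Longrightarrow> jet_functional z l' \<Longrightarrow> jet_functional z (\<lambda>p. l p + l' p)"
proof (induction rule: jet_functional.induct)
  case zero
  then show ?case by simp
next
  case (step l d j)
  show ?case using jet_functional.step[OF step.IH[OF step.prems], of d j] by (simp add: algebra_simps)
qed

lemma jet_functional_sum:
  "(\<And>i. i \<in> I \<Longrightarrow> jet_functional z (l i)) \<Longrightarrow> jet_functional z (\<lambda>p. \<Sum>i\<in>I. l i p)"
  by (induction I rule: infinite_finite_induct) (auto intro: jet_functional.zero jet_functional_add)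

text \<open>On functions whose Taylor coefficients at \<open>z\<close> are polynomials in a parameter \<open>\<mu>\<close> times the value
  at \<open>z\<close>, such a functional is itself a polynomial in \<open>\<mu>\<close> times this value. Only finitely many
  coefficients matter, so the same polynomial also governs truncated series.\<close>

lemma jet_functional_on_family:
  assumes "jet_functional z l"
  shows "\<exists>M \<Phi>. \<forall>\<mu> h. (\<forall>j<M. poly ((pderiv ^^ j) h) z = poly (\<pi> j) \<mu> * poly h z) \<longrightarrow>
    l h = poly \<Phi> \<mu> * poly h z"
  using assms
proof (induction rule: jet_functional.induct)
  case zero
  show ?case by (rule exI[of _ 0], rule exI[of _ 0]) simp
next
  case (step l c j)
  then obtain M \<Phi> where M: "\<And>\<mu> h. (\<forall>j<M. poly ((pderiv ^^ j) h) z = poly (\<pi> j) \<mu> * poly h z) \<Longrightarrow>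
    l h = poly \<Phi> \<mu> * poly h z"
    by blast
  show ?case
  proof (intro exI[of _ "max M (Suc j)"] exI[of _ "\<Phi> + smult c (\<pi> j)"] allI impI)
    fix \<mu> h
    assume h: "\<forall>i<max M (Suc j). poly ((pderiv ^^ i) h) z = poly (\<pi> i) \<mu> * poly h z"
    then have "l h = poly \<Phi> \<mu> * poly h z" by (intro M) auto
    then show "l h + c * poly ((pderiv ^^ j) h) z = poly (\<Phi> + smult c (\<pi> j)) \<mu> * poly h z"
      using h by (simp add: algebra_simps)
  qed
qed

text \<open>Differential operators, characterized by the one property that is used of them: each Taylor
  coefficient of the result at a point depends on finitely many Taylor coefficients of the argument
  there. The condition on all derivatives makes the notion stable under composition with
  \<open>pderiv\<close>.\<close>

definition local_op :: "(complex poly \<Rightarrow> complex poly) \<Rightarrow> bool"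
  where "local_op T \<longleftrightarrow> (\<forall>z m. jet_functional z (\<lambda>p. poly ((pderiv ^^ m) (T p)) z))"

lemma local_op_functional:
  assumes "local_op T"
  shows "jet_functional z (\<lambda>p. poly (T p) z)"
  using assms[unfolded local_op_def, rule_format, of z 0] by simp

lemma local_op_id: "local_op (\<lambda>p. p)"
  unfolding local_op_def
proof (intro allI)
  fix z m
  show "jet_functional z (\<lambda>p. poly ((pderiv ^^ m) p) z)"
    using jet_functional.step[OF jet_functional.zero, of z 1 m] by simp
qed

lemma local_op_pderiv:
  assumes "local_op T"
  shows "local_op (\<lambda>p. pderiv (T p))"
  unfolding local_op_def
proof (intro allI)
  fix z m
  show "jet_functional z (\<lambda>p. poly ((pderiv ^^ m) (pderiv (T p))) z)"
    using assms[unfolded local_op_def, rule_format, of z "Suc m"] by (simp add: funpow_swap1)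
qed

lemma local_op_higher_pderiv: "local_op T \<Longrightarrow> local_op (\<lambda>p. (pderiv ^^ j) (T p))"
  by (induction j) (auto intro: local_op_pderiv)

lemma local_op_add: "local_op S \<Longrightarrow> local_op T \<Longrightarrow> local_op (\<lambda>p. S p + T p)"
  unfolding local_op_def by (simp add: higher_pderiv_add jet_functional_add)

lemma local_op_mult:
  assumes "local_op T"
  shows "local_op (\<lambda>p. q * T p)"
  unfolding local_op_def
proof (intro allI)
  fix z m
  show "jet_functional z (\<lambda>p. poly ((pderiv ^^ m) (q * T p)) z)"
    unfolding higher_pderiv_Leibniz poly_sum poly_mult mult.assoc[symmetric]
    by (intro jet_functional_sum jet_functional_scale) (use assms in \<open>simp add: local_op_def\<close>)
qed

lemma local_op_smult: "local_op T \<Longrightarrow> local_op (\<lambda>p. smult c (T p))"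
  using local_op_mult[of T "[:c:]"] by simp

lemma local_op_uminus: "local_op T \<Longrightarrow> local_op (\<lambda>p. - T p)"
  using local_op_smult[of T "-1"] by simp

lemma local_op_diff: "local_op S \<Longrightarrow> local_op T \<Longrightarrow> local_op (\<lambda>p. S p - T p)"
  using local_op_add[OF _ local_op_uminus, of S T] by simp

lemma local_op_0: "local_op (\<lambda>p. 0)"
  unfolding local_op_def by (auto intro: jet_functional.zero)

lemma local_op_sum: "(\<And>i. i \<in> I \<Longrightarrow> local_op (T i)) \<Longrightarrow> local_op (\<lambda>p. \<Sum>i\<in>I. T i p)"
  by (induction I rule: infinite_finite_induct) (auto intro: local_op_0 local_op_add)

lemmas local_op_intros = local_op_id local_op_pderiv local_op_add local_op_mult local_op_smult
  local_op_uminus local_op_diff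

section \<open>Differential operators on Jacobi polynomials\<close>

lemma poly_eq_on_nat:
  fixes p q :: "complex poly"
  assumes "\<And>n::nat. poly p (of_nat n) = poly q (of_nat n)"
  shows "p = q"
proof (rule ccontr)
  assume "p \<noteq> q"
  then have "finite {z. poly (p - q) z = 0}" by (intro poly_roots_finite) simp
  moreover have "range (of_nat :: nat \<Rightarrow> complex) \<subseteq> {z. poly (p - q) z = 0}" using assms by auto
  ultimately have "finite (range (of_nat :: nat \<Rightarrow> complex))" by (rule rev_finite_subset)
  then show False by (simp add: finite_image_iff)
qed

text \<open>The eigenvalue \<open>-n (n + a + b + 1)\<close> is unchanged if \<open>n\<close> is replaced by \<open>-n - (a + b + 1)\<close>. The
  assumed identity holds for all complex \<open>n\<close>, and comparing it with its reflection leaves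
  \<open>\<Phi> \<cdot> (2 n + a + b + 1) = 0\<close>.\<close>

lemma reflection_vanish:
  assumes "\<And>n. poly \<Phi> (jacobi_eigenvalue a b n) * (of_nat n + c) = d * poly \<Psi> (jacobi_eigenvalue a b n)"
  shows "poly \<Phi> (jacobi_eigenvalue a b n) = 0"
proof -
  define s where "s = complex_of_real (a + b + 1)"
  let ?q = "[:0, - s, -1:]"
  have q: "poly ?q z = - z * (z + s)" for z by (simp add: algebra_simps)
  have ev: "jacobi_eigenvalue a b n = poly ?q (of_nat n)" for n
    unfolding q by (simp add: jacobi_eigenvalue_def s_def)
  have l: "poly [:c, 1:] z = z + c" for z by simp
  have "pcompose \<Phi> ?q * [:c, 1:] = smult d (pcompose \<Psi> ?q)"
    by (rule poly_eq_on_nat) (simp only: poly_mult poly_smult poly_pcompose l assms flip: ev)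
  then have "poly (pcompose \<Phi> ?q * [:c, 1:]) z = poly (smult d (pcompose \<Psi> ?q)) z" for z
    by simp
  then have e: "poly \<Phi> (- z * (z + s)) * (z + c) = d * poly \<Psi> (- z * (z + s))" for z
    unfolding poly_mult poly_smult poly_pcompose l q .
  \<comment> \<open>Subtract the identity at the reflected point from the identity itself.\<close>
  have "pcompose \<Phi> ?q * [:s, 2:] = 0"
  proof (rule poly_eq_pointwise)
    fix z
    have "poly \<Phi> (- z * (z + s)) * (- s - z + c) = d * poly \<Psi> (- z * (z + s))"
      using e[of "- s - z"] by (simp add: algebra_simps)
    with e[of z] have "poly \<Phi> (- z * (z + s)) * (2 * z + s) = 0"
      by (simp add: algebra_simps)
    then show "poly (pcompose \<Phi> ?q * [:s, 2:]) z = poly 0 z"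
      by (simp add: poly_pcompose q algebra_simps)
  qed
  then have "pcompose \<Phi> ?q = 0" by (simp only: mult_eq_0_iff) simp
  then have "poly \<Phi> (poly ?q (of_nat n)) = 0"
    by (metis poly_0 poly_pcompose)
  then show ?thesis unfolding q by (simp add: jacobi_eigenvalue_def s_def)
qed

lemma local_op_jacobi_endpoint:
  assumes "local_op T" "a > -1" "b > -1"
  shows "\<exists>\<Phi>. \<forall>n. poly (T (jacobi_poly a b n)) (endpoint r) =
    poly \<Phi> (jacobi_eigenvalue a b n) * poly (jacobi_poly a b n) (endpoint r)"
  using jet_functional_on_family[OF local_op_functional[OF assms(1)], where \<pi> = "jet_poly a b r" and z = "endpoint r"]
    jacobi_jet[OF assms(2,3) jacobi_op_jacobi_poly[OF assms(2,3)]]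
  by blast

text \<open>Let \<open>h\<close> and \<open>f\<close> be the Jacobi polynomials of degree \<open>n\<close> for \<open>(a, b)\<close> and \<open>(a, b + 1)\<close>. At both end
  points \<open>t f\<close> is a polynomial in the eigenvalue times \<open>h\<close>. Dividing the two relations eliminates
  \<open>t\<close> and, by \<open>jacobi_poly_endpoint_ratio\<close>, gives an identity to which \<open>reflection_vanish\<close>
  applies.\<close>

lemma no_intertwiner_up:
  assumes T: "local_op T" "a > -1" "b > -1"
    and t: "\<And>n. T (jacobi_poly a b n) = smult (t n) (jacobi_poly a (b + 1) n)"
  shows "t n = 0"
proof -
  let ?h = "jacobi_poly a b" and ?f = "jacobi_poly a (b + 1)" and ?\<mu> = "jacobi_eigenvalue a b"
  obtain \<Phi> where \<Phi>: "\<And>n. t n * poly (?f n) 1 = poly \<Phi> (?\<mu> n) * poly (?h n) 1"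
    using local_op_jacobi_endpoint[OF T, of True] by (auto simp: t endpoint_def)
  obtain \<Psi> where \<Psi>: "\<And>n. t n * poly (?f n) (-1) = poly \<Psi> (?\<mu> n) * poly (?h n) (-1)"
    using local_op_jacobi_endpoint[OF T, of False] by (auto simp: t endpoint_def)
  have b1: "b + 1 > -1" using T(3) by simp
  have nz: "poly (?h n) 1 \<noteq> 0" "poly (?h n) (-1) \<noteq> 0" "poly (?f n) 1 \<noteq> 0" "poly (?f n) (-1) \<noteq> 0" for n
    using jacobi_poly_endpoint_nonzero[OF T(2,3), of n True] jacobi_poly_endpoint_nonzero[OF T(2,3), of n False]
      jacobi_poly_endpoint_nonzero[OF T(2) b1, of n True] jacobi_poly_endpoint_nonzero[OF T(2) b1, of n False]
    by (simp_all add: endpoint_def)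
  have "poly \<Phi> (?\<mu> n) = 0"
  proof (rule reflection_vanish)
    fix n
    have "f1 * h2 * N = c * h1 * f2 \<Longrightarrow> t * f1 = P * h1 \<Longrightarrow> t * f2 = Q * h2 \<Longrightarrow>
        (f1 * h2) * (P * N) = (f1 * h2) * (c * Q)" for f1 f2 h1 h2 N c t P Q :: complex
      by algebra
    from this[OF jacobi_poly_endpoint_ratio[OF T(2,3), of n] \<Phi>[of n] \<Psi>[of n]]
    show "poly \<Phi> (?\<mu> n) * (of_nat n + of_real (b + 1)) = of_real (b + 1) * poly \<Psi> (?\<mu> n)"
      using nz by simp
  qed
  then show ?thesis using \<Phi>[of n] nz by simp
qed

text \<open>The same argument with the parts of the two families exchanged; now the linear factor multiplies
  the polynomial that belongs to the left end point.\<close>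

lemma no_intertwiner_down:
  assumes T: "local_op T" "a > -1" "b > -1"
    and t: "\<And>n. T (jacobi_poly a (b + 1) n) = smult (t n) (jacobi_poly a b n)"
  shows "t n = 0"
proof -
  let ?h = "jacobi_poly a b" and ?f = "jacobi_poly a (b + 1)" and ?\<mu> = "jacobi_eigenvalue a (b + 1)"
  have b1: "b + 1 > -1" using T(3) by simp
  obtain \<Phi> where \<Phi>: "\<And>n. t n * poly (?h n) 1 = poly \<Phi> (?\<mu> n) * poly (?f n) 1"
    using local_op_jacobi_endpoint[OF T(1,2) b1, of True] by (auto simp: t endpoint_def)
  obtain \<Psi> where \<Psi>: "\<And>n. t n * poly (?h n) (-1) = poly \<Psi> (?\<mu> n) * poly (?f n) (-1)"
    using local_op_jacobi_endpoint[OF T(1,2) b1, of False] by (auto simp: t endpoint_def)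
  have nz: "poly (?h n) 1 \<noteq> 0" "poly (?h n) (-1) \<noteq> 0" "poly (?f n) 1 \<noteq> 0" "poly (?f n) (-1) \<noteq> 0" for n
    using jacobi_poly_endpoint_nonzero[OF T(2,3), of n True] jacobi_poly_endpoint_nonzero[OF T(2,3), of n False]
      jacobi_poly_endpoint_nonzero[OF T(2) b1, of n True] jacobi_poly_endpoint_nonzero[OF T(2) b1, of n False]
    by (simp_all add: endpoint_def)
  have "poly \<Psi> (?\<mu> n) = 0"
  proof (rule reflection_vanish)
    fix n
    have "f1 * h2 * N = c * h1 * f2 \<Longrightarrow> t * h1 = P * f1 \<Longrightarrow> t * h2 = Q * f2 \<Longrightarrow>
        (h1 * f2) * (Q * N) = (h1 * f2) * (c * P)" for f1 f2 h1 h2 N c t P Q :: complex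
      by algebra
    from this[OF jacobi_poly_endpoint_ratio[OF T(2,3), of n] \<Phi>[of n] \<Psi>[of n]]
    show "poly \<Psi> (?\<mu> n) * (of_nat n + of_real (b + 1)) = of_real (b + 1) * poly \<Phi> (?\<mu> n)"
      using nz by simp
  qed
  then show ?thesis using \<Psi>[of n] nz by simp
qed

section \<open>Action on row vectors\<close>

lemma smult_sum_right: "smult c (\<Sum>i\<in>I. f i) = (\<Sum>i\<in>I. smult c (f i))"
  by (induction I rule: infinite_finite_induct) (simp_all add: smult_add_right)

text \<open>Each row of \<open>P \<cdot> D\<close> depends on the same row of \<open>P\<close> alone. Working with rows reduces matrix
  identities to identities between pairs of scalar polynomials.\<close>

definition row_act :: "'n::finite dop \<Rightarrow> complex poly^'n \<Rightarrow> complex poly^'n"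
  where "row_act D v = (\<chi> s. \<Sum>j | dop_coeff D j \<noteq> 0. \<Sum>i\<in>UNIV. (pderiv ^^ j) (v $ i) * dop_coeff D j $ i $ s)"

lemma dop_act_nth: "dop_act P D $ r = row_act D (P $ r)"
  by (simp add: vec_eq_iff dop_act_def row_act_def matrix_mul_nth)

lemma row_act_eq_dop_act: "row_act D v = dop_act (\<chi> r. v) D $ r"
  by (simp add: dop_act_nth)

lemma row_act_times: "row_act (D * E) v = row_act E (row_act D v)"
  by (subst (1) row_act_eq_dop_act) (simp add: dop_act_times dop_act_nth)

lemma row_act_one [simp]: "row_act 1 v = v"
  by (subst row_act_eq_dop_act) simp

lemma row_act_dop_0 [simp]: "row_act 0 v = 0"
  by (subst row_act_eq_dop_act) simp

lemma row_act_dop_add: "row_act (D + E) v = row_act D v + row_act E v"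
  by (subst (1) row_act_eq_dop_act) (simp add: dop_act_add_right dop_act_nth)

lemma row_act_add: "row_act D (v + w) = row_act D v + row_act D w"
  by (simp add: row_act_def vec_eq_iff higher_pderiv_add distrib_right sum.distrib)

lemma row_act_0 [simp]: "row_act D 0 = 0"
  by (simp add: row_act_def vec_eq_iff)

lemma row_act_scale: "row_act D ([:c:] *s v) = [:c:] *s row_act D v"
  by (simp add: row_act_def vec_eq_iff higher_pderiv_smult smult_sum_right)

lemma row_act_diff: "row_act D (v - w) = row_act D v - row_act D w"
proof -
  have "v = (v - w) + w" by simp
  then have "row_act D v = row_act D (v - w) + row_act D w"
    by (metis row_act_add)
  then show ?thesis by simp
qed

lemma row_act_dop_scale: "row_act (dop_scale c D) v = [:c:] *s row_act D v"
proof (cases "c = 0")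
  case True
  then have "dop_scale c D = 0" by (intro dop_eqI) (simp add: vec_eq_iff)
  then show ?thesis using True by simp
next
  case False
  then have "{j. dop_coeff (dop_scale c D) j \<noteq> 0} = {j. dop_coeff D j \<noteq> 0}"
    by (auto simp: vec_eq_iff)
  then show ?thesis
    by (simp add: row_act_def vec_eq_iff smult_sum_right)
qed

lemma row_act_del [simp]: "row_act dop_del v = (\<chi> i. pderiv (v $ i))"
  by (subst row_act_eq_dop_act) (simp add: pmat_deriv_def vec_eq_iff map_matrix_def)

lemma row_act_mat [simp]: "row_act (dop_mat F) v = (\<chi> s. \<Sum>i\<in>UNIV. v $ i * F $ i $ s)"
  by (subst row_act_eq_dop_act) (simp add: vec_eq_iff matrix_mul_nth)

lemma row_act_real_mat [simp]:
  "row_act (dop_real_mat F) v = (\<chi> s. \<Sum>i\<in>UNIV. v $ i * map_poly of_real (F $ i $ s))"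
  by (simp add: dop_real_mat_def map_matrix_def)

lemma dop_eq_by_row_act:
  assumes "\<And>v. row_act D v = row_act E v"
  shows "D = E"
  by (rule dop_eq_by_act) (simp add: vec_eq_iff[of "dop_act _ _"] dop_act_nth assms)

lemma local_op_row_act:
  assumes "\<And>i. local_op (\<lambda>p. V p $ i)"
  shows "local_op (\<lambda>p. row_act D (V p) $ s)"
proof -
  have "local_op (\<lambda>p. \<Sum>j | dop_coeff D j \<noteq> 0. \<Sum>i\<in>UNIV. dop_coeff D j $ i $ s * (pderiv ^^ j) (V p $ i))"
    by (intro local_op_sum local_op_mult local_op_higher_pderiv assms)
  then show ?thesis by (simp add: row_act_def mult.commute)
qed

text \<open>The value of \<open>v \<cdot> D\<close> at a point does not see terms of high order in \<open>v\<close> there.\<close>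

lemma row_act_jet_bound:
  "\<exists>M. \<forall>v. (\<forall>i. \<forall>j<M. poly ((pderiv ^^ j) (v $ i)) z = 0) \<longrightarrow> poly (row_act D v $ s) z = 0"
proof -
  obtain M where M: "\<And>j. j \<ge> M \<Longrightarrow> dop_coeff D j = 0"
    using dop_coeff_bounded by blast
  show ?thesis
  proof (intro exI[of _ M] allI impI)
    fix v :: "complex poly^'a"
    assume v: "\<forall>i. \<forall>j<M. poly ((pderiv ^^ j) (v $ i)) z = 0"
    have "j < M" if "dop_coeff D j \<noteq> 0" for j
      using M[of j] that not_le by blast
    then show "poly (row_act D v $ s) z = 0"
      using v by (auto simp: row_act_def poly_sum intro!: sum.neutral)
  qed
qed

section \<open>Monic sequences\<close>

lemma monic_pmat_coeff:
  assumes "monic_pmat n P"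
  shows "coeff (P $ r $ s) n = (if r = s then 1 else 0)" and "deg_less (Suc n) (P $ r $ s)"
  using assms unfolding monic_pmat_def
  by (auto simp: vec_eq_iff mat_def Suc_le_eq intro: coeff_eq_0 le_less_trans)

text \<open>The rows of \<open>P\<^sub>0, \<dots>, P\<^bsub>n - 1\<^esub>\<close> span all rows of degree less than \<open>n\<close>, because the leading
  coefficients are identity matrices. This is stated as an induction rule for predicates that are
  preserved by linear combinations.\<close>

lemma monic_row_induct [consumes 2, case_names zero add scale row]:
  fixes P :: "nat \<Rightarrow> 'n::finite pmat"
  assumes "\<And>s. deg_less n (w $ s)" and monic: "\<And>m. m < n \<Longrightarrow> monic_pmat m (P m)"
    and "S 0" and add: "\<And>u v. S u \<Longrightarrow> S v \<Longrightarrow> S (u + v)"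
    and scale: "\<And>c u. S u \<Longrightarrow> S ([:c:] *s u)"
    and row: "\<And>m s. m < n \<Longrightarrow> S (P m $ s)"
  shows "S w"
  using assms(1) monic row
proof (induction n arbitrary: w)
  case 0
  then have "w = 0" by (simp add: vec_eq_iff poly_eq_iff)
  then show ?case using \<open>S 0\<close> by simp
next
  case (Suc n)
  define u where "u = (\<Sum>s\<in>UNIV. [:coeff (w $ s) n:] *s (P n $ s))"
  have M: "coeff (P n $ s $ t) n = (if s = t then 1 else 0)" "deg_less (Suc n) (P n $ s $ t)" for s t
    using monic_pmat_coeff[OF Suc.prems(2)[of n]] by auto
  have sum_S: "S (\<Sum>s\<in>I. f s)" if "\<And>s. s \<in> I \<Longrightarrow> S (f s)" for I and f :: "'n \<Rightarrow> _"
    using that by (induction I rule: infinite_finite_induct) (auto intro: add \<open>S 0\<close>)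
  have "S u"
    unfolding u_def by (intro sum_S scale Suc.prems(3)) simp
  have "deg_less n ((w - u) $ t)" for t
  proof (intro allI impI)
    fix j assume "j \<ge> n"
    then show "coeff ((w - u) $ t) j = 0"
      using Suc.prems(1)[of t] M
      by (cases "j = n") (auto simp: u_def coeff_sum if_distrib[of "\<lambda>x. _ * x"] cong: if_cong)
  qed
  then have "S (w - u)"
    using Suc.IH[of "w - u"] Suc.prems(2,3) by (meson less_Suc_eq)
  then show ?case using add[OF _ \<open>S u\<close>, of "w - u"] by simp
qed

text \<open>An operator is therefore determined by its action on a monic sequence.\<close>

lemma dop_eq_on_monic:
  assumes monic: "\<And>n. monic_pmat n (P n)"
    and eq: "\<And>n s. row_act D (P n $ s) = row_act E (P n $ s)"
  shows "D = E"
proof (rule dop_eq_by_row_act)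
  fix v :: "complex poly^'a"
  define n where "n = Suc (Max (range (\<lambda>s. degree (v $ s))))"
  have "degree (v $ s) < n" for s
    unfolding n_def by (simp add: less_Suc_eq_le)
  then have "deg_less n (v $ s)" for s
    by (metis coeff_eq_0 order.strict_trans1 order_less_le_trans)
  then show "row_act D v = row_act E v"
    by (rule monic_row_induct[where P = P]) (simp_all add: monic row_act_add row_act_scale eq)
qed

section \<open>Orthogonality as an algebraic condition\<close>

text \<open>The form \<open>\<integral> v W w\<^sup>*\<close> for a weight \<open>W\<close> that is a scalar Jacobi density times a polynomial matrix
  \<open>M\<close>. Conjugating the coefficients of \<open>w\<close> makes the integrand a polynomial times the
  density.\<close>

definition row_form :: "real \<Rightarrow> real \<Rightarrow> 'n::finite pmat \<Rightarrow> complex poly^'n \<Rightarrow> complex poly^'n \<Rightarrow> complex"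
  where "row_form a b M v w =
    jacobi_integral a b (\<Sum>i\<in>UNIV. \<Sum>j\<in>UNIV. v $ i * M $ i $ j * map_poly cnj (w $ j))"

lemma map_poly_cnj_add: "map_poly cnj (p + q) = map_poly cnj p + map_poly cnj q"
  and map_poly_cnj_mult: "map_poly cnj (p * q) = map_poly cnj p * map_poly cnj q"
  and map_poly_cnj_smult: "map_poly cnj (smult c p) = smult (cnj c) (map_poly cnj p)"
  by (rule poly_eq_pointwise, simp)+

lemma map_poly_cnj_sum: "map_poly cnj (sum f I) = (\<Sum>i\<in>I. map_poly cnj (f i))"
  by (induction I rule: infinite_finite_induct) (simp_all add: map_poly_cnj_add)

lemma map_poly_cnj_cnj [simp]: "map_poly cnj (map_poly cnj p) = p"
  by (rule poly_eq_pointwise) simp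

lemma jacobi_integral_cnj: "jacobi_integral a b (map_poly cnj p) = cnj (jacobi_integral a b p)"
proof -
  have "jacobi_integral a b (map_poly cnj p) =
      (LINT x|lborel. cnj (indicator {-1<..<1} x *\<^sub>R (jacobi_density a b x *\<^sub>R poly p (of_real x))))"
    by (simp add: jacobi_integral_def set_lebesgue_integral_def)
  then show ?thesis
    by (simp only: Bochner_Integration.integral_cnj jacobi_integral_def set_lebesgue_integral_def)
qed

lemma row_form_add:
  assumes "a > -1" "b > -1"
  shows "row_form a b M (u + v) w = row_form a b M u w + row_form a b M v w"
    and "row_form a b M u (v + w) = row_form a b M u v + row_form a b M u w"
  by (simp_all add: row_form_def jacobi_integral_add[OF assms, symmetric] map_poly_cnj_add
      sum.distrib[symmetric] algebra_simps)

lemma row_form_scale: "row_form a b M u ([:c:] *s v) = cnj c * row_form a b M u v"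
  "row_form a b M ([:c:] *s u) v = c * row_form a b M u v"
  by (simp_all add: row_form_def jacobi_integral_smult[symmetric] map_poly_cnj_smult smult_sum_right)

lemma row_form_0 [simp]: "row_form a b M u 0 = 0" "row_form a b M 0 u = 0"
  by (simp_all add: row_form_def)

lemma row_form_hermitian:
  assumes M: "\<And>i j. map_poly cnj (M $ i $ j) = M $ j $ i"
  shows "row_form a b M w v = cnj (row_form a b M v w)"
  unfolding row_form_def jacobi_integral_cnj[symmetric] map_poly_cnj_sum map_poly_cnj_mult map_poly_cnj_cnj M
  by (subst sum.swap) (simp add: mult_ac)

lemma set_integrable_matrix:
  fixes F :: "real \<Rightarrow> complex^'n::finite^'m::finite"
  assumes "\<And>r s. set_integrable M S (\<lambda>x. F x $ r $ s)"
  shows "set_integrable M S F"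
proof -
  have e: "A = (\<Sum>r\<in>UNIV. \<Sum>s\<in>UNIV. axis r (axis s (A $ r $ s)))" for A :: "complex^'n^'m"
  proof -
    have "axis r (axis s z) $ i $ j = (if s = j then if r = i then z else 0 else 0)"
      for r i :: 'm and s j :: 'n and z :: complex
      by (auto simp: axis_def)
    then have "(\<Sum>r\<in>UNIV. \<Sum>s\<in>UNIV. axis r (axis s (A $ r $ s))) $ i $ j = A $ i $ j" for i j
      by (simp only: sum_component) simp
    then show ?thesis unfolding vec_eq_iff by metis
  qed
  have bl: "bounded_linear (\<lambda>z::complex. axis r (axis s z) :: complex^'n^'m)" for r s
    by (rule linear_conv_bounded_linear[THEN iffD1])
      (auto simp: linear_iff vec_eq_iff axis_def)
  have "integrable M (\<lambda>x. \<Sum>r\<in>UNIV. \<Sum>s\<in>UNIV. axis r (axis s (indicator S x *\<^sub>R F x $ r $ s)) :: complex^'n^'m)"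
    using assms unfolding set_integrable_def
    by (intro Bochner_Integration.integrable_sum integrable_bounded_linear[OF bl])
  moreover have "(\<Sum>r\<in>UNIV. \<Sum>s\<in>UNIV. axis r (axis s (indicator S x *\<^sub>R F x $ r $ s))) = indicator S x *\<^sub>R F x" for x
    using e[of "indicator S x *\<^sub>R F x"] by simp
  ultimately show ?thesis by (simp add: set_integrable_def)
qed

lemma set_integral_matrix_nth:
  fixes F :: "real \<Rightarrow> complex^'n::finite^'m::finite"
  assumes "set_integrable M S F"
  shows "(LINT x:S|M. F x) $ r $ s = (LINT x:S|M. F x $ r $ s)"
proof -
  have bl: "bounded_linear (\<lambda>A :: complex^'n^'m. A $ r $ s)"
    by (rule linear_conv_bounded_linear[THEN iffD1]) (simp add: linear_iff)
  show ?thesis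
    using integral_bounded_linear[OF bl assms[unfolded set_integrable_def]]
    by (simp add: set_lebesgue_integral_def)
qed

lemma monic_orthogonal_iff:
  fixes P :: "nat \<Rightarrow> 'n::finite pmat"
  assumes ab: "a > -1" "b > -1"
    and W: "\<And>x. W x = jacobi_density a b x *\<^sub>R pmat_eval M x"
  shows "monic_orthogonal {-1<..<1} W P \<longleftrightarrow> (\<forall>n. monic_pmat n (P n)) \<and>
    (\<forall>n m r s. n \<noteq> m \<longrightarrow> row_form a b M (P n $ r) (P m $ s) = 0)"
proof -
  define F where "F n m x = pmat_eval (P n) x ** W x ** adjoint_cmat (pmat_eval (P m) x)" for n m x
  define q where "q n m r s = (\<Sum>i\<in>UNIV. \<Sum>j\<in>UNIV. P n $ r $ i * M $ i $ j * map_poly cnj (P m $ s $ j))"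
    for n m r s
  have nth: "F n m x $ r $ s = jacobi_density a b x *\<^sub>R poly (q n m r s) (of_real x)" for n m x r s
  proof -
    have "F n m x $ r $ s = (\<Sum>j\<in>UNIV. \<Sum>i\<in>UNIV. jacobi_density a b x *\<^sub>R
        poly (P n $ r $ i * M $ i $ j * map_poly cnj (P m $ s $ j)) (of_real x))"
      by (simp add: F_def W matrix_mul_nth pmat_eval_def adjoint_cmat_def transpose_def map_matrix_def
          sum_distrib_right)
    also have "\<dots> = (\<Sum>i\<in>UNIV. \<Sum>j\<in>UNIV. jacobi_density a b x *\<^sub>R
        poly (P n $ r $ i * M $ i $ j * map_poly cnj (P m $ s $ j)) (of_real x))"
      by (rule sum.swap)
    finally show ?thesis
      by (simp add: q_def poly_sum scaleR_sum_right)
  qed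
  have int: "set_integrable lborel {-1<..<1} (F n m)" for n m
    by (rule set_integrable_matrix) (simp only: nth jacobi_density_poly_integrable[OF ab])
  have "(LINT x:{-1<..<1}|lborel. F n m x) $ r $ s = row_form a b M (P n $ r) (P m $ s)" for n m r s
    unfolding set_integral_matrix_nth[OF int] nth
    by (simp add: jacobi_integral_def row_form_def q_def)
  then have "(LINT x:{-1<..<1}|lborel. F n m x) = 0 \<longleftrightarrow>
      (\<forall>r s. row_form a b M (P n $ r) (P m $ s) = 0)" for n m
    by (simp add: vec_eq_iff)
  then show ?thesis
    using int unfolding monic_orthogonal_def F_def by (auto simp del: set_integral_scaleR_right)
qed

text \<open>Each row of \<open>P\<^sub>n - Q\<^sub>n\<close> has degree less than \<open>n\<close>, hence is orthogonal to the corresponding rows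
  of both \<open>P\<^sub>n\<close> and \<open>Q\<^sub>n\<close>, and so to itself.\<close>

lemma monic_orthogonal_unique:
  fixes P Q :: "nat \<Rightarrow> 'n::finite pmat"
  assumes ab: "a > -1" "b > -1"
    and definite: "\<And>v. row_form a b M v v = 0 \<Longrightarrow> v = 0"
    and P: "\<And>n. monic_pmat n (P n)" "\<And>n m r s. n \<noteq> m \<Longrightarrow> row_form a b M (P n $ r) (P m $ s) = 0"
    and Q: "\<And>n. monic_pmat n (Q n)" "\<And>n m r s. n \<noteq> m \<Longrightarrow> row_form a b M (Q n $ r) (Q m $ s) = 0"
  shows "P = Q"
proof -
  have lower: "row_form a b M (R n $ r) w = 0"
    if R: "\<And>n. monic_pmat n (R n)" "\<And>n m r s. n \<noteq> m \<Longrightarrow> row_form a b M (R n $ r) (R m $ s) = 0"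
      and w: "\<And>s. deg_less n (w $ s)" for R :: "nat \<Rightarrow> 'n pmat" and n r w
    using w by (rule monic_row_induct[where P = R])
      (simp_all add: R row_form_add[OF ab] row_form_scale)
  have "P n $ r = Q n $ r" for n r
  proof -
    let ?w = "P n $ r - Q n $ r"
    have w: "deg_less n (?w $ s)" for s
    proof (intro allI impI)
      fix j assume "j \<ge> n"
      then show "coeff (?w $ s) j = 0"
        using monic_pmat_coeff[OF P(1)[of n], of r s] monic_pmat_coeff[OF Q(1)[of n], of r s]
        by (cases "j = n") auto
    qed
    have "row_form a b M (P n $ r) ?w = row_form a b M (Q n $ r) ?w + row_form a b M ?w ?w"
      using row_form_add(1)[OF ab, of M "Q n $ r" ?w ?w] by simp
    moreover have "row_form a b M (P n $ r) ?w = 0" "row_form a b M (Q n $ r) ?w = 0"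
      using lower[of P, OF P w] lower[of Q, OF Q w] by blast+
    ultimately have "row_form a b M ?w ?w = 0" by simp
    then show ?thesis using definite by fastforce
  qed
  then show ?thesis by (simp add: fun_eq_iff vec_eq_iff)
qed

section \<open>Leading coefficients\<close>

text \<open>Leading coefficients multiply, since lower terms of the Leibniz rule only enter below the top
  order. The product may vanish, so this bounds the order of \<open>D E\<close> without determining it.\<close>

lemma dop_coeff_times_lead:
  assumes D: "\<And>i. i > m \<Longrightarrow> dop_coeff D i = 0" and E: "\<And>j. j > l \<Longrightarrow> dop_coeff E j = 0"
  shows "n > m + l \<Longrightarrow> dop_coeff (D * E) n = 0"
    and "dop_coeff (D * E) (m + l) = dop_coeff D m ** dop_coeff E l"
proof -
  let ?t = "\<lambda>n i j. map_matrix ((*) (of_nat (j choose (n - i))))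
    ((pmat_deriv ^^ (j - (n - i))) (dop_coeff D i) ** dop_coeff E j)"
  have c: "dop_coeff (D * E) n = (\<Sum>i\<le>n. \<Sum>j<Suc l. ?t n i j)" for n
    by (rule dop_coeff_times_bounded) (simp add: E)
  \<comment> \<open>At or above the top order every term except the leading one has a vanishing binomial or coefficient.\<close>
  have z: "?t n i j = 0" if "j < Suc l" "n \<ge> m + l" "\<not> (n = m + l \<and> i = m \<and> j = l)" "i \<le> n" for n i j
  proof (cases "i \<le> m")
    case True
    then have "j < n - i" using that by auto
    then show ?thesis by (simp add: binomial_eq_0)
  qed (simp add: D)
  show "dop_coeff (D * E) n = 0" if "n > m + l"
    unfolding c using that by (intro sum.neutral ballI z) auto
  have "(\<Sum>i\<le>m + l. \<Sum>j<Suc l. ?t (m + l) i j) = (\<Sum>i\<in>{m}. \<Sum>j\<in>{l}. ?t (m + l) i j)"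
  proof -
    have "(\<Sum>j<Suc l. ?t (m + l) i j) = 0" if "i \<in> {..m + l} - {m}" for i
      using that by (intro sum.neutral ballI z) auto
    then have "(\<Sum>i\<le>m + l. \<Sum>j<Suc l. ?t (m + l) i j) = (\<Sum>i\<in>{m}. \<Sum>j<Suc l. ?t (m + l) i j)"
      by (intro sum.mono_neutral_right) auto
    also have "(\<Sum>j<Suc l. ?t (m + l) m j) = (\<Sum>j\<in>{l}. ?t (m + l) m j)"
      by (intro sum.mono_neutral_right ballI z) auto
    then have "(\<Sum>i\<in>{m}. \<Sum>j<Suc l. ?t (m + l) i j) = (\<Sum>i\<in>{m}. \<Sum>j\<in>{l}. ?t (m + l) i j)"
      by simp
    finally show ?thesis .
  qed
  then show "dop_coeff (D * E) (m + l) = dop_coeff D m ** dop_coeff E l"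
    unfolding c by (simp add: vec_eq_iff map_matrix_def)
qed

lemma dop_order_eqI:
  assumes "\<And>j. j > n \<Longrightarrow> dop_coeff D j = 0" "dop_coeff D n \<noteq> 0"
  shows "dop_order D = n"
  unfolding dop_order_def
proof (rule Least_equality)
  show "n \<le> m" if "\<forall>j>m. dop_coeff D j = 0" for m
    using that assms(2) not_le by blast
qed (use assms(1) in blast)

lemma dop_coeff_sum: "dop_coeff (\<Sum>i\<in>I. f i) j = (\<Sum>i\<in>I. dop_coeff (f i) j)"
  by (induction I rule: infinite_finite_induct) simp_all

lemma second_order_coeff:
  fixes F G H :: "real poly^'n::finite^'n"
  defines "D \<equiv> dop_del\<^sup>2 * dop_real_mat F + dop_del * dop_real_mat G + dop_real_mat H"
  shows "j > 2 \<Longrightarrow> dop_coeff D j = 0" and "dop_coeff D 2 = map_matrix (map_poly of_real) F"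
proof -
  have m: "dop_coeff (dop_real_mat X) j = 0" if "j > 0" for j and X :: "real poly^'n^'n"
    using that by (simp add: dop_real_mat_def)
  have d: "dop_coeff (dop_del :: 'n dop) j = 0" if "j > 1" for j
    using that by simp
  have "dop_coeff (dop_del * dop_del :: 'n dop) j = 0" if "j > 1 + 1" for j
    by (rule dop_coeff_times_lead(1)[OF d d that])
  then have dd: "dop_coeff (dop_del\<^sup>2 :: 'n dop) j = 0" if "j > 2" for j
    using that by (simp add: power2_eq_square)
  have "dop_coeff (dop_del * dop_del :: 'n dop) (1 + 1) = dop_coeff dop_del 1 ** dop_coeff dop_del 1"
    by (rule dop_coeff_times_lead(2)[OF d d])
  then have dd2: "dop_coeff (dop_del\<^sup>2 :: 'n dop) 2 = mat 1"
    by (simp add: power2_eq_square numeral_2_eq_2)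
  have f: "dop_coeff (dop_del\<^sup>2 * dop_real_mat F) j = 0" if "j > 2" for j
    by (rule dop_coeff_times_lead(1)[where m = 2 and l = 0]) (use dd m that in auto)
  have f2: "dop_coeff (dop_del\<^sup>2 * dop_real_mat F) (2 + 0) = dop_coeff (dop_del\<^sup>2) 2 ** dop_coeff (dop_real_mat F) 0"
    by (rule dop_coeff_times_lead(2)) (use dd m in auto)
  have g: "dop_coeff (dop_del * dop_real_mat G) j = 0" if "j > 1" for j
    by (rule dop_coeff_times_lead(1)[where m = 1 and l = 0]) (use d m that in auto)
  show "dop_coeff D j = 0" if "j > 2"
    unfolding D_def using f[of j] g[of j] m[of j H] that by simp
  show "dop_coeff D 2 = map_matrix (map_poly of_real) F"
    unfolding D_def using f2 g[of 2] m[of 2 H] dd2 by (simp add: dop_real_mat_def)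
qed

section \<open>Factorization through scalar operators\<close>

lemma vector2_eqI: "(v :: 'a^2) $ 1 = w $ 1 \<Longrightarrow> v $ 2 = w $ 2 \<Longrightarrow> v = w"
  by (simp add: vec_eq_iff forall_2)

lemma mat2_nth [simp]:
  "mat2 a b c d $ 1 $ 1 = a" "mat2 a b c d $ 1 $ 2 = b"
  "mat2 a b c d $ 2 $ 1 = c" "mat2 a b c d $ 2 $ 2 = d"
  by (simp_all add: mat2_def)

lemma
  fixes S :: "'n::finite dop set"
  defines "G \<equiv> dop_algebra_generated (insert 1 S)"
  shows generated_power: "D \<in> G \<Longrightarrow> D ^ j \<in> G"
    and generated_sum: "(\<And>i. i \<in> I \<Longrightarrow> f i \<in> G) \<Longrightarrow> (\<Sum>i\<in>I. f i) \<in> G"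
proof -
  show "D ^ j \<in> G" if "D \<in> G"
    by (induction j) (use that in \<open>auto simp: G_def intro: dop_algebra_generated.intros\<close>)
  show "(\<And>i. i \<in> I \<Longrightarrow> f i \<in> G) \<Longrightarrow> (\<Sum>i\<in>I. f i) \<in> G"
    by (induction I rule: infinite_finite_induct) (auto simp: G_def intro: dop_algebra_generated.intros)
qed

lemma poly_altdef_le:
  fixes p :: "complex poly"
  assumes "degree p \<le> N"
  shows "poly p x = (\<Sum>i\<le>N. coeff p i * x ^ i)"
  unfolding poly_altdef
  by (rule sum.mono_neutral_left) (use assms in \<open>auto simp: coeff_eq_0\<close>)

text \<open>The maps below are first order differential operators between scalars and row vectors:
  \<open>lift0\<close> and \<open>proj0\<close> belong to the Jacobi weight with exponents \<open>(\<alpha> + 1, \<beta>)\<close>, \<open>lift1\<close> and \<open>proj1\<close> to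
  the one with exponents \<open>(\<alpha> + 1, \<beta> + 1)\<close>.\<close>

locale jacobi_type_weight =
  fixes \<alpha> \<beta> k :: real
  assumes \<alpha>: "\<alpha> > -1" and \<beta>: "\<beta> > -1" and k_pos: "0 < k" and k_less: "k < \<alpha> + 1"
begin

definition lift0 :: "complex poly \<Rightarrow> complex poly^2"
  where "lift0 h = vector [[:1, -1:] * pderiv h - smult (of_real k) h, smult (-2) (pderiv h)]"

definition proj0 :: "complex poly^2 \<Rightarrow> complex poly"
  where "proj0 v = [:1, 1:] * pderiv (v $ 1) + smult (of_real (\<alpha> + \<beta> + 2 - k)) (v $ 1)
    + smult (of_real (\<alpha> + 1 - k)) (v $ 2)"

definition lift1 :: "complex poly \<Rightarrow> complex poly^2"
  where "lift1 f = vector [f,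
    smult (- 1 / of_real (\<alpha> + 1 - k)) ([:1, 1:] * pderiv f + smult (of_real (\<alpha> + \<beta> + 2 - k)) f)]"

definition proj1 :: "complex poly^2 \<Rightarrow> complex poly"
  where "proj1 v = smult (of_real (\<alpha> + 1 - k))
    (smult (of_real (k + 1)) (v $ 2) - smult 2 (pderiv (v $ 1)) - [:1, -1:] * pderiv (v $ 2))"

text \<open>These constants make \<open>proj0 \<circ> lift0 + glue0\<close> and \<open>proj1 \<circ> lift1 + glue1\<close> Jacobi operators. They are also
  the two points at which the eigenvalues of an operator in \<open>\<D>(W)\<close> on the two families of
  eigenfunctions are tied together, see \<open>weight_algebra_polynomial\<close>.\<close>

definition glue0 :: complex where "glue0 = of_real (k * (\<alpha> + \<beta> + 2 - k))"
definition glue1 :: complex where "glue1 = of_real ((k + 1) * (\<alpha> + \<beta> + 2 - k))"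

lemma lift1_denom_nonzero: "complex_of_real \<alpha> + 1 - complex_of_real k \<noteq> 0"
proof -
  have "\<alpha> + 1 - k \<noteq> 0" using k_less by simp
  then have "complex_of_real (\<alpha> + 1 - k) \<noteq> 0" by (simp only: of_real_eq_0_iff) simp
  then show ?thesis by simp
qed

lemma lift0_nth [simp]: "lift0 h $ 1 = [:1, -1:] * pderiv h - smult (of_real k) h"
  "lift0 h $ 2 = smult (-2) (pderiv h)"
  by (simp_all add: lift0_def)

lemma lift1_nth [simp]: "lift1 f $ 1 = f" "lift1 f $ 2 =
  smult (- 1 / of_real (\<alpha> + 1 - k)) ([:1, 1:] * pderiv f + smult (of_real (\<alpha> + \<beta> + 2 - k)) f)"
  by (simp_all add: lift1_def)

lemma lift0_smult: "lift0 (smult c h) = [:c:] *s lift0 h"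
  and lift1_smult: "lift1 (smult c h) = [:c:] *s lift1 h"
  by (rule vector2_eqI; rule poly_eq_pointwise; simp add: pderiv_smult algebra_simps)+

lemma lift0_0 [simp]: "lift0 0 = 0" and lift1_0 [simp]: "lift1 0 = 0"
  by (rule vector2_eqI; simp)+

lemma proj0_add: "proj0 (v + w) = proj0 v + proj0 w"
  and proj1_add: "proj1 (v + w) = proj1 v + proj1 w"
  and proj0_scale: "proj0 ([:c:] *s v) = smult c (proj0 v)"
  and proj1_scale: "proj1 ([:c:] *s v) = smult c (proj1 v)"
  by (rule poly_eq_pointwise; simp add: proj0_def proj1_def pderiv_add pderiv_smult algebra_simps)+

lemma proj0_lift1: "proj0 (lift1 f) = 0"
  by (rule poly_eq_pointwise) (use lift1_denom_nonzero in \<open>simp add: proj0_def field_simps\<close>)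

lemma proj1_lift0: "proj1 (lift0 h) = 0"
  by (rule poly_eq_pointwise)
    (simp add: proj1_def pderiv_diff pderiv_add pderiv_minus pderiv_mult pderiv_smult pderiv_pCons algebra_simps)

lemma proj0_lift0: "proj0 (lift0 h) = jacobi_op (\<alpha> + 1) \<beta> h - smult glue0 h"
  by (rule poly_eq_pointwise)
    (simp add: proj0_def jacobi_op_def glue0_def pderiv_diff pderiv_add pderiv_minus pderiv_mult pderiv_smult
      pderiv_pCons algebra_simps)

lemma proj1_lift1: "proj1 (lift1 f) = jacobi_op (\<alpha> + 1) (\<beta> + 1) f - smult glue1 f"
proof -
  define c where "c = complex_of_real (\<alpha> + 1 - k)"
  have c: "c \<noteq> 0" using lift1_denom_nonzero by (simp add: c_def)
  have a: "complex_of_real \<alpha> = c - 1 + of_real k" by (simp add: c_def)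
  show ?thesis
    by (rule poly_eq_pointwise)
      (use c in \<open>simp add: proj1_def jacobi_op_def glue1_def pderiv_diff pderiv_add pderiv_minus pderiv_mult pderiv_smult
      pderiv_pCons a field_simps\<close>)
qed

text \<open>The operator \<open>D\<^sub>2\<close> is degenerate: it factors through scalar polynomials, and its kernel is the image
  of \<open>lift1\<close>.\<close>

lemma row_act_D2: "row_act (jacobi_D2 \<alpha> \<beta> k) v = lift0 (proj0 v)"
  by (rule vector2_eqI; rule poly_eq_pointwise;
    simp add: jacobi_D2_def row_act_dop_add row_act_times power2_eq_square sum_2 map_poly_pCons proj0_def
     pderiv_diff pderiv_add pderiv_minus pderiv_mult pderiv_smult pderiv_pCons algebra_simps)

text \<open>Correspondingly \<open>D\<^sub>1 - D\<^sub>2 - glue1\<close> factors through \<open>proj1\<close> and \<open>lift1\<close>.\<close>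

lemma row_act_D1: "row_act (jacobi_D1 \<alpha> \<beta> k) v = lift0 (proj0 v) + lift1 (proj1 v) + [:glue1:] *s v"
proof -
  define c where "c = complex_of_real (\<alpha> + 1 - k)"
  have c: "c \<noteq> 0" using lift1_denom_nonzero by (simp add: c_def)
  have a: "complex_of_real \<alpha> = c - 1 + of_real k" by (simp add: c_def)
  show ?thesis
    by (rule vector2_eqI; rule poly_eq_pointwise;
      use c in \<open>simp add: jacobi_D1_def row_act_dop_add row_act_times power2_eq_square sum_2 map_poly_pCons proj0_def
       proj1_def glue1_def pderiv_diff pderiv_add pderiv_minus pderiv_mult pderiv_smult pderiv_pCons a field_simps\<close>)
qed

section \<open>The orthogonal polynomials\<close>

abbreviation h_poly :: "nat \<Rightarrow> complex poly"
  where "h_poly \<equiv> jacobi_poly (\<alpha> + 1) \<beta>"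

abbreviation f_poly :: "nat \<Rightarrow> complex poly"
  where "f_poly \<equiv> jacobi_poly (\<alpha> + 1) (\<beta> + 1)"

abbreviation h_ev :: "nat \<Rightarrow> complex"
  where "h_ev \<equiv> jacobi_eigenvalue (\<alpha> + 1) \<beta>"

abbreviation f_ev :: "nat \<Rightarrow> complex"
  where "f_ev \<equiv> jacobi_eigenvalue (\<alpha> + 1) (\<beta> + 1)"

definition h_row :: "nat \<Rightarrow> complex poly^2"
  where "h_row n = lift0 (h_poly n)"

definition f_row :: "nat \<Rightarrow> complex poly^2"
  where "f_row n = lift1 (f_poly n)"

lemma shifted_exponents: "\<alpha> + 1 > -1" "\<beta> + 1 > -1"
  using \<alpha> \<beta> by auto

lemma n_plus_k_nonzero: "of_nat n + complex_of_real k \<noteq> 0"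
proof -
  have "real n + k \<noteq> 0" using k_pos by linarith
  then have "complex_of_real (real n + k) \<noteq> 0" by (simp only: of_real_eq_0_iff) simp
  then show ?thesis by simp
qed

lemma n_plus_sk_nonzero: "of_nat n + complex_of_real (\<alpha> + \<beta> + 2 - k) \<noteq> 0"
proof -
  have "real n + (\<alpha> + \<beta> + 2 - k) \<noteq> 0" using \<beta> k_less by linarith
  then have "complex_of_real (real n + (\<alpha> + \<beta> + 2 - k)) \<noteq> 0" by (simp only: of_real_eq_0_iff) simp
  then show ?thesis by simp
qed

text \<open>The shifted eigenvalues on \<open>h_row\<close> and \<open>f_row\<close> have the common root
  \<open>n = k - (\<alpha> + \<beta> + 2)\<close>, which is the origin of the gluing condition, but for natural numbers \<open>n\<close> they are nonzero.\<close>

lemma h_ev_factor: "h_ev n - glue0 = - (of_nat n + of_real k) * (of_nat n + of_real (\<alpha> + \<beta> + 2 - k))"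
  by (simp add: jacobi_eigenvalue_def glue0_def algebra_simps)

lemma f_ev_factor: "f_ev n - glue1 = - (of_nat (Suc n) + of_real k) * (of_nat n + of_real (\<alpha> + \<beta> + 2 - k))"
  by (simp add: jacobi_eigenvalue_def glue1_def algebra_simps)

lemma h_ev_nonzero: "h_ev n - glue0 \<noteq> 0" and f_ev_nonzero: "f_ev n - glue1 \<noteq> 0"
  unfolding h_ev_factor f_ev_factor
  using n_plus_k_nonzero[of n] n_plus_k_nonzero[of "Suc n"] n_plus_sk_nonzero[of n] by (simp_all add: add_eq_0_iff)

lemma proj0_h_row: "proj0 (h_row n) = smult (h_ev n - glue0) (h_poly n)"
  by (simp add: h_row_def proj0_lift0 jacobi_op_jacobi_poly[OF shifted_exponents(1) \<beta>] smult_diff_left)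

lemma proj1_f_row: "proj1 (f_row n) = smult (f_ev n - glue1) (f_poly n)"
  by (simp add: f_row_def proj1_lift1 jacobi_op_jacobi_poly[OF shifted_exponents] smult_diff_left)

lemma proj0_f_row: "proj0 (f_row n) = 0" and proj1_h_row: "proj1 (h_row n) = 0"
  by (simp_all add: f_row_def h_row_def proj0_lift1 proj1_lift0)

lemma row_act_D2_rows:
  "row_act (jacobi_D2 \<alpha> \<beta> k) (h_row n) = [:h_ev n - glue0:] *s h_row n"
  "row_act (jacobi_D2 \<alpha> \<beta> k) (f_row n) = [:0:] *s f_row n"
  by (simp_all add: row_act_D2 proj0_h_row proj0_f_row lift0_smult) (simp add: h_row_def)

lemma row_act_D1_rows:
  "row_act (jacobi_D1 \<alpha> \<beta> k) (h_row n) = [:h_ev n + of_real (\<alpha> + \<beta> + 2 - k):] *s h_row n"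
  "row_act (jacobi_D1 \<alpha> \<beta> k) (f_row n) = [:f_ev n:] *s f_row n"
proof -
  have e: "h_ev n + of_real (\<alpha> + \<beta> + 2 - k) = (h_ev n - glue0) + glue1"
    by (simp add: glue0_def glue1_def algebra_simps)
  show "row_act (jacobi_D1 \<alpha> \<beta> k) (h_row n) = [:h_ev n + of_real (\<alpha> + \<beta> + 2 - k):] *s h_row n"
    unfolding e
    by (simp add: row_act_D1 proj0_h_row proj1_h_row lift0_smult vector_sadd_rdistrib[symmetric] flip: h_row_def)
  show "row_act (jacobi_D1 \<alpha> \<beta> k) (f_row n) = [:f_ev n:] *s f_row n"
    by (simp add: row_act_D1 proj1_f_row proj0_f_row lift1_smult vector_sadd_rdistrib[symmetric] flip: f_row_def)
qed

definition weight_matrix :: "2 pmat"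
  where "weight_matrix = map_matrix (map_poly complex_of_real) (mat2
    [:4 * (\<alpha> + 1) - 2 * k, 2 * k:]                  [:2 * (\<alpha> + 1 - k), - 2 * (\<alpha> + 1 - k):]
    [:2 * (\<alpha> + 1 - k), - 2 * (\<alpha> + 1 - k):]    [:\<alpha> + 1 - k, - 2 * (\<alpha> + 1 - k), \<alpha> + 1 - k:])"

lemma weight_matrix_nth [simp]:
  "weight_matrix $ 1 $ 1 = [:4 * (of_real \<alpha> + 1) - 2 * of_real k, 2 * of_real k:]"
  "weight_matrix $ 1 $ 2 = [:2 * (of_real \<alpha> + 1 - of_real k), - 2 * (of_real \<alpha> + 1 - of_real k):]"
  "weight_matrix $ 2 $ 1 = [:2 * (of_real \<alpha> + 1 - of_real k), - 2 * (of_real \<alpha> + 1 - of_real k):]"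
  "weight_matrix $ 2 $ 2 = [:of_real \<alpha> + 1 - of_real k, - 2 * (of_real \<alpha> + 1 - of_real k), of_real \<alpha> + 1 - of_real k:]"
  by (simp_all add: weight_matrix_def map_matrix_def map_poly_pCons)

lemma jacobi_weight_eq:
  "jacobi_weight \<alpha> \<beta> k x = jacobi_density \<alpha> \<beta> x *\<^sub>R pmat_eval weight_matrix x"
  by (simp add: jacobi_weight_def vec_eq_iff forall_2 map_matrix_def pmat_eval_def jacobi_density_def)
    (simp add: scaleR_conv_of_real power2_eq_square algebra_simps)

abbreviation weight_form :: "complex poly^2 \<Rightarrow> complex poly^2 \<Rightarrow> complex"
  where "weight_form \<equiv> row_form \<alpha> \<beta> weight_matrix"

text \<open>Up to a constant \<open>proj0\<close> is the adjoint of \<open>lift0\<close> for the weight \<open>W\<close> and the Jacobi weight with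
  exponents \<open>(\<alpha> + 1, \<beta>)\<close>; the two integrands differ by a term of Pearson type.\<close>

lemma weight_form_lift0:
  "weight_form (lift0 h) v =
    - 2 * of_real k * jacobi_integral (\<alpha> + 1) \<beta> (h * proj0 (\<chi> i. map_poly cnj (v $ i)))"
proof -
  define g where "g = (\<chi> i. map_poly cnj (v $ i))"
  let ?q = "h * g $ 1"
  have "weight_form (lift0 h) v =
      jacobi_integral \<alpha> \<beta> (\<Sum>i\<in>UNIV. \<Sum>j\<in>UNIV. lift0 h $ i * weight_matrix $ i $ j * g $ j)"
    by (simp add: row_form_def g_def)
  also have "(\<Sum>i\<in>UNIV. \<Sum>j\<in>UNIV. lift0 h $ i * weight_matrix $ i $ j * g $ j) =
      smult (2 * of_real k) ([:1, 0, -1:] * pderiv ?q + [:of_real (\<beta> - \<alpha>), - of_real (\<alpha> + \<beta> + 2):] * ?q)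
      + smult (- 2 * of_real k) ([:1, -1:] * (h * proj0 g))"
    by (rule poly_eq_pointwise)
      (simp add: sum_2 proj0_def pderiv_mult algebra_simps)
  finally show ?thesis
    unfolding jacobi_integral_mod_pearson[OF \<alpha> \<beta>] jacobi_integral_smult jacobi_integral_shift g_def .
qed

text \<open>The analogous adjointness of \<open>lift1\<close> and \<open>proj1\<close>.\<close>

lemma weight_form_lift1:
  "weight_form (lift1 f) v =
    - 1 / of_real (\<alpha> + 1 - k) * jacobi_integral (\<alpha> + 1) (\<beta> + 1) (f * proj1 (\<chi> i. map_poly cnj (v $ i)))"
proof -
  define g where "g = (\<chi> i. map_poly cnj (v $ i))"
  define c where "c = complex_of_real (\<alpha> + 1 - k)"
  have c: "c \<noteq> 0" using lift1_denom_nonzero by (simp add: c_def)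
  have a: "complex_of_real \<alpha> = c - 1 + of_real k" by (simp add: c_def)
  let ?q = "- smult 2 (f * g $ 1) - [:1, -1:] * (f * g $ 2)"
  have "weight_form (lift1 f) v =
      jacobi_integral \<alpha> \<beta> (\<Sum>i\<in>UNIV. \<Sum>j\<in>UNIV. lift1 f $ i * weight_matrix $ i $ j * g $ j)"
    by (simp add: row_form_def g_def)
  also have "(\<Sum>i\<in>UNIV. \<Sum>j\<in>UNIV. lift1 f $ i * weight_matrix $ i $ j * g $ j) =
      smult 1 ([:1, 0, -1:] * pderiv ?q + [:of_real (\<beta> - \<alpha>), - of_real (\<alpha> + \<beta> + 2):] * ?q)
      + smult (- 1 / of_real (\<alpha> + 1 - k)) ([:1, -1:] * ([:1, 1:] * (f * proj1 g)))"
    by (rule poly_eq_pointwise)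
      (use c in \<open>simp add: sum_2 proj1_def pderiv_mult pderiv_diff pderiv_minus pderiv_smult pderiv_add pderiv_pCons
        a field_simps\<close>)
  finally show ?thesis
    unfolding jacobi_integral_mod_pearson[OF \<alpha> \<beta>] jacobi_integral_smult jacobi_integral_shift g_def .
qed

lemma deg_less_proj:
  assumes "\<And>s. deg_less n (v $ s)"
  shows "deg_less n (proj0 v)" "deg_less n (proj1 v)"
proof -
  have "deg_less n ([:c, d:] * pderiv (v $ s))" for c d s
    by (rule deg_less_pCons_mult_pderiv[OF assms])
  moreover from this[of 1 0] have "deg_less n (pderiv (v $ s))" for s by simp
  ultimately show "deg_less n (proj0 v)" "deg_less n (proj1 v)"
    using assms by (simp_all add: proj0_def proj1_def del: mult_pCons_left)
qed

text \<open>By adjointness this is the orthogonality of scalar Jacobi polynomials, as \<open>proj0\<close> and \<open>proj1\<close> do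
  not raise degrees.\<close>

lemma weight_form_rows:
  assumes "\<And>s. deg_less n (v $ s)"
  shows "weight_form (h_row n) v = 0" "weight_form (f_row n) v = 0"
proof -
  have "deg_less n ((\<chi> i. map_poly cnj (v $ i)) $ s)" for s
    using assms by (simp add: coeff_map_poly)
  from deg_less_proj[OF this] show "weight_form (h_row n) v = 0" "weight_form (f_row n) v = 0"
    by (simp_all add: h_row_def f_row_def weight_form_lift0 weight_form_lift1
        jacobi_poly_orthogonal[OF shifted_exponents(1) \<beta>] jacobi_poly_orthogonal[OF shifted_exponents])
qed

text \<open>Completing the square,
  \<open>u M u\<^sup>* = (\<alpha> + 1 - k) |2 u\<^sub>1 + (1 - x) u\<^sub>2|\<^sup>2 + 2 k (1 + x) |u\<^sub>1|\<^sup>2\<close> for the polynomial part \<open>M\<close> of the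
  weight. This is where \<open>0 < k < \<alpha> + 1\<close> enters as positivity.\<close>

lemma weight_form_definite:
  assumes "weight_form v v = 0"
  shows "v = 0"
proof -
  let ?p = "\<Sum>i\<in>UNIV. \<Sum>j\<in>UNIV. v $ i * weight_matrix $ i $ j * map_poly cnj (v $ j)"
  define u where "u i x = poly (v $ i) (complex_of_real x)" for i x
  define g where "g x = (\<alpha> + 1 - k) * (cmod (2 * u 1 x + of_real (1 - x) * u 2 x))\<^sup>2 + 2 * k * (1 + x) * (cmod (u 1 x))\<^sup>2" for x
  have eval: "poly ?p (of_real x) = of_real (g x)" for x
    unfolding g_def of_real_add of_real_mult complex_norm_square
    by (simp add: sum_2 u_def algebra_simps)
  have "?p = 0"
  proof (rule jacobi_integral_nonneg_eq_0[OF \<alpha> \<beta>])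
    show "jacobi_integral \<alpha> \<beta> ?p = 0" using assms by (simp add: row_form_def)
    show "poly ?p (of_real x) = of_real (g x) \<and> 0 \<le> g x" if "x \<in> {-1<..<1}" for x
      using that k_pos k_less eval by (auto simp: g_def)
  qed
  then have g0: "g x = 0" for x using eval[of x] by simp
  have z: "u 1 x = 0 \<and> u 2 x = 0" if "x \<in> {-1<..<1}" for x
  proof -
    have "0 \<le> (\<alpha> + 1 - k) * (cmod (2 * u 1 x + of_real (1 - x) * u 2 x))\<^sup>2" "0 \<le> 2 * k * (1 + x) * (cmod (u 1 x))\<^sup>2"
      using that k_pos k_less by auto
    then have "(\<alpha> + 1 - k) * (cmod (2 * u 1 x + of_real (1 - x) * u 2 x))\<^sup>2 = 0" "2 * k * (1 + x) * (cmod (u 1 x))\<^sup>2 = 0"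
      using g0[of x] unfolding g_def by linarith+
    then have "2 * u 1 x + of_real (1 - x) * u 2 x = 0" "u 1 x = 0"
      using that k_pos k_less by simp_all
    moreover have "complex_of_real (1 - x) \<noteq> 0" using that by (simp only: of_real_eq_0_iff) simp
    ultimately show ?thesis by simp
  qed
  have "v $ i = 0" for i
  proof (rule ccontr)
    assume "v $ i \<noteq> 0"
    then have "finite {z. poly (v $ i) z = 0}" by (rule poly_roots_finite)
    moreover have "complex_of_real ` {-1<..<1} \<subseteq> {z. poly (v $ i) z = 0}"
      using z exhaust_2[of i] by (auto simp: u_def)
    ultimately have "finite (complex_of_real ` {-1<..<1})" by (rule rev_finite_subset)
    then have "finite {-1<..<1::real}" by (rule finite_imageD) (simp add: inj_on_def)
    then show False using infinite_Ioo[of "-1" "1::real"] by simp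
  qed
  then show ?thesis by (simp add: vec_eq_iff)
qed

text \<open>The combinations of \<open>h_row n\<close> and \<open>f_row n\<close> whose leading coefficients form the identity
  matrix.\<close>

definition ortho_poly :: "nat \<Rightarrow> 2 pmat"
  where "ortho_poly n = (let r = [:- 1 / (of_nat n + of_real k):] *s h_row n in
    vector [r, [:of_real (\<alpha> + 1 - k) / (of_nat n + of_real (\<alpha> + \<beta> + 2 - k)):] *s (r - f_row n)])"

lemma ortho_poly_nth:
  "ortho_poly n $ 1 = [:- 1 / (of_nat n + of_real k):] *s h_row n"
  "ortho_poly n $ 2 = [:of_real (\<alpha> + 1 - k) / (of_nat n + of_real (\<alpha> + \<beta> + 2 - k)):] *s
    (ortho_poly n $ 1 - f_row n)"
  by (simp_all add: ortho_poly_def Let_def)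

lemma rows_via_ortho_poly:
  "h_row n = [:- (of_nat n + of_real k):] *s ortho_poly n $ 1"
  "f_row n = ortho_poly n $ 1 - [:(of_nat n + of_real (\<alpha> + \<beta> + 2 - k)) / of_real (\<alpha> + 1 - k):] *s ortho_poly n $ 2"
proof -
  define c where "c = complex_of_real (\<alpha> + 1 - k)"
  define m where "m = of_nat n + complex_of_real (\<alpha> + \<beta> + 2 - k)"
  define l where "l = of_nat n + complex_of_real k"
  have nz: "c \<noteq> 0" "m \<noteq> 0" "l \<noteq> 0"
    using n_plus_k_nonzero[of n] n_plus_sk_nonzero[of n] lift1_denom_nonzero by (simp_all add: c_def m_def l_def)
  have "[:- l:] * [:- 1 / l:] = 1" "[:m / c:] * [:c / m:] = 1"
    using nz by (simp_all add: one_pCons)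
  then show "h_row n = [:- (of_nat n + of_real k):] *s ortho_poly n $ 1"
    "f_row n = ortho_poly n $ 1 - [:(of_nat n + of_real (\<alpha> + \<beta> + 2 - k)) / of_real (\<alpha> + 1 - k):] *s ortho_poly n $ 2"
    unfolding ortho_poly_nth(2) unfolding ortho_poly_nth(1) vector_smult_assoc
      c_def[symmetric] m_def[symmetric] l_def[symmetric] by simp_all
qed

lemma coeff_h_row:
  "coeff (h_row n $ 1) n = - (of_nat n + of_real k)" "coeff (h_row n $ 2) n = 0" "deg_less (Suc n) (h_row n $ s)"
proof -
  have c: "coeff (h_poly n) n = 1" and d: "\<And>j. j \<ge> Suc n \<Longrightarrow> coeff (h_poly n) j = 0"
    using coeff_jacobi_poly[OF shifted_exponents(1) \<beta>] deg_less_jacobi_poly[OF shifted_exponents(1) \<beta>, of n] by auto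
  show "coeff (h_row n $ 1) n = - (of_nat n + of_real k)" "coeff (h_row n $ 2) n = 0"
    using c d by (cases n; simp add: h_row_def coeff_pderiv)+
  show "deg_less (Suc n) (h_row n $ s)"
    using exhaust_2[of s] deg_less_pCons_mult_pderiv[of "Suc n" "h_poly n" 1 "-1"]
      deg_less_pCons_mult_pderiv[of "Suc n" "h_poly n" 1 0]
    by (auto simp: h_row_def d simp del: mult_pCons_left) (auto simp: coeff_pderiv d)
qed

lemma coeff_f_row:
  "coeff (f_row n $ 1) n = 1"
  "coeff (f_row n $ 2) n = - (of_nat n + of_real (\<alpha> + \<beta> + 2 - k)) / of_real (\<alpha> + 1 - k)"
  "deg_less (Suc n) (f_row n $ s)"
proof -
  have c: "coeff (f_poly n) n = 1" and d: "\<And>j. j \<ge> Suc n \<Longrightarrow> coeff (f_poly n) j = 0"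
    using coeff_jacobi_poly[OF shifted_exponents] deg_less_jacobi_poly[OF shifted_exponents, of n] by auto
  have "coeff ([:1, 1:] * pderiv (f_poly n)) n = of_nat n"
    using c d by (cases n) (simp_all add: coeff_pderiv)
  then show "coeff (f_row n $ 1) n = 1"
    "coeff (f_row n $ 2) n = - (of_nat n + of_real (\<alpha> + \<beta> + 2 - k)) / of_real (\<alpha> + 1 - k)"
    by (simp_all add: f_row_def c diff_divide_distrib add_divide_distrib del: mult_pCons_left)
  show "deg_less (Suc n) (f_row n $ s)"
    using exhaust_2[of s] deg_less_pCons_mult_pderiv[of "Suc n" "f_poly n" 1 1]
    by (auto simp: f_row_def d simp del: mult_pCons_left)
qed

lemma monic_ortho_poly: "monic_pmat n (ortho_poly n)"
proof -
  let ?P = "ortho_poly n"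
  have "deg_less (Suc n) (?P $ 1 $ s)" for s
    using coeff_h_row(3)[of n s] by (simp add: ortho_poly_nth)
  moreover from this have "deg_less (Suc n) (?P $ 2 $ s)" for s
    using coeff_f_row(3)[of n s] by (simp add: ortho_poly_nth(2))
  ultimately have "deg_less (Suc n) (?P $ r $ s)" for r s
    using exhaust_2[of r] by auto
  then have "degree (?P $ r $ s) \<le> n" for r s
    by (intro degree_le) (auto simp: Suc_le_eq)
  moreover have "- 1 / (of_nat n + of_real k) * - (of_nat n + complex_of_real k) = 1"
    using n_plus_k_nonzero[of n] by (simp add: field_simps)
  then have "coeff (?P $ 1 $ 1) n = 1" "coeff (?P $ 1 $ 2) n = 0"
    using coeff_h_row(1,2)[of n] by (simp_all add: ortho_poly_nth)
  moreover from this have "coeff (?P $ 2 $ 1) n = 0"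
    using coeff_f_row(1)[of n] by (simp add: ortho_poly_nth(2))
  moreover have "coeff (?P $ 2 $ 2) n = 1"
  proof -
    have "c \<noteq> 0 \<Longrightarrow> m \<noteq> 0 \<Longrightarrow> c / m * (0 - (- m / c)) = 1" for c m :: complex by simp
    from this[of "of_real (\<alpha> + 1 - k)", OF _ n_plus_sk_nonzero[of n]] show ?thesis
      using lift1_denom_nonzero \<open>coeff (?P $ 1 $ 2) n = 0\<close> by (simp add: ortho_poly_nth(2) coeff_f_row(2))
  qed
  ultimately show ?thesis
    unfolding monic_pmat_def by (simp add: vec_eq_iff forall_2 mat_def)
qed

lemma ortho_poly_orthogonal:
  assumes "n \<noteq> m"
  shows "weight_form (ortho_poly n $ r) (ortho_poly m $ s) = 0"
proof -
  have lower: "weight_form (ortho_poly n $ r) v = 0" if "\<And>s. deg_less n (v $ s)" for n r v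
  proof -
    have 1: "weight_form (ortho_poly n $ 1) v = 0"
      unfolding ortho_poly_nth(1) row_form_scale using weight_form_rows[OF that] by simp
    have "ortho_poly n $ 1 = (ortho_poly n $ 1 - f_row n) + f_row n" by simp
    then have "weight_form (ortho_poly n $ 1 - f_row n) v = 0"
      using 1 weight_form_rows[OF that] row_form_add(1)[OF \<alpha> \<beta>] by (metis add.right_neutral)
    then have "weight_form (ortho_poly n $ 2) v = 0"
      unfolding ortho_poly_nth(2) row_form_scale by simp
    with 1 show ?thesis using exhaust_2[of r] by auto
  qed
  have deg: "deg_less n (ortho_poly m $ s $ t)" if "m < n" for n m s t
    using monic_pmat_coeff(2)[OF monic_ortho_poly] that by (meson Suc_le_eq order_trans)
  have herm: "map_poly cnj (weight_matrix $ i $ j) = weight_matrix $ j $ i" for i j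
    using exhaust_2[of i] exhaust_2[of j] by (auto simp: map_poly_pCons)
  show ?thesis
  proof (cases "m < n")
    case True
    then show ?thesis by (intro lower deg)
  next
    case False
    then have "weight_form (ortho_poly m $ s) (ortho_poly n $ r) = 0"
      using assms by (intro lower deg) simp
    then show ?thesis
      using row_form_hermitian[of weight_matrix \<alpha> \<beta> "ortho_poly n $ r" "ortho_poly m $ s"] herm by simp
  qed
qed

lemma monic_orthogonal_polys_eq:
  "monic_orthogonal_polys {-1<..<1} (jacobi_weight \<alpha> \<beta> k) = ortho_poly"
  unfolding monic_orthogonal_polys_def
proof (rule the_equality)
  note iff = monic_orthogonal_iff[OF \<alpha> \<beta> jacobi_weight_eq]
  show "monic_orthogonal {-1<..<1} (jacobi_weight \<alpha> \<beta> k) ortho_poly"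
    unfolding iff using monic_ortho_poly ortho_poly_orthogonal by blast
  fix P
  assume "monic_orthogonal {-1<..<1} (jacobi_weight \<alpha> \<beta> k) P"
  then show "P = ortho_poly"
    unfolding iff
    by (intro monic_orthogonal_unique[OF \<alpha> \<beta> weight_form_definite])
      (auto simp: monic_ortho_poly ortho_poly_orthogonal)
qed

section \<open>Classification\<close>

lemma local_op_lift0: "local_op (\<lambda>p. lift0 p $ i)"
proof -
  have "local_op (\<lambda>p. [:1, -1:] * pderiv p - smult (of_real k) p)" "local_op (\<lambda>p. smult (-2) (pderiv p))"
    by (intro local_op_intros)+
  then show ?thesis using exhaust_2[of i] by (auto simp del: mult_pCons_left)
qed

lemma local_op_lift1: "local_op (\<lambda>p. lift1 p $ i)"
proof -
  have "local_op (\<lambda>p. p)" "local_op (\<lambda>p. smult (- 1 / of_real (\<alpha> + 1 - k))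
      ([:1, 1:] * pderiv p + smult (of_real (\<alpha> + \<beta> + 2 - k)) p))"
    by (intro local_op_intros)+
  then show ?thesis using exhaust_2[of i] by (auto simp del: mult_pCons_left)
qed

lemma local_op_proj:
  assumes "\<And>i. local_op (\<lambda>p. V p $ i)"
  shows "local_op (\<lambda>p. proj0 (V p))" "local_op (\<lambda>p. proj1 (V p))"
  unfolding proj0_def proj1_def by (intro local_op_intros assms)+

text \<open>Operators that are diagonal in the basis \<open>h_row n\<close>, \<open>f_row n\<close>, with their eigenvalue
  sequences.\<close>

definition eigen_pair :: "2 dop \<Rightarrow> (nat \<Rightarrow> complex) \<Rightarrow> (nat \<Rightarrow> complex) \<Rightarrow> bool"
  where "eigen_pair D a d \<longleftrightarrow>
    (\<forall>n. row_act D (h_row n) = [:a n:] *s h_row n \<and> row_act D (f_row n) = [:d n:] *s f_row n)"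

lemma eigen_pair_unique:
  assumes "eigen_pair D a d" "eigen_pair E a d"
  shows "D = E"
proof (rule dop_eq_on_monic[of ortho_poly])
  fix n s
  have 1: "row_act D (ortho_poly n $ 1) = row_act E (ortho_poly n $ 1)"
    using assms unfolding eigen_pair_def ortho_poly_nth(1) row_act_scale by simp
  then have "row_act D (ortho_poly n $ 2) = row_act E (ortho_poly n $ 2)"
    using assms unfolding eigen_pair_def ortho_poly_nth(2) row_act_scale row_act_diff by simp
  with 1 show "row_act D (ortho_poly n $ s) = row_act E (ortho_poly n $ s)"
    using exhaust_2[of s] by auto
qed (rule monic_ortho_poly)

lemma eigen_pair_0: "eigen_pair 0 (\<lambda>n. 0) (\<lambda>n. 0)"
  and eigen_pair_1: "eigen_pair 1 (\<lambda>n. 1) (\<lambda>n. 1)"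
  and eigen_pair_D1: "eigen_pair (jacobi_D1 \<alpha> \<beta> k) (\<lambda>n. h_ev n + of_real (\<alpha> + \<beta> + 2 - k)) f_ev"
  and eigen_pair_D2: "eigen_pair (jacobi_D2 \<alpha> \<beta> k) (\<lambda>n. h_ev n - glue0) (\<lambda>n. 0)"
  by (simp_all only: eigen_pair_def row_act_D1_rows row_act_D2_rows) (simp_all flip: one_pCons)

lemma eigen_pair_add:
  assumes "eigen_pair D a d" "eigen_pair E b e"
  shows "eigen_pair (D + E) (\<lambda>n. a n + b n) (\<lambda>n. d n + e n)"
  using assms by (simp add: eigen_pair_def row_act_dop_add vector_sadd_rdistrib[symmetric])

lemma eigen_pair_scale:
  assumes "eigen_pair D a d"
  shows "eigen_pair (dop_scale c D) (\<lambda>n. c * a n) (\<lambda>n. c * d n)"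
  using assms by (simp add: eigen_pair_def row_act_dop_scale vector_smult_assoc mult.commute)

lemma eigen_pair_mult:
  assumes "eigen_pair D a d" "eigen_pair E b e"
  shows "eigen_pair (D * E) (\<lambda>n. a n * b n) (\<lambda>n. d n * e n)"
  using assms by (simp add: eigen_pair_def row_act_times row_act_scale vector_smult_assoc mult.commute)

lemma eigen_pair_power:
  assumes "eigen_pair D a d"
  shows "eigen_pair (D ^ j) (\<lambda>n. a n ^ j) (\<lambda>n. d n ^ j)"
  by (induction j) (use eigen_pair_1 eigen_pair_mult[OF assms] in auto)

lemma eigen_pair_sum:
  "(\<And>i. i \<in> I \<Longrightarrow> eigen_pair (D i) (a i) (d i)) \<Longrightarrow>
    eigen_pair (\<Sum>i\<in>I. D i) (\<lambda>n. \<Sum>i\<in>I. a i n) (\<lambda>n. \<Sum>i\<in>I. d i n)"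
  by (induction I rule: infinite_finite_induct) (auto intro: eigen_pair_0 eigen_pair_add)

lemma weight_algebra_iff:
  "D \<in> weight_algebra {-1<..<1} (jacobi_weight \<alpha> \<beta> k) \<longleftrightarrow>
    (\<forall>n. \<exists>\<Lambda>. dop_act (ortho_poly n) D = pmat_const \<Lambda> ** ortho_poly n)"
  by (simp add: weight_algebra_def monic_orthogonal_polys_eq)

lemma pmat_const_mult_nth:
  "(pmat_const \<Lambda> ** P) $ r = [:\<Lambda> $ r $ 1:] *s P $ 1 + [:\<Lambda> $ r $ 2:] *s P $ 2"
  for P :: "2 pmat"
  by (simp add: vec_eq_iff matrix_mul_nth sum_2 pmat_const_def map_matrix_def)

lemma eigen_pair_imp_weight_algebra:
  assumes "eigen_pair D a d"
  shows "D \<in> weight_algebra {-1<..<1} (jacobi_weight \<alpha> \<beta> k)"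
  unfolding weight_algebra_iff
proof
  fix n
  let ?P = "ortho_poly n"
  obtain l m where h: "?P $ 1 = [:l:] *s h_row n" and f: "?P $ 2 = [:m:] *s (?P $ 1 - f_row n)"
    and f': "\<exists>c. f_row n = ?P $ 1 - [:c:] *s ?P $ 2"
    using ortho_poly_nth[of n] rows_via_ortho_poly(2)[of n] by blast
  obtain c where c: "f_row n = ?P $ 1 - [:c:] *s ?P $ 2" using f' by blast
  have 1: "row_act D (?P $ 1) = [:a n:] *s ?P $ 1"
    using assms unfolding eigen_pair_def h row_act_scale by (simp add: vector_smult_assoc mult.commute)
  have "row_act D (?P $ 2) = [:m:] *s ([:a n:] *s ?P $ 1 - [:d n:] *s f_row n)"
    using assms 1 unfolding eigen_pair_def by (subst f) (simp add: row_act_scale row_act_diff)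
  also have "\<dots> = [:m * (a n - d n):] *s ?P $ 1 + [:m * d n * c:] *s ?P $ 2"
    unfolding c by (simp add: vec_eq_iff algebra_simps smult_diff_left smult_diff_right)
  finally have 2: "row_act D (?P $ 2) = [:m * (a n - d n):] *s ?P $ 1 + [:m * d n * c:] *s ?P $ 2" .
  define L where "L = (mat2 (a n) 0 (m * (a n - d n)) (m * d n * c) :: 2 cmat)"
  have "dop_act ?P D $ r = (pmat_const L ** ?P) $ r" for r
    unfolding dop_act_nth pmat_const_mult_nth using 1 2 exhaust_2[of r] by (auto simp: L_def)
  then show "\<exists>\<Lambda>. dop_act ?P D = pmat_const \<Lambda> ** ?P"
    unfolding vec_eq_iff[of "dop_act _ _"] by blast
qed

text \<open>The rows \<open>h_row n\<close> and \<open>f_row n\<close> span the same two-dimensional space as the rows of the \<open>n\<close>-th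
  orthogonal polynomial, which an operator in the algebra preserves.\<close>

lemma weight_algebra_rows:
  assumes "D \<in> weight_algebra {-1<..<1} (jacobi_weight \<alpha> \<beta> k)"
  shows "\<exists>a b. row_act D (h_row n) = [:a:] *s h_row n + [:b:] *s f_row n"
    and "\<exists>a b. row_act D (f_row n) = [:a:] *s h_row n + [:b:] *s f_row n"
proof -
  let ?P = "ortho_poly n"
  define U where "U = {v. \<exists>a b. v = [:a:] *s h_row n + [:b:] *s f_row n}"
  have U_add: "v + w \<in> U" if v: "v \<in> U" and w: "w \<in> U" for v w
  proof -
    obtain a b where "v = [:a:] *s h_row n + [:b:] *s f_row n"
      using v unfolding U_def by blast
    moreover obtain a' b' where "w = [:a':] *s h_row n + [:b':] *s f_row n"
      using w unfolding U_def by blast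
    ultimately have "v + w = [:a + a':] *s h_row n + [:b + b':] *s f_row n"
      by (simp add: vec_eq_iff smult_add_left)
    then show ?thesis unfolding U_def by blast
  qed
  have U_scale: "[:c:] *s v \<in> U" if v: "v \<in> U" for v c
  proof -
    obtain a b where "v = [:a:] *s h_row n + [:b:] *s f_row n"
      using v unfolding U_def by blast
    then have "[:c:] *s v = [:c * a:] *s h_row n + [:c * b:] *s f_row n"
      by (simp add: vec_eq_iff smult_add_right)
    then show ?thesis unfolding U_def by blast
  qed
  have U_diff: "v - w \<in> U" if "v \<in> U" "w \<in> U" for v w
  proof -
    have "v - w = v + [:-1:] *s w" by (simp add: vec_eq_iff)
    then show ?thesis using U_add[OF that(1) U_scale[OF that(2), of "-1"]] by metis
  qed
  have "h_row n = [:1:] *s h_row n + [:0:] *s f_row n" "f_row n = [:0:] *s h_row n + [:1:] *s f_row n"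
    by (simp_all add: vec_eq_iff)
  then have "h_row n \<in> U" "f_row n \<in> U" unfolding U_def by blast+
  then have "?P $ 1 \<in> U" unfolding ortho_poly_nth(1) by (intro U_scale)
  then have "?P $ 2 \<in> U" unfolding ortho_poly_nth(2) using \<open>f_row n \<in> U\<close> by (intro U_scale U_diff)
  obtain L where "dop_act ?P D = pmat_const L ** ?P"
    using assms unfolding weight_algebra_iff by blast
  then have "row_act D (?P $ r) = [:L $ r $ 1:] *s ?P $ 1 + [:L $ r $ 2:] *s ?P $ 2" for r
    by (metis dop_act_nth pmat_const_mult_nth)
  then have P: "row_act D (?P $ r) \<in> U" for r
    using \<open>?P $ 1 \<in> U\<close> \<open>?P $ 2 \<in> U\<close> U_add U_scale by simp
  have "row_act D (h_row n) \<in> U" "row_act D (f_row n) \<in> U"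
    unfolding rows_via_ortho_poly[of n] row_act_diff row_act_scale by (intro U_scale U_diff P)+
  then show "\<exists>a b. row_act D (h_row n) = [:a:] *s h_row n + [:b:] *s f_row n"
    "\<exists>a b. row_act D (f_row n) = [:a:] *s h_row n + [:b:] *s f_row n"
    unfolding U_def by blast+
qed

text \<open>Composing \<open>D\<close> with \<open>lift0\<close> and \<open>proj1\<close> isolates one off-diagonal entry as a scalar differential
  operator from one Jacobi family to the other, and \<open>lift1\<close> with \<open>proj0\<close> isolates the other entry.
  Neither operator can be different from zero on its family.\<close>

lemma weight_algebra_diagonal:
  assumes "D \<in> weight_algebra {-1<..<1} (jacobi_weight \<alpha> \<beta> k)"
  shows "\<exists>a d. eigen_pair D a d"
proof -
  obtain a b where ab: "\<And>n. row_act D (h_row n) = [:a n:] *s h_row n + [:b n:] *s f_row n"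
    using weight_algebra_rows(1)[OF assms] by metis
  obtain c d where cd: "\<And>n. row_act D (f_row n) = [:c n:] *s h_row n + [:d n:] *s f_row n"
    using weight_algebra_rows(2)[OF assms] by metis
  have "local_op (\<lambda>p. proj1 (row_act D (lift0 p)))"
    by (intro local_op_proj local_op_row_act local_op_lift0)
  moreover have "proj1 (row_act D (lift0 (h_poly n))) = smult (b n * (f_ev n - glue1)) (f_poly n)" for n
    using ab[of n] by (simp add: proj1_add proj1_scale proj1_h_row proj1_f_row flip: h_row_def)
  ultimately have b: "b n * (f_ev n - glue1) = 0" for n
    by (rule no_intertwiner_up[OF _ shifted_exponents(1) \<beta>])
  have "local_op (\<lambda>p. proj0 (row_act D (lift1 p)))"
    by (intro local_op_proj local_op_row_act local_op_lift1)
  moreover have "proj0 (row_act D (lift1 (f_poly n))) = smult (c n * (h_ev n - glue0)) (h_poly n)" for n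
    using cd[of n] by (simp add: proj0_add proj0_scale proj0_h_row proj0_f_row flip: f_row_def)
  ultimately have c: "c n * (h_ev n - glue0) = 0" for n
    by (rule no_intertwiner_down[OF _ shifted_exponents(1) \<beta>])
  have "b n = 0" "c n = 0" for n
    using b[of n] c[of n] h_ev_nonzero[of n] f_ev_nonzero[of n] by auto
  then have "eigen_pair D a d"
    using ab cd by (simp add: eigen_pair_def)
  then show ?thesis by blast
qed

abbreviation h_jet :: "nat \<Rightarrow> complex poly" where "h_jet \<equiv> jet_poly (\<alpha> + 1) \<beta> True"
abbreviation f_jet :: "nat \<Rightarrow> complex poly" where "f_jet \<equiv> jet_poly (\<alpha> + 1) (\<beta> + 1) True"

lemma jet_poly_Suc:
  assumes "a > -1" "b > -1"
  shows "jet_denom a b r j * poly (jet_poly a b r (Suc j)) \<mu> = (\<mu> - jacobi_eigenvalue a b j) * poly (jet_poly a b r j) \<mu>"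
  using jet_denom_nonzero[OF assms, of r j] by (simp add: poly_jet_poly)

lemma k_nonzero: "complex_of_real k \<noteq> 0" using k_pos by simp

text \<open>Let \<open>h\<close> solve, up to high order at \<open>1\<close>, the equation \<open>proj0 (lift0 h) = 0\<close>. Then \<open>lift0 h\<close> lies in the kernel
  of \<open>proj0\<close>, which consists of vectors \<open>lift1 g\<close>; here \<open>g = - k f\<close>, and \<open>f\<close> solves
  \<open>proj1 (lift1 f) = 0\<close> since \<open>proj1 \<circ> lift0 = 0\<close>. So the two families of eigenfunctions, continued to the
  eigenvalues \<open>glue0\<close> and \<open>glue1\<close>, meet in a common vector. The factor \<open>- 1 / k\<close> normalizes
  \<open>f\<close> to the value \<open>1\<close> at \<open>1\<close> when \<open>h\<close> has this value. The proof verifies this on Taylor coefficients.\<close>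

lemma glued_jets:
  assumes h: "\<And>j. j < N \<Longrightarrow> poly ((pderiv ^^ j) h) 1 = poly (h_jet j) glue0"
  defines "f \<equiv> smult (- 1 / of_real k) (lift0 h $ 1)"
  shows "j < N \<Longrightarrow> poly ((pderiv ^^ j) f) 1 = poly (f_jet j) glue1"
    and "Suc j < N \<Longrightarrow> poly ((pderiv ^^ j) ((lift0 h + [:of_real k:] *s lift1 f) $ i)) 1 = 0"
proof -
  define K where "K = complex_of_real k"
  define c where "c = complex_of_real (\<alpha> + 1 - k)"
  have K: "K \<noteq> 0" using k_nonzero by (simp add: K_def)
  have c: "c \<noteq> 0" using lift1_denom_nonzero by (simp add: c_def)
  let ?y = "\<lambda>j. poly ((pderiv ^^ j) h) 1"
  have fy: "poly ((pderiv ^^ j) f) 1 = (of_nat j + K) / K * ?y j" for j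
    unfolding f_def lift0_nth higher_pderiv_smult higher_pderiv_diff higher_pderiv_linear_mult
    using K by (simp add: K_def[symmetric] field_simps)
  have step: "- 2 * (of_nat j + of_real \<alpha> + 2) * ?y (Suc j) =
      (of_nat j + K) * (of_nat j + of_real (\<alpha> + \<beta> + 2 - k)) * ?y j" if "Suc j < N" for j
  proof -
    have "glue0 - h_ev j = (of_nat j + K) * (of_nat j + of_real (\<alpha> + \<beta> + 2 - k))"
      using h_ev_factor[of j] by (simp add: K_def algebra_simps)
    moreover have "jet_denom (\<alpha> + 1) \<beta> True j = - 2 * (of_nat j + of_real \<alpha> + 2)"
      by (simp add: jet_denom_def)
    ultimately show ?thesis
      using jet_poly_Suc[OF shifted_exponents(1) \<beta>, of True j glue0] h[of j] h[OF that] that by simp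
  qed
  show "poly ((pderiv ^^ j) f) 1 = poly (f_jet j) glue1" if "j < N"
    using that
  proof (induction j)
    case 0
    then show ?case using h[of 0] fy[of 0] K by (simp add: poly_jet_poly)
  next
    case (Suc j)
    have "glue1 - f_ev j = (of_nat j + 1 + K) * (of_nat j + of_real (\<alpha> + \<beta> + 2 - k))"
      using f_ev_factor[of j] by (simp add: K_def algebra_simps)
    moreover have "jet_denom (\<alpha> + 1) (\<beta> + 1) True j = - 2 * (of_nat j + of_real \<alpha> + 2)"
      by (simp add: jet_denom_def)
    ultimately have "- 2 * (of_nat j + of_real \<alpha> + 2) * poly (f_jet (Suc j)) glue1 =
        (of_nat j + 1 + K) * (of_nat j + of_real (\<alpha> + \<beta> + 2 - k)) * ((of_nat j + K) / K * ?y j)"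
      using jet_poly_Suc[OF shifted_exponents, of True j glue1] Suc fy[of j] by simp
    also have "\<dots> = (of_nat j + 1 + K) / K * (- 2 * (of_nat j + of_real \<alpha> + 2) * ?y (Suc j))"
      unfolding step[OF Suc.prems] by simp
    also have "\<dots> = - 2 * (of_nat j + of_real \<alpha> + 2) * poly ((pderiv ^^ Suc j) f) 1"
      unfolding fy by simp
    finally have "jet_denom (\<alpha> + 1) (\<beta> + 1) True j * poly (f_jet (Suc j)) glue1 =
        jet_denom (\<alpha> + 1) (\<beta> + 1) True j * poly ((pderiv ^^ Suc j) f) 1"
      by (simp add: jet_denom_def)
    then show ?case using jet_denom_nonzero[OF shifted_exponents, of True j] by simp
  qed
  show "poly ((pderiv ^^ j) ((lift0 h + [:of_real k:] *s lift1 f) $ i)) 1 = 0" if "Suc j < N"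
  proof (cases "i = 1")
    case True
    have "(lift0 h + [:of_real k:] *s lift1 f) $ 1 = 0"
      using k_nonzero by (simp add: f_def smult_diff_right)
    then show ?thesis using True by simp
  next
    case False
    then have i: "i = 2" using exhaust_2 by blast
    have "poly ((pderiv ^^ j) (lift1 f $ 2)) 1 = - 1 / c *
        (2 * ((of_nat j + 1 + K) / K * ?y (Suc j)) + (of_nat j + of_real (\<alpha> + \<beta> + 2 - k)) * ((of_nat j + K) / K * ?y j))"
      unfolding lift1_nth higher_pderiv_smult higher_pderiv_add higher_pderiv_linear_mult c_def[symmetric]
        poly_smult poly_add poly_mult fy
      by (simp add: algebra_simps add_divide_distrib diff_divide_distrib)
    also have "\<dots> = - 1 / (c * K) * (2 * (of_nat j + 1 + K) * ?y (Suc j) +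
        (of_nat j + K) * (of_nat j + of_real (\<alpha> + \<beta> + 2 - k)) * ?y j)"
      using c K by (simp add: field_simps)
    also have "\<dots> = - 1 / (c * K) * (2 * (K - 1 - of_real \<alpha>) * ?y (Suc j))"
      unfolding step[OF that, symmetric] by (simp add: algebra_simps)
    also have "\<dots> = 2 / K * ?y (Suc j)"
    proof -
      have "K - 1 - of_real \<alpha> = - c" by (simp add: K_def c_def)
      then show ?thesis using c by simp
    qed
    finally have "poly ((pderiv ^^ j) (lift1 f $ 2)) 1 = 2 / K * ?y (Suc j)" .
    moreover have "(pderiv ^^ j) ((lift0 h + [:of_real k:] *s lift1 f) $ 2) =
        smult (- 2) ((pderiv ^^ Suc j) h) + smult K ((pderiv ^^ j) (lift1 f $ 2))"
      by (simp only: vector_add_component vector_smult_component lift0_nth higher_pderiv_add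
          higher_pderiv_smult funpow_Suc_right o_apply K_def mult_pCons_left mult_zero_left pCons_0_0 add_0_right)
    ultimately show ?thesis
      using K unfolding i by simp
  qed
qed

text \<open>The value at \<open>1\<close> of the first component of \<open>lift0 h \<cdot> D\<close> is a polynomial in the eigenvalue of \<open>h\<close>
  times \<open>h(1)\<close>, and the first component of \<open>lift0 h\<close> is \<open>- k h(1)\<close> there; so the eigenvalues of \<open>D\<close>
  on \<open>h_row\<close> are polynomial in \<open>h_ev\<close>, and likewise on \<open>f_row\<close>. The polynomials also describe \<open>D\<close> on
  the common vector of \<open>glued_jets\<close>, and hence agree there.\<close>

lemma weight_algebra_polynomial:
  assumes "D \<in> weight_algebra {-1<..<1} (jacobi_weight \<alpha> \<beta> k)"
  shows "\<exists>A B. eigen_pair D (\<lambda>n. poly A (h_ev n)) (\<lambda>n. poly B (f_ev n)) \<and> poly A glue0 = poly B glue1"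
proof -
  obtain a d where ad: "eigen_pair D a d" using weight_algebra_diagonal[OF assms] by blast
  have "local_op (\<lambda>p. row_act D (lift0 p) $ 1)" "local_op (\<lambda>p. row_act D (lift1 p) $ 1)"
    by (intro local_op_row_act local_op_lift0 local_op_lift1)+
  then have J: "jet_functional 1 (\<lambda>p. poly (row_act D (lift0 p) $ 1) 1)"
    "jet_functional 1 (\<lambda>p. poly (row_act D (lift1 p) $ 1) 1)"
    by (auto dest: local_op_functional)
  obtain M \<Phi> where \<Phi>: "\<And>\<mu> h. (\<forall>j<M. poly ((pderiv ^^ j) h) 1 = poly (h_jet j) \<mu> * poly h 1) \<Longrightarrow>
      poly (row_act D (lift0 h) $ 1) 1 = poly \<Phi> \<mu> * poly h 1"
    using jet_functional_on_family[OF J(1), where \<pi> = h_jet] by blast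
  obtain M' \<Psi> where \<Psi>: "\<And>\<mu> h. (\<forall>j<M'. poly ((pderiv ^^ j) h) 1 = poly (f_jet j) \<mu> * poly h 1) \<Longrightarrow>
      poly (row_act D (lift1 h) $ 1) 1 = poly \<Psi> \<mu> * poly h 1"
    using jet_functional_on_family[OF J(2), where \<pi> = f_jet] by blast
  have a: "a n = poly (smult (- 1 / of_real k) \<Phi>) (h_ev n)" for n
  proof -
    have "poly (row_act D (lift0 (h_poly n)) $ 1) 1 = poly \<Phi> (h_ev n) * poly (h_poly n) 1"
      using jacobi_jet[OF shifted_exponents(1) \<beta> jacobi_op_jacobi_poly[OF shifted_exponents(1) \<beta>], of _ n True]
      by (intro \<Phi>) (simp add: endpoint_def)
    moreover have "row_act D (lift0 (h_poly n)) = [:a n:] *s lift0 (h_poly n)"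
      using ad by (simp add: eigen_pair_def h_row_def)
    ultimately have "(- of_real k * a n) * poly (h_poly n) 1 = poly \<Phi> (h_ev n) * poly (h_poly n) 1"
      by (simp add: mult_ac)
    then have e: "- of_real k * a n = poly \<Phi> (h_ev n)"
      using jacobi_poly_endpoint_nonzero[OF shifted_exponents(1) \<beta>, of n True] by (simp only: endpoint_def mult_cancel_right) simp
    show ?thesis
      unfolding poly_smult e[symmetric] using k_nonzero by simp
  qed
  have d: "d n = poly \<Psi> (f_ev n)" for n
  proof -
    have "poly (row_act D (lift1 (f_poly n)) $ 1) 1 = poly \<Psi> (f_ev n) * poly (f_poly n) 1"
      using jacobi_jet[OF shifted_exponents jacobi_op_jacobi_poly[OF shifted_exponents], of _ n True]
      by (intro \<Psi>) (simp add: endpoint_def)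
    moreover have "row_act D (lift1 (f_poly n)) = [:d n:] *s lift1 (f_poly n)"
      using ad by (simp add: eigen_pair_def f_row_def)
    ultimately show ?thesis
      using jacobi_poly_endpoint_nonzero[OF shifted_exponents, of n True] by (simp add: endpoint_def)
  qed
  obtain M'' where M'': "\<And>v. (\<forall>i. \<forall>j<M''. poly ((pderiv ^^ j) (v $ i)) 1 = 0) \<Longrightarrow> poly (row_act D v $ 1) 1 = 0"
    using row_act_jet_bound by blast
  \<comment> \<open>The extra order accounts for the derivative of \<open>h\<close> in the second component of \<open>lift0 h\<close>.\<close>
  define N where "N = Suc (max M (max M' M''))"
  obtain h where h: "\<And>j. j < N \<Longrightarrow> poly ((pderiv ^^ j) h) 1 = poly (h_jet j) glue0"
    using exists_poly_with_jet[of N 1 "\<lambda>j. poly (h_jet j) glue0"] by blast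
  define f where "f = smult (- 1 / of_real k) (lift0 h $ 1)"
  have f: "poly ((pderiv ^^ j) f) 1 = poly (f_jet j) glue1" if "j < N" for j
    using glued_jets(1)[OF h that] by (simp add: f_def)
  have "poly h 1 = 1" "poly f 1 = 1"
    using h[of 0] f[of 0] by (simp_all add: N_def poly_jet_poly)
  moreover have "poly (row_act D (lift0 h) $ 1) 1 = poly \<Phi> glue0 * poly h 1"
    using h \<open>poly h 1 = 1\<close> by (intro \<Phi>) (simp add: N_def)
  moreover have "poly (row_act D (lift1 f) $ 1) 1 = poly \<Psi> glue1 * poly f 1"
    using f \<open>poly f 1 = 1\<close> by (intro \<Psi>) (simp add: N_def)
  moreover have "poly (row_act D (lift0 h + [:of_real k:] *s lift1 f) $ 1) 1 = 0"
    using glued_jets(2)[OF h] by (intro M'') (auto simp: N_def f_def)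
  ultimately have "poly \<Phi> glue0 + of_real k * poly \<Psi> glue1 = 0"
    by (simp add: row_act_add row_act_scale)
  then have "poly (smult (- 1 / of_real k) \<Phi>) glue0 = poly \<Psi> glue1"
    using k_nonzero by (simp add: field_simps add_eq_0_iff)
  moreover have "eigen_pair D (\<lambda>n. poly (smult (- 1 / of_real k) \<Phi>) (h_ev n)) (\<lambda>n. poly \<Psi> (f_ev n))"
    using ad unfolding eigen_pair_def a d .
  ultimately show ?thesis by blast
qed

section \<open>Orders and generators\<close>

text \<open>The leading coefficients of \<open>D\<^sub>1\<^sup>j\<close> and \<open>D\<^sub>2\<^sup>j\<close>, both of order \<open>2 j\<close>, are linearly independent for
  \<open>j > 0\<close>: the first is scalar, the second has a nonzero corner and a vanishing lower row.\<close>

lemma D1_power_coeff: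
  "i > 2 * j \<Longrightarrow> dop_coeff (jacobi_D1 \<alpha> \<beta> k ^ j) i = 0"
  "dop_coeff (jacobi_D1 \<alpha> \<beta> k ^ j) (2 * j) = mat ([:1, 0, -1:] ^ j)"
proof -
  have l': "dop_coeff (jacobi_D1 \<alpha> \<beta> k) 2 = mat [:1, 0, -1:]"
    unfolding jacobi_D1_def second_order_coeff(2)
    by (simp add: vec_eq_iff forall_2 mat_def map_matrix_def map_poly_pCons)
  have b': "dop_coeff (jacobi_D1 \<alpha> \<beta> k) i = 0" if "i > 2" for i
    unfolding jacobi_D1_def by (rule second_order_coeff(1)[OF that])
  have "(\<forall>i>2 * j. dop_coeff (jacobi_D1 \<alpha> \<beta> k ^ j) i = 0) \<and>
      dop_coeff (jacobi_D1 \<alpha> \<beta> k ^ j) (2 * j) = mat ([:1, 0, -1:] ^ j)"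
  proof (induction j)
    case 0
    then show ?case by (simp add: one_dop_def)
  next
    case (Suc j)
    have IH: "i > 2 * j \<Longrightarrow> dop_coeff (jacobi_D1 \<alpha> \<beta> k ^ j) i = 0" for i using Suc.IH by blast
    note t = dop_coeff_times_lead[where m = 2 and l = "2 * j", OF b' IH, folded power_Suc]
    have "mat p ** mat q = (mat (p * q) :: 2 pmat)" for p q
      by (simp add: vec_eq_iff forall_2 matrix_mul_nth sum_2 mat_def)
    then have "dop_coeff (jacobi_D1 \<alpha> \<beta> k ^ Suc j) (2 * Suc j) = mat ([:1, 0, -1:] ^ Suc j)"
      using t(2) Suc.IH l' by (simp only: mult_Suc_right power_Suc)
    moreover have "dop_coeff (jacobi_D1 \<alpha> \<beta> k ^ Suc j) i = 0" if "i > 2 * Suc j" for i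
      using t(1)[of i] that by simp
    ultimately show ?case by blast
  qed
  then show "i > 2 * j \<Longrightarrow> dop_coeff (jacobi_D1 \<alpha> \<beta> k ^ j) i = 0"
    "dop_coeff (jacobi_D1 \<alpha> \<beta> k ^ j) (2 * j) = mat ([:1, 0, -1:] ^ j)"
    by blast+
qed

lemma D2_power_coeff:
  "i > 2 * Suc j \<Longrightarrow> dop_coeff (jacobi_D2 \<alpha> \<beta> k ^ Suc j) i = 0"
  "dop_coeff (jacobi_D2 \<alpha> \<beta> k ^ Suc j) (2 * Suc j) =
    mat2 ([:1, 0, -1:] ^ Suc j) ([:1, 0, -1:] ^ j * [:-2, -2:]) 0 0"
proof -
  have l: "dop_coeff (jacobi_D2 \<alpha> \<beta> k) 2 = mat2 [:1, 0, -1:] [:-2, -2:] 0 0"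
    unfolding jacobi_D2_def second_order_coeff(2)
    by (simp add: vec_eq_iff forall_2 map_matrix_def map_poly_pCons)
  have b: "dop_coeff (jacobi_D2 \<alpha> \<beta> k) i = 0" if "i > 2" for i
    unfolding jacobi_D2_def by (rule second_order_coeff(1)[OF that])
  have "(\<forall>i>2 * Suc j. dop_coeff (jacobi_D2 \<alpha> \<beta> k ^ Suc j) i = 0) \<and>
      dop_coeff (jacobi_D2 \<alpha> \<beta> k ^ Suc j) (2 * Suc j) =
        mat2 ([:1, 0, -1:] ^ Suc j) ([:1, 0, -1:] ^ j * [:-2, -2:]) 0 0"
  proof (induction j)
    case 0
    then show ?case using l b by simp
  next
    case (Suc j)
    have IH: "i > 2 * Suc j \<Longrightarrow> dop_coeff (jacobi_D2 \<alpha> \<beta> k ^ Suc j) i = 0" for i using Suc.IH by blast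
    note t = dop_coeff_times_lead[where m = 2 and l = "2 * Suc j", OF b IH, folded power_Suc]
    have "mat2 p q 0 0 ** mat2 r s 0 0 = (mat2 (p * r) (p * s) 0 0 :: 2 pmat)" for p q r s
      by (simp add: vec_eq_iff forall_2 matrix_mul_nth sum_2)
    then have "dop_coeff (jacobi_D2 \<alpha> \<beta> k ^ Suc (Suc j)) (2 * Suc (Suc j)) =
        mat2 ([:1, 0, -1:] ^ Suc (Suc j)) ([:1, 0, -1:] ^ Suc j * [:-2, -2:]) 0 0"
      using t(2) Suc.IH l by (simp only: mult_Suc_right power_Suc mult.assoc)
    moreover have "dop_coeff (jacobi_D2 \<alpha> \<beta> k ^ Suc (Suc j)) i = 0" if "i > 2 * Suc (Suc j)" for i
      using t(1)[of i] that by simp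
    ultimately show ?case by blast
  qed
  then show "i > 2 * Suc j \<Longrightarrow> dop_coeff (jacobi_D2 \<alpha> \<beta> k ^ Suc j) i = 0"
    "dop_coeff (jacobi_D2 \<alpha> \<beta> k ^ Suc j) (2 * Suc j) =
      mat2 ([:1, 0, -1:] ^ Suc j) ([:1, 0, -1:] ^ j * [:-2, -2:]) 0 0"
    by blast+
qed

text \<open>The operators \<open>p(D\<^sub>1) + q(D\<^sub>2)\<close>. They exhaust the polynomials in \<open>D\<^sub>1\<close> and \<open>D\<^sub>2\<close>, because
  \<open>D\<^sub>2 (D\<^sub>1 - D\<^sub>2 - glue1) = 0\<close> turns mixed products into polynomials in \<open>D\<^sub>2\<close>.\<close>

definition polynomial_form :: "nat \<Rightarrow> (nat \<Rightarrow> complex) \<Rightarrow> (nat \<Rightarrow> complex) \<Rightarrow> 2 dop"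
  where "polynomial_form N a b =
    (\<Sum>j\<le>N. dop_scale (a j) (jacobi_D1 \<alpha> \<beta> k ^ j)) + (\<Sum>j\<le>N. dop_scale (b j) (jacobi_D2 \<alpha> \<beta> k ^ j))"

text \<open>The highest index at which \<open>a\<close> or \<open>b\<close> is nonzero determines the order, because the leading
  coefficients of the two powers cannot cancel.\<close>

lemma even_order_polynomial_form: "even (dop_order (polynomial_form N a b))"
proof (induction N)
  case 0
  have "dop_coeff (polynomial_form 0 a b) j = 0" if "j > 0" for j
    using that by (simp add: polynomial_form_def one_dop_def vec_eq_iff)
  then have "dop_order (polynomial_form 0 a b) = 0"
    unfolding dop_order_def by (intro Least_eq_0) simp
  then show ?case by simp
next
  case (Suc N)
  let ?D = "polynomial_form (Suc N) a b"
  have top: "dop_coeff ?D i = dop_coeff (dop_scale (a (Suc N)) (jacobi_D1 \<alpha> \<beta> k ^ Suc N)) i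
      + dop_coeff (dop_scale (b (Suc N)) (jacobi_D2 \<alpha> \<beta> k ^ Suc N)) i" if "i \<ge> 2 * Suc N" for i
  proof -
    have "dop_coeff (dop_scale (a j) (jacobi_D1 \<alpha> \<beta> k ^ j)) i = 0" if "j \<le> N" for j
      using D1_power_coeff(1)[of j i] that \<open>i \<ge> _\<close> by (simp add: vec_eq_iff)
    moreover have "dop_coeff (dop_scale (b j) (jacobi_D2 \<alpha> \<beta> k ^ j)) i = 0" if "j \<le> N" for j
      using D2_power_coeff(1)[of "j - 1" i] that \<open>i \<ge> _\<close>
      by (cases j) (simp_all add: vec_eq_iff one_dop_def del: power_Suc)
    ultimately show ?thesis
      by (simp add: polynomial_form_def dop_coeff_sum del: power_Suc dop_coeff_scale)
  qed
  show ?case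
  proof (cases "a (Suc N) = 0 \<and> b (Suc N) = 0")
    case True
    have "dop_scale 0 D = 0" for D :: "2 dop" by (rule dop_eqI) (simp add: vec_eq_iff)
    then have "?D = polynomial_form N a b" using True by (simp add: polynomial_form_def)
    then show ?thesis using Suc.IH by simp
  next
    case False
    have "dop_order ?D = 2 * Suc N"
    proof (rule dop_order_eqI)
      show "dop_coeff ?D i = 0" if "i > 2 * Suc N" for i
        using D1_power_coeff(1)[OF that] D2_power_coeff(1)[OF that] top[of i] that
        by (simp add: vec_eq_iff del: power_Suc)
      have "dop_coeff ?D (2 * Suc N) $ 1 $ 2 = smult (b (Suc N)) ([:1, 0, -1:] ^ N * [:-2, -2:])"
        "dop_coeff ?D (2 * Suc N) $ 2 $ 2 = smult (a (Suc N)) ([:1, 0, -1:] ^ Suc N)"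
        by (simp_all only: top[OF order_refl] dop_coeff_scale D1_power_coeff(2) D2_power_coeff(2))
          (simp_all add: map_matrix_def mat_def)
      moreover have "([:1, 0, -1:] :: complex poly) ^ j \<noteq> 0" for j by simp
      ultimately have "dop_coeff ?D (2 * Suc N) $ 1 $ 2 \<noteq> 0 \<or> dop_coeff ?D (2 * Suc N) $ 2 $ 2 \<noteq> 0"
        using False by (simp only: smult_eq_0_iff mult_eq_0_iff) auto
      then show "dop_coeff ?D (2 * Suc N) \<noteq> 0" by auto
    qed
    then show ?thesis by simp
  qed
qed

lemma eigen_pair_polynomial_form:
  assumes "degree p \<le> N" "degree q \<le> N"
  shows "eigen_pair (polynomial_form N (coeff p) (coeff q))
    (\<lambda>n. poly p (h_ev n + of_real (\<alpha> + \<beta> + 2 - k)) + poly q (h_ev n - glue0))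
    (\<lambda>n. poly p (f_ev n) + poly q 0)"
  unfolding polynomial_form_def poly_altdef_le[OF assms(1)] poly_altdef_le[OF assms(2)]
  by (intro eigen_pair_add eigen_pair_sum eigen_pair_scale eigen_pair_power eigen_pair_D1 eigen_pair_D2)

text \<open>With \<open>p = B\<close> the eigenvalues on \<open>f_row\<close> are correct as soon as \<open>q(0) = 0\<close>; the eigenvalues on
  \<open>h_row\<close> then determine \<open>q\<close>, and \<open>q(0) = 0\<close> is exactly the gluing condition.\<close>

lemma weight_algebra_polynomial_form:
  assumes "D \<in> weight_algebra {-1<..<1} (jacobi_weight \<alpha> \<beta> k)"
  shows "\<exists>N a b. D = polynomial_form N a b"
proof -
  obtain A B where AB: "eigen_pair D (\<lambda>n. poly A (h_ev n)) (\<lambda>n. poly B (f_ev n))"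
    and glue: "poly A glue0 = poly B glue1"
    using weight_algebra_polynomial[OF assms] by blast
  define q where "q = pcompose A [:glue0, 1:] - pcompose B [:glue1, 1:]"
  have q0: "poly q 0 = 0" using glue by (simp add: q_def poly_pcompose)
  have "glue1 - glue0 = of_real (\<alpha> + \<beta> + 2 - k)" by (simp add: glue0_def glue1_def algebra_simps)
  then have qh: "poly B (z + of_real (\<alpha> + \<beta> + 2 - k)) + poly q (z - glue0) = poly A z" for z
    by (simp add: q_def poly_pcompose algebra_simps flip: \<open>glue1 - glue0 = _\<close> of_real_add of_real_diff)
  have "eigen_pair (polynomial_form (max (degree B) (degree q)) (coeff B) (coeff q))
      (\<lambda>n. poly A (h_ev n)) (\<lambda>n. poly B (f_ev n))"
    using eigen_pair_polynomial_form[of B "max (degree B) (degree q)" q] unfolding q0 qh by simp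
  then show ?thesis using eigen_pair_unique[OF AB] by blast
qed

lemma weight_algebra_eq_generated:
  "weight_algebra {-1<..<1} (jacobi_weight \<alpha> \<beta> k) =
    dop_algebra_generated {1, jacobi_D1 \<alpha> \<beta> k, jacobi_D2 \<alpha> \<beta> k}" (is "?W = ?G")
proof
  show "?W \<subseteq> ?G"
  proof
    fix D assume "D \<in> ?W"
    then obtain N a b where "D = polynomial_form N a b" using weight_algebra_polynomial_form by blast
    moreover have "jacobi_D1 \<alpha> \<beta> k \<in> ?G" "jacobi_D2 \<alpha> \<beta> k \<in> ?G"
      by (auto intro: dop_algebra_generated.gen)
    ultimately show "D \<in> ?G"
      unfolding polynomial_form_def
      by (auto intro!: dop_algebra_generated.add generated_sum dop_algebra_generated.scale generated_power)
  qed
  show "?G \<subseteq> ?W"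
  proof
    fix D assume "D \<in> ?G"
    then have "\<exists>a d. eigen_pair D a d"
    proof (induction rule: dop_algebra_generated.induct)
      case (gen D)
      then show ?case using eigen_pair_1 eigen_pair_D1 eigen_pair_D2 by blast
    qed (blast intro: eigen_pair_0 eigen_pair_add eigen_pair_scale eigen_pair_mult)+
    then show "D \<in> ?W" using eigen_pair_imp_weight_algebra by blast
  qed
qed

text \<open>All operators in the algebra are diagonal in the same basis.\<close>

lemma weight_algebra_commute:
  assumes "D \<in> weight_algebra {-1<..<1} (jacobi_weight \<alpha> \<beta> k)"
    and "E \<in> weight_algebra {-1<..<1} (jacobi_weight \<alpha> \<beta> k)"
  shows "D * E = E * D"
proof -
  obtain a d b e where "eigen_pair D a d" "eigen_pair E b e"
    using weight_algebra_diagonal assms by meson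
  then have "eigen_pair (D * E) (\<lambda>n. a n * b n) (\<lambda>n. d n * e n)"
    and "eigen_pair (E * D) (\<lambda>n. a n * b n) (\<lambda>n. d n * e n)"
    using eigen_pair_mult[of D a d E b e] eigen_pair_mult[of E b e D a d] by (simp_all add: mult.commute)
  then show ?thesis by (rule eigen_pair_unique)
qed

end

theorem proposition7p3:
  fixes \<alpha> \<beta> k :: real
  assumes "\<alpha> > -1" and "\<beta> > -1" and "0 < k" and "k < \<alpha> + 1"
  shows "(\<forall>D \<in> weight_algebra {-1<..<1} (jacobi_weight \<alpha> \<beta> k).
            \<forall>E \<in> weight_algebra {-1<..<1} (jacobi_weight \<alpha> \<beta> k). D * E = E * D) \<and>
         (\<forall>D \<in> weight_algebra {-1<..<1} (jacobi_weight \<alpha> \<beta> k). \<not> odd (dop_order D)) \<and>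
         weight_algebra {-1<..<1} (jacobi_weight \<alpha> \<beta> k) =
           dop_algebra_generated {1, jacobi_D1 \<alpha> \<beta> k, jacobi_D2 \<alpha> \<beta> k}"
proof -
  interpret jacobi_type_weight \<alpha> \<beta> k
    using assms by unfold_locales
  show ?thesis
    using weight_algebra_commute weight_algebra_polynomial_form even_order_polynomial_form
      weight_algebra_eq_generated by metis
qed

end
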